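(* Let $(M,g,Q,P)$ be a super-null Riemannian manifold. Then the reduced manifold $M_{red}$, equipped with the reduced metric $g_{red}$, is a pseudo-Riemannian manifold; that is, $g_{red}$ is a non-degenerate symmetric $(0,2)$-tensor on $M_{red}$.
   Context: Supermanifolds are real, finite-dimensional, in the Berezin–Leites (locally ringed space) sense, $M=(|M|,\mathcal{O}_M)$; $C^\infty(M)$ is the superalgebra of global functions, $\mathrm{Vect}(M)$ the $C^\infty(M)$-module of vector fields, $\widetilde{\cdot}$ denotes $\mathbb{Z}_2$-parity, and $[X,Y]=XY-(-1)^{\widetilde X\widetilde Y}YX$ is the graded commutator. A metric $g$ on $M$ is an even, graded-symmetric, rank 2 covariant tensor, possibly degenerate; it determines a pairing $\langle X|Y\rangle$ with $\widetilde{\langle X|Y\rangle}=\widetilde X+\widetilde Y$, $\langle X|Y\rangle=(-1)^{\widetilde X\widetilde Y}\langle Y|X\rangle$, $\langle fX+Y|Z\rangle=f\langle X|Z\rangle+\langle Y|Z\rangle$. Its kernel is $\ker(g)=\{X\in\mathrm{Vect}(M) : \langle X|Y\rangle=0\ \text{for all } Y\in\mathrm{Vect}(M)\}$; $g$ is degenerate if $\ker(g)\neq\{0\}$. A super-null Riemannian manifold is a quadruple $(M,g,Q,P)$ where $M$ is a supermanifold of dimension $n|1$ ($n\ge 1$), $g$ is a degenerate (even) metric on $M$, $Q\in\mathrm{Vect}(M)$ is a non-singular odd vector field (i.e. its value in $T_mM$ is nonzero at every point $m\in|M|$) with $[Q,Q]=2P$ for an even vector field $P$, and $\ker(g)=\mathrm{Span}\{Q\}$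 (the $C^\infty(M)$-span). It is part of the setting that the rank of the kernel is constant, equal to $0|1$ (at every point $m\in |M|$ the bilinear form induced by $g$ on $T_mM$ has kernel of dimension $0|1$), and that around every point of $|M|$ there are Shander coordinates $(x^a,t,\tau)$, with $x^a,t$ even and $\tau$ odd, in which $Q=\partial_\tau+\tau\partial_t$ and $P=\partial_t$. The reduced manifold $M_{red}=(|M|,C^\infty_{|M|})$ is the smooth manifold underlying $M$, with canonical morphism $\epsilon:\mathcal{O}_M\to C^\infty_{|M|}$. A lift of a vector field $\bar X$ on $M_{red}$ is an even vector field $X$ on $M$ with $\bar X(\epsilon f)=\epsilon(Xf)$ for all $f$. The reduced metric is $g_{red}(\bar X,\bar Y)=\langle\bar X|\bar Y\rangle_{M_{red}}:=\epsilon(\langle X|Y\rangle)$ for any lifts $X,Y$ of $\bar X,\bar Y$. *)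

theory Defs
  imports "HOL-Analysis.Analysis" "HOL-Algebra.Module" "HOL-Algebra.AbelCoset" "HOL-Library.Z2"
begin

section \<open>Real superalgebras\<close>

text \<open>Parities are elements of the two-element field \<^typ>\<open>bit\<close>, so the parity of a product is a
  sum of parities, and \<open>ksign p q\<close> is the Koszul sign \<open>(-1)\<close> to the power \<open>p q\<close>.\<close>

definition ksign :: "bit \<Rightarrow> bit \<Rightarrow> real" where
  "ksign p q = (if p * q = 0 then 1 else - 1)"

definition real_ring :: "real ring" where
  "real_ring = \<lparr>carrier = UNIV, mult = (*), one = 1, zero = 0, add = (+)\<rparr>"

record 's superalg = "(real, 's) module" +
  gr :: "bit \<Rightarrow> 's set"

text \<open>Supercommutative associative unital real superalgebras.\<close>

definition superalgebra :: "'s superalg \<Rightarrow> bool" where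
  "superalgebra A \<longleftrightarrow>
     ring A \<and> module real_ring A \<and>
     (\<forall>r. \<forall>x \<in> carrier A. \<forall>y \<in> carrier A.
        (r \<odot>\<^bsub>A\<^esub> x) \<otimes>\<^bsub>A\<^esub> y = r \<odot>\<^bsub>A\<^esub> (x \<otimes>\<^bsub>A\<^esub> y) \<and>
        x \<otimes>\<^bsub>A\<^esub> (r \<odot>\<^bsub>A\<^esub> y) = r \<odot>\<^bsub>A\<^esub> (x \<otimes>\<^bsub>A\<^esub> y)) \<and>
     (\<forall>p. submodule (gr A p) real_ring A) \<and>
     gr A 0 <+>\<^bsub>A\<^esub> gr A 1 = carrier A \<and>
     gr A 0 \<inter> gr A 1 = {\<zero>\<^bsub>A\<^esub>} \<and>
     \<one>\<^bsub>A\<^esub> \<in> gr A 0 \<and>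
     (\<forall>p q. \<forall>x \<in> gr A p. \<forall>y \<in> gr A q.
        x \<otimes>\<^bsub>A\<^esub> y \<in> gr A (p + q) \<and>
        x \<otimes>\<^bsub>A\<^esub> y = ksign p q \<odot>\<^bsub>A\<^esub> (y \<otimes>\<^bsub>A\<^esub> x))"

definition superalg_hom :: "'s superalg \<Rightarrow> 't superalg \<Rightarrow> ('s \<Rightarrow> 't) set" where
  "superalg_hom A B =
     {h \<in> ring_hom A B.
        (\<forall>r. \<forall>x \<in> carrier A. h (r \<odot>\<^bsub>A\<^esub> x) = r \<odot>\<^bsub>B\<^esub> h x) \<and>
        (\<forall>p. h ` gr A p \<subseteq> gr B p)}"

section \<open>Superringed spaces\<close>

text \<open>\<open>sec M U\<close> is the algebra of sections over an open set \<open>U\<close>, and \<open>res M U W\<close> is the restriction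
  map from \<open>U\<close> to \<open>W\<close>; both are meaningful on open sets only.\<close>

record ('a, 's) superspace =
  base :: "'a topology"
  sec :: "'a set \<Rightarrow> 's superalg"
  res :: "'a set \<Rightarrow> 'a set \<Rightarrow> 's \<Rightarrow> 's"

abbreviation points :: "('a, 's) superspace \<Rightarrow> 'a set" where
  "points M \<equiv> topspace (base M)"

definition opens :: "('a, 's) superspace \<Rightarrow> 'a set \<Rightarrow> 'a set set" where
  "opens M U = {W. openin (base M) W \<and> W \<subseteq> U}"

definition nbhds :: "('a, 's) superspace \<Rightarrow> 'a \<Rightarrow> 'a set set" where
  "nbhds M m = {W. openin (base M) W \<and> m \<in> W}"

definition superringed_space :: "('a, 's) superspace \<Rightarrow> bool" where
  "superringed_space M \<longleftrightarrow>
     (\<forall>U \<in> opens M (points M). superalgebra (sec M U)) \<and>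
     (\<forall>U \<in> opens M (points M). \<forall>W \<in> opens M U. res M U W \<in> superalg_hom (sec M U) (sec M W)) \<and>
     (\<forall>U \<in> opens M (points M). \<forall>s \<in> carrier (sec M U). res M U U s = s) \<and>
     (\<forall>U \<in> opens M (points M). \<forall>V \<in> opens M U. \<forall>W \<in> opens M V. \<forall>s \<in> carrier (sec M U).
        res M V W (res M U V s) = res M U W s) \<and>
     (\<forall>\<U> s. \<U> \<subseteq> opens M (points M) \<and> (\<forall>W \<in> \<U>. s W \<in> carrier (sec M W)) \<and>
        (\<forall>W \<in> \<U>. \<forall>W' \<in> \<U>. res M W (W \<inter> W') (s W) = res M W' (W \<inter> W') (s W')) \<longrightarrow>
        (\<exists>!t. t \<in> carrier (sec M (\<Union>\<U>)) \<and> (\<forall>W \<in> \<U>. res M (\<Union>\<U>) W t = s W)))"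

section \<open>Superdomains and supermanifolds\<close>

definition partial :: "'n::finite \<Rightarrow> (real ^ 'n \<Rightarrow> real) \<Rightarrow> real ^ 'n \<Rightarrow> real" where
  "partial i f x = frechet_derivative f (at x) (axis i 1)"

primrec Ck_on :: "nat \<Rightarrow> (real ^ 'n::finite \<Rightarrow> real) \<Rightarrow> (real ^ 'n) set \<Rightarrow> bool" where
  "Ck_on 0 f S \<longleftrightarrow> continuous_on S f"
| "Ck_on (Suc k) f S \<longleftrightarrow> f differentiable_on S \<and> (\<forall>i. Ck_on k (partial i f) S)"

text \<open>Smooth functions on an open set \<open>W\<close>, taken to be \<open>undefined\<close> outside \<open>W\<close> so that equality of
  functions is equality on \<open>W\<close>.\<close>

definition smooth_funs :: "(real ^ 'n::finite) set \<Rightarrow> (real ^ 'n \<Rightarrow> real) set" where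
  "smooth_funs W = {f \<in> extensional W. \<forall>k. Ck_on k f W}"

text \<open>\<open>superdomain_alg q W\<close> is the tensor product of the smooth functions on \<open>W\<close> with the
  Grassmann algebra on generators indexed by \<open>j < q\<close>. A section \<open>f\<close> stands for the sum over
  \<open>I \<subseteq> {..<q}\<close> of \<open>f I \<theta>\<^sub>I\<close>, where \<open>\<theta>\<^sub>I\<close> is the product of the \<open>\<theta>\<^sub>i\<close>, \<open>i \<in> I\<close>, in increasing order;
  for disjoint \<open>I\<close>, \<open>J\<close> one has \<open>\<theta>\<^sub>I \<theta>\<^sub>J = grass_sign I J \<theta>\<^bsub>I \<union> J\<^esub>\<close>.\<close>

definition grass_sign :: "nat set \<Rightarrow> nat set \<Rightarrow> real" where
  "grass_sign I J = (- 1) ^ card {(i, j) \<in> I \<times> J. j < i}"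

type_synonym 'n superfun = "nat set \<Rightarrow> real ^ 'n \<Rightarrow> real"

definition superdomain_alg :: "nat \<Rightarrow> (real ^ 'n::finite) set \<Rightarrow> 'n superfun superalg" where
  "superdomain_alg q W =
     \<lparr>carrier = (\<Pi>\<^sub>E I \<in> Pow {..<q}. smooth_funs W),
      mult = (\<lambda>f h. \<lambda>K \<in> Pow {..<q}. \<lambda>x \<in> W. \<Sum>I \<in> Pow K. grass_sign I (K - I) * f I x * h (K - I) x),
      one = (\<lambda>K \<in> Pow {..<q}. \<lambda>x \<in> W. if K = {} then 1 else 0),
      zero = (\<lambda>K \<in> Pow {..<q}. \<lambda>x \<in> W. 0),
      add = (\<lambda>f h. \<lambda>K \<in> Pow {..<q}. \<lambda>x \<in> W. f K x + h K x),
      smult = (\<lambda>r f. \<lambda>K \<in> Pow {..<q}. \<lambda>x \<in> W. r * f K x),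
      gr = (\<lambda>p. {f \<in> \<Pi>\<^sub>E I \<in> Pow {..<q}. smooth_funs W.
                   \<forall>K \<in> Pow {..<q}. of_nat (card K) \<noteq> p \<longrightarrow> f K = (\<lambda>x \<in> W. 0)})\<rparr>"

definition superdomain_res :: "nat \<Rightarrow> (real ^ 'n::finite) set \<Rightarrow> 'n superfun \<Rightarrow> 'n superfun" where
  "superdomain_res q W f = (\<lambda>K \<in> Pow {..<q}. restrict (f K) W)"

definition theta :: "nat \<Rightarrow> (real ^ 'n::finite) set \<Rightarrow> nat \<Rightarrow> 'n superfun" where
  "theta q W j = (\<lambda>K \<in> Pow {..<q}. \<lambda>x \<in> W. if K = {j} then 1 else 0)"

definition even_partial ::
    "nat \<Rightarrow> (real ^ 'n::finite) set \<Rightarrow> 'n \<Rightarrow> 'n superfun \<Rightarrow> 'n superfun" where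
  "even_partial q W i f = (\<lambda>K \<in> Pow {..<q}. \<lambda>x \<in> W. partial i (f K) x)"

text \<open>The left derivative along \<open>\<theta>\<^sub>j\<close>: the sign comes from moving \<open>\<theta>\<^sub>j\<close> to the front.\<close>

definition odd_partial ::
    "nat \<Rightarrow> (real ^ 'n::finite) set \<Rightarrow> nat \<Rightarrow> 'n superfun \<Rightarrow> 'n superfun" where
  "odd_partial q W j f =
     (\<lambda>K \<in> Pow {..<q}. \<lambda>x \<in> W. if j \<in> K then 0 else grass_sign {j} K * f (insert j K) x)"

text \<open>A chart on \<open>U\<close> is an isomorphism of superringed spaces from \<open>U\<close> onto a superdomain with
  underlying open set \<open>\<phi> ` U\<close>; \<open>\<psi> W\<close> is the pullback of superfunctions on \<open>W \<subseteq> \<phi> ` U\<close>.\<close>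

definition super_chart ::
    "nat \<Rightarrow> ('a, 's) superspace \<Rightarrow> 'a set \<Rightarrow> ('a \<Rightarrow> real ^ 'n::finite)
      \<Rightarrow> ((real ^ 'n) set \<Rightarrow> 'n superfun \<Rightarrow> 's) \<Rightarrow> bool" where
  "super_chart q M U \<phi> \<psi> \<longleftrightarrow>
     openin (base M) U \<and> open (\<phi> ` U) \<and>
     homeomorphic_map (subtopology (base M) U) (top_of_set (\<phi> ` U)) \<phi> \<and>
     (\<forall>W. open W \<and> W \<subseteq> \<phi> ` U \<longrightarrow>
        \<psi> W \<in> superalg_hom (superdomain_alg q W) (sec M (U \<inter> \<phi> -` W)) \<and>
        bij_betw (\<psi> W) (carrier (superdomain_alg q W)) (carrier (sec M (U \<inter> \<phi> -` W)))) \<and>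
     (\<forall>W W'. open W \<and> open W' \<and> W' \<subseteq> W \<and> W \<subseteq> \<phi> ` U \<longrightarrow>
        (\<forall>f \<in> carrier (superdomain_alg q W).
           \<psi> W' (superdomain_res q W' f) = res M (U \<inter> \<phi> -` W) (U \<inter> \<phi> -` W') (\<psi> W f)))"

text \<open>Supermanifolds of dimension \<open>CARD('n)|q\<close>; the first argument only carries the type \<open>'n\<close>.
  For \<open>q = 0\<close> these are the ordinary smooth manifolds of dimension \<open>CARD('n)\<close>.\<close>

definition supermanifold :: "'n::finite itself \<Rightarrow> nat \<Rightarrow> ('a, 's) superspace \<Rightarrow> bool" where
  "supermanifold n q M \<longleftrightarrow>
     superringed_space M \<and> Hausdorff_space (base M) \<and> second_countable (base M) \<and>
     (\<forall>m \<in> points M. \<exists>U (\<phi> :: 'a \<Rightarrow> real ^ 'n) \<psi>. m \<in> U \<and> super_chart q M U \<phi> \<psi>)"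

section \<open>The reduced manifold\<close>

text \<open>The value of a section \<open>s\<close> at \<open>m\<close> is the real number \<open>r\<close> for which \<open>s - r\<close> lies in the maximal
  ideal of the stalk at \<open>m\<close>, i.e. is not invertible on any neighbourhood of \<open>m\<close>.\<close>

definition eps :: "('a, 's) superspace \<Rightarrow> 'a set \<Rightarrow> 's \<Rightarrow> 'a \<Rightarrow> real" where
  "eps M U s = (\<lambda>m \<in> U. THE r. \<forall>W \<in> nbhds M m. W \<subseteq> U \<longrightarrow>
     res M U W s \<ominus>\<^bsub>sec M W\<^esub> (r \<odot>\<^bsub>sec M W\<^esub> \<one>\<^bsub>sec M W\<^esub>) \<notin> Units (sec M W))"

definition red_funs :: "('a, 's) superspace \<Rightarrow> 'a set \<Rightarrow> ('a \<Rightarrow> real) set" where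
  "red_funs M U = {h \<in> extensional U. \<forall>m \<in> U. \<exists>W \<in> nbhds M m. W \<subseteq> U \<and>
     (\<exists>s \<in> carrier (sec M W). restrict h W = eps M W s)}"

definition reduced :: "('a, 's) superspace \<Rightarrow> ('a, 'a \<Rightarrow> real) superspace" where
  "reduced M =
     \<lparr>base = base M,
      sec = (\<lambda>U. \<lparr>carrier = red_funs M U,
                  mult = (\<lambda>f h. \<lambda>x \<in> U. f x * h x),
                  one = (\<lambda>x \<in> U. 1),
                  zero = (\<lambda>x \<in> U. 0),
                  add = (\<lambda>f h. \<lambda>x \<in> U. f x + h x),
                  smult = (\<lambda>r f. \<lambda>x \<in> U. r * f x),
                  gr = (\<lambda>p. if p = 0 then red_funs M U else {\<lambda>x \<in> U. 0})\<rparr>),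
      res = (\<lambda>U W f. restrict f W)\<rparr>"

section \<open>Vector fields\<close>

text \<open>A vector field on \<open>U\<close> is a derivation of the structure sheaf restricted to \<open>U\<close>: a family of
  maps indexed by the open subsets \<open>W\<close> of \<open>U\<close>, compatible with restriction. As for functions,
  \<open>undefined\<close> is used outside the domain so that equality has its usual meaning.\<close>

type_synonym ('a, 's) vf = "'a set \<Rightarrow> 's \<Rightarrow> 's"

definition vect_hom :: "('a, 's) superspace \<Rightarrow> 'a set \<Rightarrow> bit \<Rightarrow> ('a, 's) vf set" where
  "vect_hom M U p =
     {X \<in> \<Pi>\<^sub>E W \<in> opens M U. carrier (sec M W) \<rightarrow>\<^sub>E carrier (sec M W).
        (\<forall>W \<in> opens M U.
           (\<forall>s \<in> carrier (sec M W). \<forall>t \<in> carrier (sec M W).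
              X W (s \<oplus>\<^bsub>sec M W\<^esub> t) = X W s \<oplus>\<^bsub>sec M W\<^esub> X W t) \<and>
           (\<forall>r. \<forall>s \<in> carrier (sec M W). X W (r \<odot>\<^bsub>sec M W\<^esub> s) = r \<odot>\<^bsub>sec M W\<^esub> X W s) \<and>
           (\<forall>q. X W ` gr (sec M W) q \<subseteq> gr (sec M W) (p + q)) \<and>
           (\<forall>q. \<forall>s \<in> gr (sec M W) q. \<forall>t \<in> carrier (sec M W).
              X W (s \<otimes>\<^bsub>sec M W\<^esub> t) =
                (X W s \<otimes>\<^bsub>sec M W\<^esub> t) \<oplus>\<^bsub>sec M W\<^esub> (ksign p q \<odot>\<^bsub>sec M W\<^esub> (s \<otimes>\<^bsub>sec M W\<^esub> X W t)))) \<and>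
        (\<forall>W \<in> opens M U. \<forall>W' \<in> opens M W. \<forall>s \<in> carrier (sec M W).
           X W' (res M W W' s) = res M W W' (X W s))}"

definition vf_zero :: "('a, 's) superspace \<Rightarrow> 'a set \<Rightarrow> ('a, 's) vf" where
  "vf_zero M U = (\<lambda>W \<in> opens M U. \<lambda>s \<in> carrier (sec M W). \<zero>\<^bsub>sec M W\<^esub>)"

definition vf_add :: "('a, 's) superspace \<Rightarrow> 'a set \<Rightarrow> ('a, 's) vf \<Rightarrow> ('a, 's) vf \<Rightarrow> ('a, 's) vf" where
  "vf_add M U X Y = (\<lambda>W \<in> opens M U. \<lambda>s \<in> carrier (sec M W). X W s \<oplus>\<^bsub>sec M W\<^esub> Y W s)"

definition vf_smult :: "('a, 's) superspace \<Rightarrow> 'a set \<Rightarrow> real \<Rightarrow> ('a, 's) vf \<Rightarrow> ('a, 's) vf" where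
  "vf_smult M U r X = (\<lambda>W \<in> opens M U. \<lambda>s \<in> carrier (sec M W). r \<odot>\<^bsub>sec M W\<^esub> X W s)"

definition vf_scale :: "('a, 's) superspace \<Rightarrow> 'a set \<Rightarrow> 's \<Rightarrow> ('a, 's) vf \<Rightarrow> ('a, 's) vf" where
  "vf_scale M U f X = (\<lambda>W \<in> opens M U. \<lambda>s \<in> carrier (sec M W). res M U W f \<otimes>\<^bsub>sec M W\<^esub> X W s)"

definition vf_restrict :: "('a, 's) superspace \<Rightarrow> 'a set \<Rightarrow> ('a, 's) vf \<Rightarrow> ('a, 's) vf" where
  "vf_restrict M W X = restrict X (opens M W)"

text \<open>The graded commutator of \<open>X\<close> of parity \<open>p\<close> and \<open>Y\<close> of parity \<open>q\<close>.\<close>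

definition vf_bracket :: "('a, 's) superspace \<Rightarrow> 'a set \<Rightarrow> bit \<Rightarrow> bit
    \<Rightarrow> ('a, 's) vf \<Rightarrow> ('a, 's) vf \<Rightarrow> ('a, 's) vf" where
  "vf_bracket M U p q X Y = (\<lambda>W \<in> opens M U. \<lambda>s \<in> carrier (sec M W).
     X W (Y W s) \<ominus>\<^bsub>sec M W\<^esub> (ksign p q \<odot>\<^bsub>sec M W\<^esub> Y W (X W s)))"

definition vect :: "('a, 's) superspace \<Rightarrow> 'a set \<Rightarrow> ('a, 's) vf set" where
  "vect M U = {vf_add M U X Y | X Y. X \<in> vect_hom M U 0 \<and> Y \<in> vect_hom M U 1}"

section \<open>Tangent spaces\<close>

text \<open>Tangent vectors at \<open>m\<close> are derivations of the stalk at \<open>m\<close> into the reals; a map out of the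
  stalk is written as a compatible family of maps on the sections over neighbourhoods of \<open>m\<close>.\<close>

type_synonym ('a, 's) tvec = "'a set \<Rightarrow> 's \<Rightarrow> real"

definition tangent_hom :: "('a, 's) superspace \<Rightarrow> 'a \<Rightarrow> bit \<Rightarrow> ('a, 's) tvec set" where
  "tangent_hom M m p =
     {v \<in> \<Pi>\<^sub>E W \<in> nbhds M m. carrier (sec M W) \<rightarrow>\<^sub>E UNIV.
        (\<forall>W \<in> nbhds M m.
           (\<forall>s \<in> carrier (sec M W). \<forall>t \<in> carrier (sec M W). v W (s \<oplus>\<^bsub>sec M W\<^esub> t) = v W s + v W t) \<and>
           (\<forall>r. \<forall>s \<in> carrier (sec M W). v W (r \<odot>\<^bsub>sec M W\<^esub> s) = r * v W s) \<and>
           (\<forall>q. q \<noteq> p \<longrightarrow> (\<forall>s \<in> gr (sec M W) q. v W s = 0)) \<and>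
           (\<forall>q. \<forall>s \<in> gr (sec M W) q. \<forall>t \<in> carrier (sec M W).
              v W (s \<otimes>\<^bsub>sec M W\<^esub> t) = v W s * eps M W t m + ksign p q * eps M W s m * v W t)) \<and>
        (\<forall>W \<in> nbhds M m. \<forall>W' \<in> nbhds M m. W' \<subseteq> W \<longrightarrow>
           (\<forall>s \<in> carrier (sec M W). v W' (res M W W' s) = v W s))}"

definition tvec_zero :: "('a, 's) superspace \<Rightarrow> 'a \<Rightarrow> ('a, 's) tvec" where
  "tvec_zero M m = (\<lambda>W \<in> nbhds M m. \<lambda>s \<in> carrier (sec M W). 0)"

definition tvec_add :: "('a, 's) superspace \<Rightarrow> 'a \<Rightarrow> ('a, 's) tvec \<Rightarrow> ('a, 's) tvec \<Rightarrow> ('a, 's) tvec" where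
  "tvec_add M m v w = (\<lambda>W \<in> nbhds M m. \<lambda>s \<in> carrier (sec M W). v W s + w W s)"

definition tvec_smult :: "('a, 's) superspace \<Rightarrow> 'a \<Rightarrow> real \<Rightarrow> ('a, 's) tvec \<Rightarrow> ('a, 's) tvec" where
  "tvec_smult M m r v = (\<lambda>W \<in> nbhds M m. \<lambda>s \<in> carrier (sec M W). r * v W s)"

definition tangent :: "('a, 's) superspace \<Rightarrow> 'a \<Rightarrow> ('a, 's) tvec set" where
  "tangent M m = {tvec_add M m v w | v w. v \<in> tangent_hom M m 0 \<and> w \<in> tangent_hom M m 1}"

definition vf_at :: "('a, 's) superspace \<Rightarrow> 'a set \<Rightarrow> ('a, 's) vf \<Rightarrow> 'a \<Rightarrow> ('a, 's) tvec" where
  "vf_at M U X m = (\<lambda>W \<in> nbhds M m. \<lambda>s \<in> carrier (sec M W).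
     eps M (W \<inter> U) (X (W \<inter> U) (res M W (W \<inter> U) s)) m)"

definition nonsingular :: "('a, 's) superspace \<Rightarrow> ('a, 's) vf \<Rightarrow> bool" where
  "nonsingular M X \<longleftrightarrow> (\<forall>m \<in> points M. vf_at M (points M) X m \<noteq> tvec_zero M m)"

section \<open>Metrics\<close>

text \<open>An even graded-symmetric covariant tensor of rank two, as a pairing of sheaves: \<open>g U\<close> pairs
  vector fields on \<open>U\<close>. Additivity in the second slot is listed because graded symmetry is
  only stated for homogeneous arguments. On a space without odd sections, metrics are the
  symmetric (0,2)-tensors (possibly degenerate).\<close>

type_synonym ('a, 's) tensor2 = "'a set \<Rightarrow> ('a, 's) vf \<Rightarrow> ('a, 's) vf \<Rightarrow> 's"

definition super_metric :: "('a, 's) superspace \<Rightarrow> ('a, 's) tensor2 \<Rightarrow> bool" where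
  "super_metric M g \<longleftrightarrow>
     (\<forall>U \<in> opens M (points M).
        (\<forall>p q. \<forall>X \<in> vect_hom M U p. \<forall>Y \<in> vect_hom M U q.
           g U X Y \<in> gr (sec M U) (p + q) \<and>
           g U X Y = ksign p q \<odot>\<^bsub>sec M U\<^esub> g U Y X) \<and>
        (\<forall>f \<in> carrier (sec M U). \<forall>X \<in> vect M U. \<forall>Y \<in> vect M U. \<forall>Z \<in> vect M U.
           g U (vf_add M U (vf_scale M U f X) Y) Z =
             (f \<otimes>\<^bsub>sec M U\<^esub> g U X Z) \<oplus>\<^bsub>sec M U\<^esub> g U Y Z) \<and>
        (\<forall>X \<in> vect M U. \<forall>Y \<in> vect M U. \<forall>Z \<in> vect M U.
           g U X (vf_add M U Y Z) = g U X Y \<oplus>\<^bsub>sec M U\<^esub> g U X Z) \<and>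
        (\<forall>W \<in> opens M U. \<forall>X \<in> vect M U. \<forall>Y \<in> vect M U.
           g W (vf_restrict M W X) (vf_restrict M W Y) = res M U W (g U X Y)))"

definition metric_kernel :: "('a, 's) superspace \<Rightarrow> ('a, 's) tensor2 \<Rightarrow> ('a, 's) vf set" where
  "metric_kernel M g = {X \<in> vect M (points M).
     \<forall>Y \<in> vect M (points M). g (points M) X Y = \<zero>\<^bsub>sec M (points M)\<^esub>}"

definition degenerate :: "('a, 's) superspace \<Rightarrow> ('a, 's) tensor2 \<Rightarrow> bool" where
  "degenerate M g \<longleftrightarrow> metric_kernel M g \<noteq> {vf_zero M (points M)}"

definition vf_span :: "('a, 's) superspace \<Rightarrow> ('a, 's) vf \<Rightarrow> ('a, 's) vf set" where
  "vf_span M X = {vf_scale M (points M) f X | f. f \<in> carrier (sec M (points M))}"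

text \<open>The bilinear form induced by \<open>g\<close> on the tangent space at \<open>m\<close>, evaluated through arbitrary
  extensions of tangent vectors to vector fields near \<open>m\<close>.\<close>

definition form_at ::
    "('a, 's) superspace \<Rightarrow> ('a, 's) tensor2 \<Rightarrow> 'a \<Rightarrow> ('a, 's) tvec \<Rightarrow> ('a, 's) tvec \<Rightarrow> real" where
  "form_at M g m v w = (THE r. \<exists>U \<in> nbhds M m. \<exists>X \<in> vect M U. \<exists>Y \<in> vect M U.
     vf_at M U X m = v \<and> vf_at M U Y m = w \<and> r = eps M U (g U X Y) m)"

definition form_kernel :: "('a, 's) superspace \<Rightarrow> ('a, 's) tensor2 \<Rightarrow> 'a \<Rightarrow> ('a, 's) tvec set" where
  "form_kernel M g m = {v \<in> tangent M m. \<forall>w \<in> tangent M m. form_at M g m v w = 0}"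

definition kernel_dim_0_1 :: "('a, 's) superspace \<Rightarrow> ('a, 's) tensor2 \<Rightarrow> 'a \<Rightarrow> bool" where
  "kernel_dim_0_1 M g m \<longleftrightarrow>
     form_kernel M g m \<inter> tangent_hom M m 0 = {tvec_zero M m} \<and>
     (\<exists>v \<in> form_kernel M g m \<inter> tangent_hom M m 1. v \<noteq> tvec_zero M m \<and>
        form_kernel M g m \<inter> tangent_hom M m 1 = range (\<lambda>r. tvec_smult M m r v))"

section \<open>Super-null Riemannian manifolds\<close>

text \<open>In the chart, \<open>t\<close> is the \<open>k\<close>-th even coordinate and \<open>\<tau> = theta 1 W 0\<close> is the odd one; the two
  equations are \<open>Q = \<partial>\<^sub>\<tau> + \<tau> \<partial>\<^sub>t\<close> and \<open>P = \<partial>\<^sub>t\<close>.\<close>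

definition shander_chart ::
    "('a, 's) superspace \<Rightarrow> ('a, 's) vf \<Rightarrow> ('a, 's) vf \<Rightarrow> 'a set \<Rightarrow> ('a \<Rightarrow> real ^ 'n::finite)
      \<Rightarrow> ((real ^ 'n) set \<Rightarrow> 'n superfun \<Rightarrow> 's) \<Rightarrow> 'n \<Rightarrow> bool" where
  "shander_chart M Q P U \<phi> \<psi> k \<longleftrightarrow>
     super_chart 1 M U \<phi> \<psi> \<and>
     (\<forall>W. open W \<and> W \<subseteq> \<phi> ` U \<longrightarrow> (\<forall>f \<in> carrier (superdomain_alg 1 W).
        Q (U \<inter> \<phi> -` W) (\<psi> W f) =
          \<psi> W (odd_partial 1 W 0 f \<oplus>\<^bsub>superdomain_alg 1 W\<^esub>
                (theta 1 W 0 \<otimes>\<^bsub>superdomain_alg 1 W\<^esub> even_partial 1 W k f)) \<and>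
        P (U \<inter> \<phi> -` W) (\<psi> W f) = \<psi> W (even_partial 1 W k f)))"

definition super_null_riemannian :: "'n::finite itself \<Rightarrow> ('a, 's) superspace \<Rightarrow> ('a, 's) tensor2
    \<Rightarrow> ('a, 's) vf \<Rightarrow> ('a, 's) vf \<Rightarrow> bool" where
  "super_null_riemannian n M g Q P \<longleftrightarrow>
     supermanifold n 1 M \<and>
     super_metric M g \<and> degenerate M g \<and>
     Q \<in> vect_hom M (points M) 1 \<and> nonsingular M Q \<and>
     P \<in> vect_hom M (points M) 0 \<and>
     vf_bracket M (points M) 1 1 Q Q = vf_smult M (points M) 2 P \<and>
     metric_kernel M g = vf_span M Q \<and>
     (\<forall>m \<in> points M. kernel_dim_0_1 M g m) \<and>
     (\<forall>m \<in> points M. \<exists>U (\<phi> :: 'a \<Rightarrow> real ^ 'n) \<psi> k. m \<in> U \<and> shander_chart M Q P U \<phi> \<psi> k)"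

section \<open>The reduced metric\<close>

definition is_lift ::
    "('a, 's) superspace \<Rightarrow> 'a set \<Rightarrow> ('a, 'a \<Rightarrow> real) vf \<Rightarrow> ('a, 's) vf \<Rightarrow> bool" where
  "is_lift M U X\<^sub>r X \<longleftrightarrow> X \<in> vect_hom M U 0 \<and>
     (\<forall>W \<in> opens M U. \<forall>f \<in> carrier (sec M W). X\<^sub>r W (eps M W f) = eps M W (X W f))"

text \<open>The definite description is the common value obtained from all pairs of lifts.\<close>

definition reduced_metric :: "('a, 's) superspace \<Rightarrow> ('a, 's) tensor2 \<Rightarrow> ('a, 'a \<Rightarrow> real) tensor2" where
  "reduced_metric M g U X\<^sub>r Y\<^sub>r =
     (THE h. \<exists>X Y. is_lift M U X\<^sub>r X \<and> is_lift M U Y\<^sub>r Y \<and> h = eps M U (g U X Y))"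

definition pseudo_riemannian ::
    "'n::finite itself \<Rightarrow> ('a, 's) superspace \<Rightarrow> ('a, 's) tensor2 \<Rightarrow> bool" where
  "pseudo_riemannian n N h \<longleftrightarrow>
     supermanifold n 0 N \<and> super_metric N h \<and>
     (\<forall>m \<in> points N. form_kernel N h m = {tvec_zero N m})"

end

theory Submission
  imports Defs "HOL-Algebra.RingHom"
begin

text \<open>
  In a Shander chart \<open>Q (f + \<theta> h) = h + \<theta> \<partial>\<^sub>t f\<close>, so \<open>s \<mapsto> (\<epsilon> s, \<epsilon> (Q s))\<close> reads off both components of a
  section. This map does not refer to the chart, hence it identifies the structure sheaf of \<open>M\<close> with the
  smooth functions on the reduced manifold tensored with the exterior algebra on one global generator \<open>\<tau>\<close>,
  where \<open>Q \<tau> = 1\<close>. A field on the reduced manifold therefore has a canonical lift, acting on both components,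
  and no partition of unity is needed. Two lifts differ by \<open>f Q\<close> with \<open>f\<close> odd, and \<open>\<epsilon> (f \<langle>Q|Z\<rangle>) = 0\<close>, so the
  reduced metric is well defined. An even tangent vector of \<open>M\<close> is the same as a tangent vector of the reduced
  manifold, and odd vectors pair to zero with everything after applying \<open>\<epsilon>\<close>; hence a vector in the kernel of
  the reduced form is an even vector in the kernel of the form on \<open>T\<^sub>m M\<close>, which is purely odd by hypothesis.
  Passing from fields to tangent vectors uses Hadamard's lemma.
\<close>

section \<open>Smooth functions\<close>

text \<open>Both forms are reached through definite descriptions: \<open>reduced_metric\<close>
  ranges over all lifts, \<open>form_at\<close> over all extensions of tangent vectors. Each value
  therefore needs a witness and a proof of independence, and most of the work lies there. Witnesses
  for lifts come from the splitting: \<open>ev\<close> embeds the reduced functions as sections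
  without odd part, and \<open>red_lift\<close> is the lift that kills \<open>\<tau>\<close>. Both
  are global since their defining equations mention only \<epsilon> and Q. Independence has two
  sources. Every section is a + b \<tau>, so an even field is determined by its reduction and the
  one function \<epsilon> (Q (X \<tau>)). And the pairing is linear over functions, hence pointwise,
  in the first slot and by symmetry in the second. For odd X, multiplication by \<tau> sees only
  bodies, which gives \<tau> X = \<tau> (X \<tau>) Q; applying \<epsilon> Q to the pairing with Z
  recovers \<epsilon> of <X|Z> as a multiple of \<epsilon> of <Q|Z>. Since <Q|Q> is antisymmetric,
  odd pairs contribute nothing. Extensions of tangent vectors are built on one chart domain, which
  is enough because \<open>form_at\<close> accepts any neighbourhood.\<close>

definition smooth_on :: "(real ^ 'n::finite) set \<Rightarrow> (real ^ 'n \<Rightarrow> real) \<Rightarrow> bool" where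
  "smooth_on S f \<longleftrightarrow> (\<forall>k. Ck_on k f S)"

lemma smooth_funs_iff: "f \<in> smooth_funs S \<longleftrightarrow> f \<in> extensional S \<and> smooth_on S f"
  by (auto simp: smooth_funs_def smooth_on_def)

lemma differentiable_on_cong_open:
  assumes "open S" "\<And>x. x \<in> S \<Longrightarrow> f x = g x" "f differentiable_on S"
  shows "g differentiable_on S"
  using assms by (metis differentiable_transform_within differentiable_on_def zero_less_one)

text \<open>\<open>frechet_derivative\<close> chooses one of the derivatives at the point. Functions
  that agree near \<open>x\<close> have the same derivatives there, so the choice is the same; this
  covers points without a derivative as well.\<close>

lemma partial_cong_open:
  assumes "open S" "\<And>x. x \<in> S \<Longrightarrow> f x = g x" "x \<in> S"
  shows "partial i f x = partial i g x"
proof -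
  have "(f has_derivative D) (at x) \<longleftrightarrow> (g has_derivative D) (at x)" for D
    using assms has_derivative_transform_within_open[of f D x UNIV S g]
      has_derivative_transform_within_open[of g D x UNIV S f] by auto
  then show ?thesis
    by (simp add: partial_def frechet_derivative_def)
qed

lemma partial_eq:
  assumes "(f has_derivative D) (at x)"
  shows "partial i f x = D (axis i 1)"
  using assms by (simp add: partial_def frechet_derivative_at[symmetric])

text \<open>On an open set derivatives do not see values off the set. This allows passing between
  total functions and functions that are \<open>undefined\<close> outside their domain.\<close>

lemma Ck_on_cong:
  assumes "open S" "\<And>x. x \<in> S \<Longrightarrow> f x = g x" "Ck_on k f S"
  shows "Ck_on k g S"
  using assms(2,3)
proof (induction k arbitrary: f g)
  case 0
  then show ?case by (simp cong: continuous_on_cong)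
next
  case (Suc k)
  have "Ck_on k (partial i g) S" for i
    using Suc.IH[of "partial i f"] Suc.prems partial_cong_open[OF \<open>open S\<close> Suc.prems(1)] by simp
  with Suc.prems show ?case
    using differentiable_on_cong_open[OF \<open>open S\<close> Suc.prems(1)] by simp
qed

lemma Ck_on_subset: "Ck_on k f S \<Longrightarrow> T \<subseteq> S \<Longrightarrow> Ck_on k f T"
  by (induction k arbitrary: f) (auto intro: continuous_on_subset differentiable_on_subset)

lemma Ck_on_Suc: "Ck_on (Suc k) f S \<Longrightarrow> Ck_on k f S"
  by (induction k arbitrary: f) (auto simp: differentiable_imp_continuous_on)

lemma Ck_on_const: "Ck_on k (\<lambda>x. c) (S :: (real ^ 'n::finite) set)"
proof (induction k arbitrary: c)
  case (Suc k)
  have "partial i (\<lambda>x :: real ^ 'n. c) = (\<lambda>x. 0)" for i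
    by (rule ext) (simp add: partial_eq[OF has_derivative_const])
  then show ?case using Suc by simp
qed simp

lemma partial_add:
  assumes "f differentiable at x" "g differentiable at x"
  shows "partial i (\<lambda>x. f x + g x) x = partial i f x + partial i g x"
  using partial_eq[OF has_derivative_add, OF frechet_derivative_works[THEN iffD1] frechet_derivative_works[THEN iffD1], OF assms]
  by (simp add: partial_def)

lemma partial_mult:
  assumes "f differentiable at x" "g differentiable at x"
  shows "partial i (\<lambda>x. f x * g x) x = f x * partial i g x + partial i f x * g x"
  using partial_eq[OF has_derivative_mult, OF frechet_derivative_works[THEN iffD1] frechet_derivative_works[THEN iffD1], OF assms]
  by (simp add: partial_def)

text \<open>The right-hand side is arranged as nested products ending in the derivative of
  \<open>f\<close>, the shape that \<open>Ck_on_mult\<close> consumes in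
  \<open>Ck_on_inverse\<close>.\<close>

lemma partial_inverse:
  assumes "f differentiable at x" "f x \<noteq> 0"
  shows "partial i (\<lambda>x. inverse (f x)) x = - 1 * (inverse (f x) * (inverse (f x) * partial i f x))"
  using partial_eq[OF Deriv.has_derivative_inverse[OF assms(2) assms(1)[THEN frechet_derivative_works[THEN iffD1]]], of i]
  by (simp add: partial_def)

lemma Ck_on_add:
  assumes "open S"
  shows "Ck_on k f S \<Longrightarrow> Ck_on k g S \<Longrightarrow> Ck_on k (\<lambda>x. f x + g x) S"
proof (induction k arbitrary: f g)
  case 0
  then show ?case by (simp add: continuous_on_add)
next
  case (Suc k)
  have "Ck_on k (partial i (\<lambda>x. f x + g x)) S" for i
    by (rule Ck_on_cong[where f = "\<lambda>x. partial i f x + partial i g x"])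
      (use Suc.prems assms in \<open>auto simp: partial_add differentiable_on_eq_differentiable_at intro!: Suc.IH\<close>)
  with Suc.prems show ?case
    by (auto intro: derivative_intros)
qed

text \<open>The product rule pairs each factor with a derivative of the other, so the induction runs
  over all \<open>f\<close> and \<open>g\<close>; the undifferentiated factor is brought down to
  order \<open>k\<close> by \<open>Ck_on_Suc\<close>.\<close>

lemma Ck_on_mult:
  assumes "open S"
  shows "Ck_on k f S \<Longrightarrow> Ck_on k g S \<Longrightarrow> Ck_on k (\<lambda>x. f x * g x) S"
proof (induction k arbitrary: f g)
  case 0
  then show ?case by (simp add: continuous_on_mult)
next
  case (Suc k)
  have fg: "Ck_on k f S" "Ck_on k g S"
    using Suc.prems Ck_on_Suc by blast+
  have "Ck_on k (partial i (\<lambda>x. f x * g x)) S" for i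
  proof (rule Ck_on_cong[OF assms])
    show "Ck_on k (\<lambda>x. f x * partial i g x + partial i f x * g x) S"
      using Suc.prems fg by (intro Ck_on_add[OF assms Suc.IH Suc.IH]) auto
    show "f x * partial i g x + partial i f x * g x = partial i (\<lambda>x. f x * g x) x" if "x \<in> S" for x
      using Suc.prems assms that by (simp add: partial_mult differentiable_on_eq_differentiable_at)
  qed
  with Suc.prems show ?case
    by (auto intro: derivative_intros)
qed

text \<open>The derivative of 1/f contains 1/f again, but only to order \<open>k\<close>, where the
  induction hypothesis applies.\<close>

lemma Ck_on_inverse:
  assumes "open S" "\<And>x. x \<in> S \<Longrightarrow> f x \<noteq> 0"
  shows "Ck_on k f S \<Longrightarrow> Ck_on k (\<lambda>x. inverse (f x)) S"
proof (induction k)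
  case 0
  then show ?case using assms by (simp add: continuous_on_inverse)
next
  case (Suc k)
  have inv: "Ck_on k (\<lambda>x. inverse (f x)) S"
    using Suc.IH Suc.prems Ck_on_Suc by blast
  have "Ck_on k (partial i (\<lambda>x. inverse (f x))) S" for i
  proof (rule Ck_on_cong[OF assms(1)])
    show "Ck_on k (\<lambda>x. - 1 * (inverse (f x) * (inverse (f x) * partial i f x))) S"
      by (rule Ck_on_mult[OF assms(1) Ck_on_const Ck_on_mult[OF assms(1) inv Ck_on_mult[OF assms(1) inv]]])
        (use Suc.prems in simp)
    show "- 1 * (inverse (f x) * (inverse (f x) * partial i f x)) = partial i (\<lambda>x. inverse (f x)) x"
      if "x \<in> S" for x
      using Suc.prems assms that by (subst partial_inverse) (auto simp: differentiable_on_eq_differentiable_at)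
  qed
  moreover have "(\<lambda>x. inverse (f x)) differentiable_on S"
    using Suc.prems assms by (auto simp: differentiable_on_def intro: differentiable_inverse)
  ultimately show ?case by simp
qed

lemma smooth_on_cong:
  "open S \<Longrightarrow> (\<And>x. x \<in> S \<Longrightarrow> f x = g x) \<Longrightarrow> smooth_on S f \<Longrightarrow> smooth_on S g"
  unfolding smooth_on_def using Ck_on_cong by blast

lemma smooth_on_subset: "smooth_on S f \<Longrightarrow> T \<subseteq> S \<Longrightarrow> smooth_on T f"
  unfolding smooth_on_def using Ck_on_subset by blast

lemma smooth_on_const: "smooth_on S (\<lambda>x. c)"
  and smooth_on_add: "open S \<Longrightarrow> smooth_on S f \<Longrightarrow> smooth_on S g \<Longrightarrow> smooth_on S (\<lambda>x. f x + g x)"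
  and smooth_on_mult: "open S \<Longrightarrow> smooth_on S f \<Longrightarrow> smooth_on S g \<Longrightarrow> smooth_on S (\<lambda>x. f x * g x)"
  by (simp_all add: smooth_on_def Ck_on_const Ck_on_add Ck_on_mult)

lemma smooth_on_inverse:
  "open S \<Longrightarrow> (\<And>x. x \<in> S \<Longrightarrow> f x \<noteq> 0) \<Longrightarrow> smooth_on S f \<Longrightarrow> smooth_on S (\<lambda>x. inverse (f x))"
  by (simp add: smooth_on_def Ck_on_inverse)

lemma smooth_on_sum:
  assumes "open S" "\<And>i. i \<in> I \<Longrightarrow> smooth_on S (f i)"
  shows "smooth_on S (\<lambda>x. \<Sum>i\<in>I. f i x)"
  using assms(2)
  by (induction I rule: infinite_finite_induct) (auto simp: assms(1) smooth_on_const smooth_on_add)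

lemma smooth_on_partial: "smooth_on S f \<Longrightarrow> smooth_on S (partial i f)"
  unfolding smooth_on_def by (metis Ck_on.simps(2))

lemma smooth_on_imp_differentiable: "open S \<Longrightarrow> smooth_on S f \<Longrightarrow> x \<in> S \<Longrightarrow> f differentiable at x"
  unfolding smooth_on_def by (metis Ck_on.simps(2) differentiable_on_eq_differentiable_at)

lemma smooth_on_imp_continuous_on: "smooth_on S f \<Longrightarrow> continuous_on S f"
  unfolding smooth_on_def by (metis Ck_on.simps(1))

lemma partial_nth: "partial i (\<lambda>x. x $ j) x = (if i = j then 1 else 0)"
  using partial_eq[OF bounded_linear_imp_has_derivative[OF bounded_linear_vec_nth], of i]
  by (simp add: axis_def)

lemma smooth_on_nth: "smooth_on S (\<lambda>x. x $ j)"
proof -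
  have "Ck_on k (\<lambda>x. x $ j) S" for k
  proof (cases k)
    case 0
    then show ?thesis by (simp add: continuous_intros)
  next
    case (Suc k')
    have "(\<lambda>x. x $ j) differentiable_on S"
      by (simp add: bounded_linear_imp_differentiable_on bounded_linear_vec_nth)
    moreover have "Ck_on k' (partial i (\<lambda>x. x $ j)) S" for i
    proof -
      have "partial i (\<lambda>x. x $ j) = (\<lambda>x. if i = j then 1 else 0)"
        by (rule ext) (rule partial_nth)
      then show ?thesis by (simp add: Ck_on_const)
    qed
    ultimately show ?thesis by (simp add: Suc)
  qed
  then show ?thesis by (simp add: smooth_on_def)
qed

lemma has_derivative_partial:
  assumes "f differentiable at x"
  shows "(f has_derivative (\<lambda>h. \<Sum>i\<in>UNIV. h $ i * partial i f x)) (at x)"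
proof -
  have D: "(f has_derivative frechet_derivative f (at x)) (at x)"
    using assms frechet_derivative_works by blast
  then interpret bounded_linear "frechet_derivative f (at x)"
    by (rule has_derivative_bounded_linear)
  have "frechet_derivative f (at x) h = (\<Sum>i\<in>UNIV. h $ i * partial i f x)" for h
  proof -
    have "h = (\<Sum>i\<in>UNIV. h $ i *\<^sub>R axis i 1)"
      by (simp add: vec_eq_iff axis_def if_distrib cong: if_cong)
    then have "frechet_derivative f (at x) h = frechet_derivative f (at x) (\<Sum>i\<in>UNIV. h $ i *\<^sub>R axis i 1)"
      by simp
    then show ?thesis
      by (simp add: sum scaleR partial_def)
  qed
  with D show ?thesis by (metis (no_types, lifting) ext)
qed

subsection \<open>Hadamard's lemma\<close>

text \<open>A weighted average of \<open>f\<close> along the segment from \<open>p\<close> to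
  \<open>x\<close>. Each derivative in \<open>x\<close> contributes one factor \<open>t\<close> by
  the chain rule, so the exponent \<open>m\<close> makes the family stable under partial
  derivatives.\<close>

definition ray_integral :: "real ^ 'n::finite \<Rightarrow> nat \<Rightarrow> (real ^ 'n \<Rightarrow> real) \<Rightarrow> real ^ 'n \<Rightarrow> real" where
  "ray_integral p m f x = integral (cbox 0 1) (\<lambda>t. t ^ m * f (p + t *\<^sub>R (x - p)))"

context
  fixes p :: "real ^ 'n::finite" and S :: "(real ^ 'n) set"
  assumes S: "open S" "convex S" "p \<in> S"
begin

lemma ray_in: "x \<in> S \<Longrightarrow> 0 \<le> t \<Longrightarrow> t \<le> 1 \<Longrightarrow> p + t *\<^sub>R (x - p) \<in> S"
  using convexD_alt[OF S(2,3), of x t] by (simp add: algebra_simps)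

text \<open>Differentiation under the integral sign, legitimate because the derivative of the
  integrand is jointly continuous; convexity keeps the whole segment inside
  \<open>S\<close>.\<close>

lemma ray_integral_has_derivative:
  assumes "smooth_on S f" "x \<in> S"
  shows "(ray_integral p m f has_derivative (\<lambda>h. \<Sum>i\<in>UNIV. h $ i * ray_integral p (Suc m) (partial i f) x)) (at x)"
proof -
  \<comment> \<open>\<open>leibniz_rule\<close> takes the derivative as a bounded linear function.
    Expanding it in inner products with the basis vectors reduces its joint continuity to that of
    the partial derivatives.\<close>
  define fx where "fx x t = (\<Sum>i\<in>UNIV. (t ^ Suc m * partial i f (p + t *\<^sub>R (x - p))) *\<^sub>R blinfun_inner_right (axis i 1 :: real ^ 'n))"
    for x and t :: real
  have cp: "continuous_on S (partial i f)" for i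
    using assms smooth_on_partial smooth_on_imp_continuous_on by blast
  have cfx: "continuous_on (S \<times> cbox 0 1) (\<lambda>(x, t). fx x t)"
    unfolding fx_def case_prod_beta
    by (intro continuous_intros continuous_on_compose2[OF cp]) (auto intro!: ray_in)
  have "((\<lambda>x. integral (cbox 0 1) (\<lambda>t. t ^ m * f (p + t *\<^sub>R (x - p)))) has_derivative integral (cbox 0 1) (fx x))
          (at x within S)"
  proof (rule leibniz_rule[where fx = fx])
    fix y t assume y: "y \<in> S" and t: "t \<in> cbox (0::real) 1"
    let ?z = "p + t *\<^sub>R (y - p)"
    have "?z \<in> S" using y t by (auto intro: ray_in)
    then have "(f has_derivative (\<lambda>h. \<Sum>i\<in>UNIV. h $ i * partial i f ?z)) (at ?z)"
      by (intro has_derivative_partial smooth_on_imp_differentiable[OF S(1) assms(1)])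
    then have "((\<lambda>y. f (p + t *\<^sub>R (y - p))) has_derivative (\<lambda>h. \<Sum>i\<in>UNIV. (t *\<^sub>R h) $ i * partial i f ?z)) (at y)"
      by (rule has_derivative_compose[rotated]) (auto intro!: derivative_eq_intros)
    then have "((\<lambda>y. t ^ m * f (p + t *\<^sub>R (y - p))) has_derivative (\<lambda>h. t ^ m * (\<Sum>i\<in>UNIV. (t *\<^sub>R h) $ i * partial i f ?z))) (at y)"
      by (rule has_derivative_mult_right)
    moreover have "blinfun_apply (fx y t) = (\<lambda>h. t ^ m * (\<Sum>i\<in>UNIV. (t *\<^sub>R h) $ i * partial i f ?z))"
      by (rule ext) (simp add: fx_def blinfun.sum_left blinfun.scaleR_left inner_axis' sum_distrib_left mult_ac)
    ultimately show "((\<lambda>y. t ^ m * f (p + t *\<^sub>R (y - p))) has_derivative blinfun_apply (fx y t)) (at y within S)"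
      by (simp add: has_derivative_at_withinI)
  next
    fix y assume y: "y \<in> S"
    have "continuous_on (cbox 0 1) (\<lambda>t. t ^ m * f (p + t *\<^sub>R (y - p)))"
      by (intro continuous_intros continuous_on_compose2[OF smooth_on_imp_continuous_on[OF assms(1)]])
        (use y in \<open>auto intro!: ray_in\<close>)
    then show "(\<lambda>t. t ^ m * f (p + t *\<^sub>R (y - p))) integrable_on cbox 0 1"
      by (rule integrable_continuous)
  qed (rule cfx assms(2) S(2))+
  moreover have "at x within S = at x"
    by (rule at_within_open[OF assms(2) S(1)])
  moreover have "blinfun_apply (integral (cbox 0 1) (fx x)) = (\<lambda>h. \<Sum>i\<in>UNIV. h $ i * ray_integral p (Suc m) (partial i f) x)"
  proof
    fix h
    have cx: "continuous_on (cbox 0 1) (fx x)"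
      unfolding fx_def
      by (intro continuous_intros continuous_on_compose2[OF cp]) (use assms in \<open>auto intro!: ray_in\<close>)
    have ci: "continuous_on (cbox 0 1) (\<lambda>t. t ^ Suc m * partial i f (p + t *\<^sub>R (x - p)))" for i
      by (intro continuous_intros continuous_on_compose2[OF cp]) (use assms in \<open>auto intro!: ray_in\<close>)
    have "blinfun_apply (integral (cbox 0 1) (fx x)) h = integral (cbox 0 1) (\<lambda>t. blinfun_apply (fx x t) h)"
      by (rule blinfun_apply_integral[OF integrable_continuous[OF cx]])
    also have "\<dots> = integral (cbox 0 1) (\<lambda>t. \<Sum>i\<in>UNIV. h $ i * (t ^ Suc m * partial i f (p + t *\<^sub>R (x - p))))"
      by (simp add: fx_def blinfun.sum_left blinfun.scaleR_left inner_axis' mult_ac)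
    also have "\<dots> = (\<Sum>i\<in>UNIV. h $ i * integral (cbox 0 1) (\<lambda>t. t ^ Suc m * partial i f (p + t *\<^sub>R (x - p))))"
      using integrable_continuous[OF ci]
      by (subst integral_sum) (auto intro!: integrable_on_mult_right simp del: power_Suc)
    finally show "blinfun_apply (integral (cbox 0 1) (fx x)) h = (\<Sum>i\<in>UNIV. h $ i * ray_integral p (Suc m) (partial i f) x)"
      by (simp add: ray_integral_def)
  qed
  ultimately show ?thesis
    by (simp add: ray_integral_def[abs_def])
qed

lemma partial_ray_integral:
  "smooth_on S f \<Longrightarrow> x \<in> S \<Longrightarrow> partial i (ray_integral p m f) x = ray_integral p (Suc m) (partial i f) x"
  by (subst partial_eq[OF ray_integral_has_derivative])
    (auto simp: axis_def if_distrib[of "\<lambda>x. x * _"] cong: if_cong)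

text \<open>A partial derivative of a ray integral is a ray integral of \<open>partial i f\<close>
  with the next exponent, hence the induction over all \<open>f\<close> and
  \<open>m\<close>.\<close>

lemma smooth_on_ray_integral:
  assumes "smooth_on S f"
  shows "smooth_on S (ray_integral p m f)"
proof -
  have "Ck_on k (ray_integral p m f) S" for k
    using assms
  proof (induction k arbitrary: f m)
    case 0
    have "isCont (ray_integral p m f) x" if "x \<in> S" for x
      using ray_integral_has_derivative[OF 0 that] has_derivative_continuous by blast
    then show ?case
      by (simp add: continuous_at_imp_continuous_on)
  next
    case (Suc k)
    have "ray_integral p m f differentiable_on S"
      using ray_integral_has_derivative[OF Suc.prems] S
      by (meson differentiable_def differentiable_on_eq_differentiable_at)
    moreover have "Ck_on k (partial i (ray_integral p m f)) S" for i
      by (rule Ck_on_cong[OF S(1) _ Suc.IH[OF smooth_on_partial[OF Suc.prems]]])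
        (simp add: partial_ray_integral[OF Suc.prems])
    ultimately show ?case by simp
  qed
  then show ?thesis by (simp add: smooth_on_def)
qed

text \<open>Integrate the derivative of f (p + t (x - p)) in t over the unit interval: the chain
  rule brings out the factors x_i - p_i, and the remaining integrals are smooth in
  \<open>x\<close>.\<close>

lemma hadamard:
  assumes "smooth_on S f"
  obtains h where "\<And>i. smooth_on S (h i)" "\<And>i. h i p = partial i f p"
    "\<And>x. x \<in> S \<Longrightarrow> f x = f p + (\<Sum>i\<in>UNIV. (x $ i - p $ i) * h i x)"
proof
  define h where "h i = ray_integral p 0 (partial i f)" for i
  show "smooth_on S (h i)" for i
    unfolding h_def by (intro smooth_on_ray_integral smooth_on_partial assms)
  \<comment> \<open>At \<open>x = p\<close> the integrand is constant in \<open>t\<close>, and the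
    interval has length 1.\<close>
  show "h i p = partial i f p" for i
    by (simp add: h_def ray_integral_def)
  show "f x = f p + (\<Sum>i\<in>UNIV. (x $ i - p $ i) * h i x)" if "x \<in> S" for x
  proof -
    have cp: "continuous_on S (partial i f)" for i
      using assms smooth_on_partial smooth_on_imp_continuous_on by blast
    have ci: "continuous_on (cbox 0 1) (\<lambda>t. partial i f (p + t *\<^sub>R (x - p)))" for i
      by (intro continuous_intros continuous_on_compose2[OF cp]) (use that in \<open>auto intro!: ray_in\<close>)
    have "((\<lambda>t. \<Sum>i\<in>UNIV. (x $ i - p $ i) * partial i f (p + t *\<^sub>R (x - p))) has_integral
            f (p + 1 *\<^sub>R (x - p)) - f (p + 0 *\<^sub>R (x - p))) {0..1}"
    proof (rule fundamental_theorem_of_calculus)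
      fix t :: real assume t: "t \<in> {0..1}"
      let ?z = "p + t *\<^sub>R (x - p)"
      have "(f has_derivative (\<lambda>h. \<Sum>i\<in>UNIV. h $ i * partial i f ?z)) (at ?z)"
        using t that by (intro has_derivative_partial smooth_on_imp_differentiable[OF S(1) assms] ray_in) auto
      then have "((\<lambda>t. f (p + t *\<^sub>R (x - p))) has_derivative (\<lambda>s. \<Sum>i\<in>UNIV. (s *\<^sub>R (x - p)) $ i * partial i f ?z)) (at t)"
        by (rule has_derivative_compose[rotated]) (auto intro!: derivative_eq_intros)
      then have "((\<lambda>t. f (p + t *\<^sub>R (x - p))) has_vector_derivative (\<Sum>i\<in>UNIV. (x $ i - p $ i) * partial i f ?z)) (at t)"
        by (simp add: has_vector_derivative_def sum_distrib_left mult_ac)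
      then show "((\<lambda>t. f (p + t *\<^sub>R (x - p))) has_vector_derivative (\<Sum>i\<in>UNIV. (x $ i - p $ i) * partial i f ?z)) (at t within {0..1})"
        by (rule has_vector_derivative_at_within)
    qed simp
    then have "f x - f p = integral (cbox 0 1) (\<lambda>t. \<Sum>i\<in>UNIV. (x $ i - p $ i) * partial i f (p + t *\<^sub>R (x - p)))"
      by (simp add: integral_unique)
    also have "\<dots> = (\<Sum>i\<in>UNIV. (x $ i - p $ i) * h i x)"
      using integrable_continuous[OF ci]
      by (subst integral_sum) (auto intro!: integrable_on_mult_right simp: h_def ray_integral_def)
    finally show ?thesis by simp
  qed
qed

end

section \<open>Superalgebras and superringed spaces\<close>

lemma superalgebraD:
  assumes "superalgebra A"
  shows superalgebra_ring: "ring A"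
    and superalgebra_module: "module real_ring A"
    and superalgebra_smult_closed: "x \<in> carrier A \<Longrightarrow> r \<odot>\<^bsub>A\<^esub> x \<in> carrier A"
    and superalgebra_gr: "x \<in> gr A p \<Longrightarrow> x \<in> carrier A"
    and superalgebra_gr_zero: "\<zero>\<^bsub>A\<^esub> \<in> gr A p"
proof -
  show "ring A" and m: "module real_ring A"
    using assms by (auto simp: superalgebra_def)
  show "x \<in> carrier A \<Longrightarrow> r \<odot>\<^bsub>A\<^esub> x \<in> carrier A"
    using module.smult_closed[OF m, of r x] by (simp add: real_ring_def)
  have s: "submodule (gr A p) real_ring A"
    using assms by (auto simp: superalgebra_def)
  show "x \<in> gr A p \<Longrightarrow> x \<in> carrier A"
    using module.submoduleE(1)[OF m s] by blast
  interpret S: subgroup "gr A p" "add_monoid A"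
    using s by (simp add: submodule_def)
  show "\<zero>\<^bsub>A\<^esub> \<in> gr A p"
    using S.one_closed by simp
qed

lemma superalgebra_decomp:
  assumes "superalgebra A" "x \<in> carrier A"
  obtains y z where "y \<in> gr A 0" "z \<in> gr A 1" "x = y \<oplus>\<^bsub>A\<^esub> z"
proof -
  have "x \<in> gr A 0 <+>\<^bsub>A\<^esub> gr A 1"
    using assms by (simp add: superalgebra_def)
  then show ?thesis
    using that by (auto simp: set_add_def set_mult_def)
qed

lemma superalg_homD:
  assumes "h \<in> superalg_hom A B"
  shows superalg_hom_closed: "x \<in> carrier A \<Longrightarrow> h x \<in> carrier B"
    and superalg_hom_add: "x \<in> carrier A \<Longrightarrow> y \<in> carrier A \<Longrightarrow> h (x \<oplus>\<^bsub>A\<^esub> y) = h x \<oplus>\<^bsub>B\<^esub> h y"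
    and superalg_hom_mult: "x \<in> carrier A \<Longrightarrow> y \<in> carrier A \<Longrightarrow> h (x \<otimes>\<^bsub>A\<^esub> y) = h x \<otimes>\<^bsub>B\<^esub> h y"
    and superalg_hom_one: "h \<one>\<^bsub>A\<^esub> = \<one>\<^bsub>B\<^esub>"
    and superalg_hom_smult: "x \<in> carrier A \<Longrightarrow> h (r \<odot>\<^bsub>A\<^esub> x) = r \<odot>\<^bsub>B\<^esub> h x"
  using assms by (auto simp: superalg_hom_def ring_hom_closed ring_hom_add ring_hom_mult ring_hom_one)

lemma superalg_hom_minus:
  assumes "h \<in> superalg_hom A B" "superalgebra A" "superalgebra B" "x \<in> carrier A" "y \<in> carrier A"
  shows "h (x \<ominus>\<^bsub>A\<^esub> y) = h x \<ominus>\<^bsub>B\<^esub> h y"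
proof -
  interpret A: ring A by (rule superalgebra_ring) fact
  interpret B: ring B by (rule superalgebra_ring) fact
  interpret ring_hom_ring A B h
    using assms(1) by (intro ring_hom_ringI2 A.ring_axioms B.ring_axioms) (simp add: superalg_hom_def)
  show ?thesis using assms by (simp add: a_minus_def)
qed

lemma superalg_hom_Units:
  assumes "h \<in> superalg_hom A B" "x \<in> Units A"
  shows "h x \<in> Units B"
proof -
  obtain y where y: "x \<in> carrier A" "y \<in> carrier A" "y \<otimes>\<^bsub>A\<^esub> x = \<one>\<^bsub>A\<^esub>" "x \<otimes>\<^bsub>A\<^esub> y = \<one>\<^bsub>A\<^esub>"
    using assms(2) unfolding Units_def by blast
  have "h y \<otimes>\<^bsub>B\<^esub> h x = \<one>\<^bsub>B\<^esub>" "h x \<otimes>\<^bsub>B\<^esub> h y = \<one>\<^bsub>B\<^esub>"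
    using y superalg_hom_mult[OF assms(1)] superalg_hom_one[OF assms(1)] by metis+
  then show ?thesis
    using y superalg_hom_closed[OF assms(1)] unfolding Units_def by blast
qed

lemma opensD: "W \<in> opens N U \<Longrightarrow> openin (base N) W" "W \<in> opens N U \<Longrightarrow> W \<subseteq> U"
  by (auto simp: opens_def)

lemma opens_points: "W \<in> opens N (points N) \<longleftrightarrow> openin (base N) W"
  by (auto simp: opens_def dest: openin_subset)

lemma opens_trans: "V \<in> opens N U \<Longrightarrow> W \<in> opens N V \<Longrightarrow> W \<in> opens N U"
  by (auto simp: opens_def)

lemma opens_imp_points: "V \<in> opens N U \<Longrightarrow> V \<in> opens N (points N)"
  by (auto simp: opens_def dest: openin_subset)

lemma opens_self: "U \<in> opens N V \<Longrightarrow> U \<in> opens N U"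
  by (auto simp: opens_def)

lemma nbhds_iff: "W \<in> nbhds N m \<longleftrightarrow> W \<in> opens N (points N) \<and> m \<in> W"
  by (auto simp: opens_def nbhds_def dest: openin_subset)

lemma opens_Int: "V \<in> opens N U \<Longrightarrow> W \<in> opens N U' \<Longrightarrow> V \<inter> W \<in> opens N U \<and> V \<inter> W \<in> opens N U' \<and> V \<inter> W \<in> opens N V \<and> V \<inter> W \<in> opens N W"
  by (auto simp: opens_def)

section \<open>Sheaf arguments: equality is local, values survive restriction\<close>

locale superringed =
  fixes N :: "('a, 's) superspace"
  assumes space: "superringed_space N"
begin

lemma sec_superalgebra: "U \<in> opens N (points N) \<Longrightarrow> superalgebra (sec N U)"
  using space by (auto simp: superringed_space_def)

lemma res_hom: "U \<in> opens N (points N) \<Longrightarrow> W \<in> opens N U \<Longrightarrow> res N U W \<in> superalg_hom (sec N U) (sec N W)"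
  using space by (auto simp: superringed_space_def)

lemma res_res: "U \<in> opens N (points N) \<Longrightarrow> V \<in> opens N U \<Longrightarrow> W \<in> opens N V \<Longrightarrow> s \<in> carrier (sec N U) \<Longrightarrow>
    res N V W (res N U V s) = res N U W s"
  using space by (simp add: superringed_space_def)

lemma glue:
  assumes "\<U> \<subseteq> opens N (points N)" "\<And>W. W \<in> \<U> \<Longrightarrow> s W \<in> carrier (sec N W)"
    "\<And>W W'. W \<in> \<U> \<Longrightarrow> W' \<in> \<U> \<Longrightarrow> res N W (W \<inter> W') (s W) = res N W' (W \<inter> W') (s W')"
  shows "\<exists>!t. t \<in> carrier (sec N (\<Union>\<U>)) \<and> (\<forall>W \<in> \<U>. res N (\<Union>\<U>) W t = s W)"
proof -
  have "\<forall>\<U> s. \<U> \<subseteq> opens N (points N) \<and> (\<forall>W \<in> \<U>. s W \<in> carrier (sec N W)) \<and>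
        (\<forall>W \<in> \<U>. \<forall>W' \<in> \<U>. res N W (W \<inter> W') (s W) = res N W' (W \<inter> W') (s W')) \<longrightarrow>
        (\<exists>!t. t \<in> carrier (sec N (\<Union>\<U>)) \<and> (\<forall>W \<in> \<U>. res N (\<Union>\<U>) W t = s W))"
    using space unfolding superringed_space_def by (elim conjE)
  from this[THEN spec, THEN spec, THEN mp, of \<U> s] show ?thesis
    by this (intro conjI ballI assms; assumption)
qed

text \<open>Uniqueness of gluing, applied to the cover by all open sets on which \<open>s\<close>
  and \<open>t\<close> agree: both glue the same restrictions.\<close>

lemma sec_eq_local:
  assumes U: "U \<in> opens N (points N)" and st: "s \<in> carrier (sec N U)" "t \<in> carrier (sec N U)"
    and loc: "\<And>m. m \<in> U \<Longrightarrow> \<exists>W \<in> opens N U. m \<in> W \<and> res N U W s = res N U W t"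
  shows "s = t"
proof -
  let ?\<U> = "{W \<in> opens N U. res N U W s = res N U W t}"
  have un: "\<Union>?\<U> = U"
    using loc by (auto simp: opens_def)
  have "\<exists>!u. u \<in> carrier (sec N (\<Union>?\<U>)) \<and> (\<forall>W \<in> ?\<U>. res N (\<Union>?\<U>) W u = res N U W s)"
  proof (rule glue)
    show "?\<U> \<subseteq> opens N (points N)"
      using opens_imp_points by blast
    show "res N U W s \<in> carrier (sec N W)" if "W \<in> ?\<U>" for W
      using that superalg_hom_closed[OF res_hom[OF U]] st by blast
    show "res N W (W \<inter> W') (res N U W s) = res N W' (W \<inter> W') (res N U W' s)" if "W \<in> ?\<U>" "W' \<in> ?\<U>" for W W'
    proof -
      have "W \<in> opens N U" "W' \<in> opens N U" "W \<inter> W' \<in> opens N W" "W \<inter> W' \<in> opens N W'"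
        using that opens_Int[of W N U W' U] by auto
      then show ?thesis
        by (metis res_res[OF U _ _ st(1)])
    qed
  qed
  then show ?thesis
    unfolding un using st by (metis (mono_tags, lifting) mem_Collect_eq)
qed

text \<open>The value at \<open>m\<close> is tested by non-invertibility on all neighbourhoods
  inside the domain. Units restrict to units, so a number excluded on some neighbourhood in
  \<open>U\<close> is already excluded on its intersection with \<open>V\<close>, and both domains
  admit the same numbers.\<close>

lemma eps_res:
  assumes U: "U \<in> opens N (points N)" and V: "V \<in> opens N U" and s: "s \<in> carrier (sec N U)" and m: "m \<in> V"
  shows "eps N V (res N U V s) m = eps N U s m"
proof -
  have "(\<forall>W \<in> nbhds N m. W \<subseteq> V \<longrightarrow>
       res N V W (res N U V s) \<ominus>\<^bsub>sec N W\<^esub> (r \<odot>\<^bsub>sec N W\<^esub> \<one>\<^bsub>sec N W\<^esub>) \<notin> Units (sec N W)) \<longleftrightarrow>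
     (\<forall>W \<in> nbhds N m. W \<subseteq> U \<longrightarrow>
       res N U W s \<ominus>\<^bsub>sec N W\<^esub> (r \<odot>\<^bsub>sec N W\<^esub> \<one>\<^bsub>sec N W\<^esub>) \<notin> Units (sec N W))"
    (is "?A \<longleftrightarrow> ?B") for r
  proof
    assume ?B
    show ?A
    proof (intro ballI impI)
      fix W assume W: "W \<in> nbhds N m" "W \<subseteq> V"
      then have "W \<in> opens N V" by (auto simp: nbhds_def opens_def)
      then show "res N V W (res N U V s) \<ominus>\<^bsub>sec N W\<^esub> (r \<odot>\<^bsub>sec N W\<^esub> \<one>\<^bsub>sec N W\<^esub>) \<notin> Units (sec N W)"
        using \<open>?B\<close> W V by (simp add: res_res[OF U V _ s]) (meson opensD(2) order_trans)
    qed
  next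
    assume A: ?A
    show ?B
    proof (intro ballI impI notI)
      fix W assume W: "W \<in> nbhds N m" "W \<subseteq> U"
        and unit: "res N U W s \<ominus>\<^bsub>sec N W\<^esub> (r \<odot>\<^bsub>sec N W\<^esub> \<one>\<^bsub>sec N W\<^esub>) \<in> Units (sec N W)"
      have W': "W \<in> opens N U" using W by (auto simp: nbhds_def opens_def)
      have WV: "W \<inter> V \<in> opens N W" "W \<inter> V \<in> opens N V" "W \<in> opens N (points N)" "W \<inter> V \<in> opens N (points N)"
        using opens_Int[OF W' V] W' opens_imp_points by blast+
      interpret W: ring "sec N W" by (intro superalgebra_ring sec_superalgebra WV)
      have c: "res N U W s \<in> carrier (sec N W)" "r \<odot>\<^bsub>sec N W\<^esub> \<one>\<^bsub>sec N W\<^esub> \<in> carrier (sec N W)"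
        using superalg_hom_closed[OF res_hom[OF U W'] s] superalgebra_smult_closed[OF sec_superalgebra[OF WV(3)]]
        by auto
      note h = res_hom[OF WV(3,1)]
      have "res N W (W \<inter> V) (res N U W s \<ominus>\<^bsub>sec N W\<^esub> (r \<odot>\<^bsub>sec N W\<^esub> \<one>\<^bsub>sec N W\<^esub>)) =
          res N V (W \<inter> V) (res N U V s) \<ominus>\<^bsub>sec N (W \<inter> V)\<^esub> (r \<odot>\<^bsub>sec N (W \<inter> V)\<^esub> \<one>\<^bsub>sec N (W \<inter> V)\<^esub>)"
        using c by (simp add: superalg_hom_minus[OF h sec_superalgebra[OF WV(3)] sec_superalgebra[OF WV(4)]]
            superalg_hom_smult[OF h] superalg_hom_one[OF h] res_res[OF U W' WV(1) s] res_res[OF U V WV(2) s])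
      with superalg_hom_Units[OF h unit]
      have "res N V (W \<inter> V) (res N U V s) \<ominus>\<^bsub>sec N (W \<inter> V)\<^esub> (r \<odot>\<^bsub>sec N (W \<inter> V)\<^esub> \<one>\<^bsub>sec N (W \<inter> V)\<^esub>)
          \<in> Units (sec N (W \<inter> V))"
        by simp
      moreover have "W \<inter> V \<in> nbhds N m"
        using W m WV by (auto simp: nbhds_iff)
      ultimately show False using A by blast
    qed
  qed
  then show ?thesis
    using m V by (auto simp: eps_def opens_def)
qed

end

section \<open>Superdomains and charts\<close>

lemma grass_sign_empty [simp]: "grass_sign {} J = 1" "grass_sign I {} = 1"
  by (simp_all add: grass_sign_def)

lemma smooth_funs_restrict: "open W \<Longrightarrow> smooth_on W f \<Longrightarrow> restrict f W \<in> smooth_funs W"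
  unfolding smooth_funs_iff by (auto intro: smooth_on_cong[of W f])

lemma smooth_funsD: "f \<in> smooth_funs W \<Longrightarrow> smooth_on W f" "f \<in> smooth_funs W \<Longrightarrow> f \<in> extensional W"
  by (auto simp: smooth_funs_iff)

lemma superdomain_carrier_iff:
  "f \<in> carrier (superdomain_alg q W) \<longleftrightarrow> f \<in> (\<Pi>\<^sub>E I \<in> Pow {..<q}. smooth_funs W)"
  by (simp add: superdomain_alg_def)

lemma superdomain_comp:
  "f \<in> carrier (superdomain_alg q W) \<Longrightarrow> K \<subseteq> {..<q} \<Longrightarrow> f K \<in> smooth_funs W"
  by (auto simp: superdomain_carrier_iff PiE_iff)

lemma superdomain_eqI:
  assumes "f \<in> carrier (superdomain_alg q W)" "h \<in> carrier (superdomain_alg q W)"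
    "\<And>K x. K \<subseteq> {..<q} \<Longrightarrow> x \<in> W \<Longrightarrow> f K x = h K x"
  shows "f = h"
proof (rule ext)
  fix K
  show "f K = h K"
  proof (cases "K \<subseteq> {..<q}")
    case True
    then show ?thesis
      using assms(3)[OF True] smooth_funsD(2)[OF superdomain_comp[OF assms(1) True]]
        smooth_funsD(2)[OF superdomain_comp[OF assms(2) True]]
      by (intro extensionalityI) auto
  next
    case False
    then show ?thesis
      using assms(1,2) by (auto simp: superdomain_carrier_iff PiE_iff extensional_def)
  qed
qed

lemma superdomain_memI:
  assumes "open W" "\<And>K. K \<subseteq> {..<q} \<Longrightarrow> smooth_on W (f K)"
  shows "(\<lambda>K \<in> Pow {..<q}. \<lambda>x \<in> W. f K x) \<in> carrier (superdomain_alg q W)"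
  using assms by (auto simp: superdomain_carrier_iff intro!: smooth_funs_restrict)

lemma superdomain_mult:
  "K \<subseteq> {..<q} \<Longrightarrow> x \<in> W \<Longrightarrow> (f \<otimes>\<^bsub>superdomain_alg q W\<^esub> h) K x = (\<Sum>I \<in> Pow K. grass_sign I (K - I) * f I x * h (K - I) x)"
  by (simp add: superdomain_alg_def)

lemma superdomain_one:
  "K \<subseteq> {..<q} \<Longrightarrow> x \<in> W \<Longrightarrow> \<one>\<^bsub>superdomain_alg q W\<^esub> K x = (if K = {} then 1 else 0)"
  by (simp add: superdomain_alg_def)

lemma superdomain_add:
  "K \<subseteq> {..<q} \<Longrightarrow> x \<in> W \<Longrightarrow> (f \<oplus>\<^bsub>superdomain_alg q W\<^esub> h) K x = f K x + h K x"
  by (simp add: superdomain_alg_def)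

lemma superdomain_smult:
  "K \<subseteq> {..<q} \<Longrightarrow> x \<in> W \<Longrightarrow> (r \<odot>\<^bsub>superdomain_alg q W\<^esub> h) K x = r * h K x"
  by (simp add: superdomain_alg_def)

lemma superdomain_mult_body:
  "x \<in> W \<Longrightarrow> (f \<otimes>\<^bsub>superdomain_alg q W\<^esub> h) {} x = f {} x * h {} x"
  by (simp add: superdomain_mult)

lemma superdomain_mult_soul:
  "x \<in> W \<Longrightarrow> (f \<otimes>\<^bsub>superdomain_alg (Suc 0) W\<^esub> h) {0} x = f {} x * h {0} x + f {0} x * h {} x"
  by (simp add: superdomain_mult Pow_insert)

lemma superdomain_closed:
  assumes "open W"
  shows superdomain_one_closed: "\<one>\<^bsub>superdomain_alg q W\<^esub> \<in> carrier (superdomain_alg q W)"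
    and superdomain_add_closed: "f \<in> carrier (superdomain_alg q W) \<Longrightarrow> h \<in> carrier (superdomain_alg q W) \<Longrightarrow>
      f \<oplus>\<^bsub>superdomain_alg q W\<^esub> h \<in> carrier (superdomain_alg q W)"
    and superdomain_mult_closed: "f \<in> carrier (superdomain_alg q W) \<Longrightarrow> h \<in> carrier (superdomain_alg q W) \<Longrightarrow>
      f \<otimes>\<^bsub>superdomain_alg q W\<^esub> h \<in> carrier (superdomain_alg q W)"
    and superdomain_smult_closed: "f \<in> carrier (superdomain_alg q W) \<Longrightarrow>
      r \<odot>\<^bsub>superdomain_alg q W\<^esub> f \<in> carrier (superdomain_alg q W)"
proof -
  have 1: "\<one>\<^bsub>superdomain_alg q W\<^esub> = (\<lambda>K \<in> Pow {..<q}. \<lambda>x \<in> W. if K = {} then 1 else 0)"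
    by (simp add: superdomain_alg_def)
  show "\<one>\<^bsub>superdomain_alg q W\<^esub> \<in> carrier (superdomain_alg q W)"
    unfolding 1 by (rule superdomain_memI[OF assms]) (simp add: smooth_on_const)
  note sm = smooth_funsD(1)[OF superdomain_comp]
  show "f \<oplus>\<^bsub>superdomain_alg q W\<^esub> h \<in> carrier (superdomain_alg q W)"
    if "f \<in> carrier (superdomain_alg q W)" "h \<in> carrier (superdomain_alg q W)"
  proof -
    have "f \<oplus>\<^bsub>superdomain_alg q W\<^esub> h = (\<lambda>K \<in> Pow {..<q}. \<lambda>x \<in> W. f K x + h K x)"
      by (simp add: superdomain_alg_def)
    then show ?thesis
      using that by (simp only:) (intro superdomain_memI assms smooth_on_add sm; assumption)
  qed
  show "f \<otimes>\<^bsub>superdomain_alg q W\<^esub> h \<in> carrier (superdomain_alg q W)"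
    if "f \<in> carrier (superdomain_alg q W)" "h \<in> carrier (superdomain_alg q W)"
  proof -
    have "f \<otimes>\<^bsub>superdomain_alg q W\<^esub> h =
        (\<lambda>K \<in> Pow {..<q}. \<lambda>x \<in> W. \<Sum>I \<in> Pow K. grass_sign I (K - I) * f I x * h (K - I) x)"
      by (simp add: superdomain_alg_def)
    then show ?thesis
      using that by (simp only:) (intro superdomain_memI assms smooth_on_sum smooth_on_mult smooth_on_const sm; (assumption | blast))
  qed
  show "r \<odot>\<^bsub>superdomain_alg q W\<^esub> f \<in> carrier (superdomain_alg q W)"
    if "f \<in> carrier (superdomain_alg q W)"
  proof -
    have "r \<odot>\<^bsub>superdomain_alg q W\<^esub> f = (\<lambda>K \<in> Pow {..<q}. \<lambda>x \<in> W. r * f K x)"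
      by (simp add: superdomain_alg_def)
    then show ?thesis
      using that by (simp only:) (intro superdomain_memI assms smooth_on_mult smooth_on_const sm; assumption)
  qed
qed

text \<open>With at most one odd generator a superfunction has a body coefficient and at most one
  other, so identities split into two cases.\<close>

lemma subsets_le_1:
  assumes "q \<le> Suc 0" "K \<subseteq> {..<q}"
  shows "K = {} \<or> q = Suc 0 \<and> K = {0}"
proof -
  have "q = 0 \<or> q = Suc 0" using assms by auto
  then show ?thesis using assms(2) by (auto simp: lessThan_Suc subset_singleton_iff)
qed

text \<open>The odd generator \<theta> squares to zero, so a + b \<theta> has the inverse 1/a -
  (b/a^2) \<theta> as soon as the body a has no zero. For \<open>q = 0\<close> the second term is
  absent.\<close>

lemma superdomain_inverse:
  assumes W: "open W" and q: "q \<le> Suc 0" and f: "f \<in> carrier (superdomain_alg q W)"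
    and nz: "\<And>x. x \<in> W \<Longrightarrow> f {} x \<noteq> 0"
  obtains h where "h \<in> carrier (superdomain_alg q W)"
    "h \<otimes>\<^bsub>superdomain_alg q W\<^esub> f = \<one>\<^bsub>superdomain_alg q W\<^esub>"
    "f \<otimes>\<^bsub>superdomain_alg q W\<^esub> h = \<one>\<^bsub>superdomain_alg q W\<^esub>"
proof
  let ?A = "superdomain_alg q W"
  define h where "h = (\<lambda>K \<in> Pow {..<q}. \<lambda>x \<in> W.
    if K = {} then inverse (f {} x) else - 1 * (f K x * (inverse (f {} x) * inverse (f {} x))))"
  have sm: "smooth_on W (f K)" if "K \<subseteq> {..<q}" for K
    by (rule smooth_funsD(1)[OF superdomain_comp[OF f that]])
  show h: "h \<in> carrier ?A"
    unfolding h_def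
  proof (rule superdomain_memI[OF W])
    show "smooth_on W (\<lambda>x. if K = {} then inverse (f {} x) else - 1 * (f K x * (inverse (f {} x) * inverse (f {} x))))"
      if "K \<subseteq> {..<q}" for K
    proof (cases "K = {}")
      case True
      then show ?thesis
        using smooth_on_inverse[OF W nz sm] by simp
    next
      case False
      have "smooth_on W (\<lambda>x. - 1 * (f K x * (inverse (f {} x) * inverse (f {} x))))"
        by (intro smooth_on_mult[OF W] smooth_on_inverse[OF W] smooth_on_const sm that nz) auto
      with False show ?thesis by (simp only: if_False)
    qed
  qed
  have hx: "h K x = (if K = {} then inverse (f {} x) else - 1 * (f K x * (inverse (f {} x) * inverse (f {} x))))"
    if "K \<subseteq> {..<q}" "x \<in> W" for K x
    using that by (simp add: h_def)
  have id: "a * (- 1 * (b * (inverse a * inverse a))) + b * inverse a = 0"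
    "inverse a * b + - 1 * (b * (inverse a * inverse a)) * a = 0" if "a \<noteq> 0" for a b :: real
    using that by (simp_all add: field_simps)
  show "h \<otimes>\<^bsub>?A\<^esub> f = \<one>\<^bsub>?A\<^esub>"
  proof (rule superdomain_eqI[OF superdomain_mult_closed[OF W h f] superdomain_one_closed[OF W]])
    fix K x assume K: "K \<subseteq> {..<q}" and x: "x \<in> W"
    from subsets_le_1[OF q K] show "(h \<otimes>\<^bsub>?A\<^esub> f) K x = \<one>\<^bsub>?A\<^esub> K x"
    proof (elim disjE conjE)
      assume "K = {}"
      then show ?thesis using x nz[OF x] by (simp add: superdomain_one superdomain_mult_body hx)
    next
      assume q: "q = Suc 0" and K: "K = {0}"
      have "{0} \<subseteq> {..<q}" by (simp add: q)
      note h0 = hx[of "{}", OF empty_subsetI x, simplified] and h1 = hx[OF this x, simplified]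
        and o = superdomain_one[OF this x, unfolded q, simplified]
      show ?thesis
        unfolding K unfolding q superdomain_mult_soul[OF x] h0 h1 o
        using id[OF nz[OF x], of "f {0} x"] by simp
    qed
  qed
  show "f \<otimes>\<^bsub>?A\<^esub> h = \<one>\<^bsub>?A\<^esub>"
  proof (rule superdomain_eqI[OF superdomain_mult_closed[OF W f h] superdomain_one_closed[OF W]])
    fix K x assume K: "K \<subseteq> {..<q}" and x: "x \<in> W"
    from subsets_le_1[OF q K] show "(f \<otimes>\<^bsub>?A\<^esub> h) K x = \<one>\<^bsub>?A\<^esub> K x"
    proof (elim disjE conjE)
      assume "K = {}"
      then show ?thesis using x nz[OF x] by (simp add: superdomain_one superdomain_mult_body hx)
    next
      assume q: "q = Suc 0" and K: "K = {0}"
      have "{0} \<subseteq> {..<q}" by (simp add: q)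
      note h0 = hx[of "{}", OF empty_subsetI x, simplified] and h1 = hx[OF this x, simplified]
        and o = superdomain_one[OF this x, unfolded q, simplified]
      show ?thesis
        unfolding K unfolding q superdomain_mult_soul[OF x] h0 h1 o
        using id[OF nz[OF x], of "f {0} x"] by simp
    qed
  qed
qed

text \<open>The bound on \<open>q\<close> lets one development serve both \<open>M\<close>, charted
  with one odd coordinate, and the reduced manifold, charted with none.\<close>

locale chart = superringed N
  for N :: "('a, 's) superspace" +
  fixes q :: nat and U :: "'a set" and \<phi> :: "'a \<Rightarrow> real ^ 'n::finite"
    and \<psi> :: "(real ^ 'n) set \<Rightarrow> 'n superfun \<Rightarrow> 's"
  assumes chart: "super_chart q N U \<phi> \<psi>" and q: "q \<le> Suc 0"
begin

lemma chart_dom: "U \<in> opens N (points N)"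
  using chart by (simp add: super_chart_def opens_points)

lemma chart_homeo: "homeomorphic_map (subtopology (base N) U) (top_of_set (\<phi> ` U)) \<phi>"
  using chart by (simp add: super_chart_def)

lemma chart_topspace: "topspace (subtopology (base N) U) = U"
  using opensD(2)[OF chart_dom] by auto

lemma chart_inj: "inj_on \<phi> U"
  using homeomorphic_imp_injective_map[OF chart_homeo] chart_topspace by simp

lemma chart_image_open:
  assumes "V \<in> opens N U"
  shows "open (\<phi> ` V)"
proof -
  have "openin (subtopology (base N) U) V"
    using assms by (metis opensD openin_subset_topspace_eq openin_subtopology_Int2 inf.absorb_iff2 openin_subtopology)
  then have "openin (top_of_set (\<phi> ` U)) (\<phi> ` V)"
    using homeomorphic_imp_open_map[OF chart_homeo] by (simp add: open_map_def)
  moreover have "open (\<phi> ` U)"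
    using chart by (simp add: super_chart_def)
  ultimately show ?thesis
    using openin_open_trans by blast
qed

lemma chart_preimage_open:
  assumes "V \<in> opens N U" "open A"
  shows "V \<inter> \<phi> -` A \<in> opens N V"
proof -
  have "continuous_map (subtopology (base N) U) (top_of_set (\<phi> ` U)) \<phi>"
    using homeomorphic_imp_continuous_map[OF chart_homeo] .
  then have "openin (subtopology (base N) U) {x \<in> topspace (subtopology (base N) U). \<phi> x \<in> \<phi> ` U \<inter> A}"
    by (rule openin_continuous_map_preimage) (use assms in \<open>auto simp: openin_open\<close>)
  then have "openin (base N) {x \<in> U. \<phi> x \<in> \<phi> ` U \<inter> A}"
    unfolding chart_topspace using openin_trans_full opensD(1)[OF chart_dom] by blast
  moreover have "V \<inter> \<phi> -` A = V \<inter> {x \<in> U. \<phi> x \<in> \<phi> ` U \<inter> A}"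
    using assms by (auto simp: opens_def)
  ultimately show ?thesis
    using assms by (auto simp: opens_def)
qed

text \<open>Charts are given over open sets of the model space. Through this identity all later
  statements are indexed by open subsets of \<open>U\<close> instead.\<close>

lemma chart_vimage: "V \<subseteq> U \<Longrightarrow> U \<inter> \<phi> -` \<phi> ` V = V"
  using chart_inj by (auto simp: inj_on_def)

lemma chart_hom:
  assumes "V \<in> opens N U"
  shows "\<psi> (\<phi> ` V) \<in> superalg_hom (superdomain_alg q (\<phi> ` V)) (sec N V)"
    and "bij_betw (\<psi> (\<phi> ` V)) (carrier (superdomain_alg q (\<phi> ` V))) (carrier (sec N V))"
proof -
  have "\<forall>W. open W \<and> W \<subseteq> \<phi> ` U \<longrightarrow>
        \<psi> W \<in> superalg_hom (superdomain_alg q W) (sec N (U \<inter> \<phi> -` W)) \<and>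
        bij_betw (\<psi> W) (carrier (superdomain_alg q W)) (carrier (sec N (U \<inter> \<phi> -` W)))"
    using chart unfolding super_chart_def by (elim conjE)
  from this[rule_format, of "\<phi> ` V"] show
    "\<psi> (\<phi> ` V) \<in> superalg_hom (superdomain_alg q (\<phi> ` V)) (sec N V)"
    "bij_betw (\<psi> (\<phi> ` V)) (carrier (superdomain_alg q (\<phi> ` V))) (carrier (sec N V))"
    using chart_image_open[OF assms] opensD(2)[OF assms]
    by (simp_all add: chart_vimage[OF opensD(2)[OF assms]] image_mono)
qed

lemma chart_res:
  assumes "V \<in> opens N U" "V' \<in> opens N V" "f \<in> carrier (superdomain_alg q (\<phi> ` V))"
  shows "\<psi> (\<phi> ` V') (superdomain_res q (\<phi> ` V') f) = res N V V' (\<psi> (\<phi> ` V) f)"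
proof -
  have V': "V' \<in> opens N U" using assms opens_trans by blast
  have "\<forall>W W'. open W \<and> open W' \<and> W' \<subseteq> W \<and> W \<subseteq> \<phi> ` U \<longrightarrow>
        (\<forall>f \<in> carrier (superdomain_alg q W).
           \<psi> W' (superdomain_res q W' f) = res N (U \<inter> \<phi> -` W) (U \<inter> \<phi> -` W') (\<psi> W f))"
    using chart unfolding super_chart_def by (elim conjE)
  from this[rule_format, of "\<phi> ` V" "\<phi> ` V'" f] show ?thesis
    using chart_image_open[OF assms(1)] chart_image_open[OF V'] opensD(2)[OF assms(1)] opensD(2)[OF assms(2)] assms(3)
    by (simp add: chart_vimage[OF opensD(2)[OF assms(1)]] chart_vimage[OF opensD(2)[OF V']] image_mono)
qed

lemma superdomain_res_carrier:
  assumes "V \<in> opens N U" "V' \<in> opens N V" "f \<in> carrier (superdomain_alg q (\<phi> ` V))"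
  shows "superdomain_res q (\<phi> ` V') f \<in> carrier (superdomain_alg q (\<phi> ` V'))"
  unfolding superdomain_res_def
proof -
  have "\<phi> ` V' \<subseteq> \<phi> ` V"
    using assms opensD(2) by blast
  then show "(\<lambda>K\<in>Pow {..<q}. restrict (f K) (\<phi> ` V')) \<in> carrier (superdomain_alg q (\<phi> ` V'))"
    using chart_image_open[OF opens_trans[OF assms(1,2)]]
    by (intro superdomain_memI smooth_on_subset[OF smooth_funsD(1)[OF superdomain_comp[OF assms(3)]]]) auto
qed

lemma chart_section:
  assumes "V \<in> opens N U" "s \<in> carrier (sec N V)"
  obtains f where "f \<in> carrier (superdomain_alg q (\<phi> ` V))" "s = \<psi> (\<phi> ` V) f"
  using chart_hom(2)[OF assms(1)] assms(2) unfolding bij_betw_def by blast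

lemma chart_inject:
  assumes "V \<in> opens N U" "f \<in> carrier (superdomain_alg q (\<phi> ` V))" "h \<in> carrier (superdomain_alg q (\<phi> ` V))"
    "\<psi> (\<phi> ` V) f = \<psi> (\<phi> ` V) h"
  shows "f = h"
  using chart_hom(2)[OF assms(1)] assms unfolding bij_betw_def inj_on_def by blast

text \<open>The odd part is nilpotent, so the body alone decides: it is multiplicative, hence
  non-zero for a unit, and conversely a non-vanishing body gives the explicit inverse of
  \<open>superdomain_inverse\<close>.\<close>

lemma chart_Units:
  assumes V: "V \<in> opens N U" and f: "f \<in> carrier (superdomain_alg q (\<phi> ` V))"
  shows "\<psi> (\<phi> ` V) f \<in> Units (sec N V) \<longleftrightarrow> (\<forall>x \<in> V. f {} (\<phi> x) \<noteq> 0)"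
proof
  let ?A = "superdomain_alg q (\<phi> ` V)"
  note W = chart_image_open[OF V] and h = chart_hom(1)[OF V]
  {
    assume "\<psi> (\<phi> ` V) f \<in> Units (sec N V)"
    then obtain t where t: "t \<in> carrier (sec N V)" "t \<otimes>\<^bsub>sec N V\<^esub> \<psi> (\<phi> ` V) f = \<one>\<^bsub>sec N V\<^esub>"
      unfolding Units_def by blast
    obtain e where e: "e \<in> carrier ?A" "t = \<psi> (\<phi> ` V) e"
      using chart_section[OF V t(1)] .
    have "\<psi> (\<phi> ` V) (e \<otimes>\<^bsub>?A\<^esub> f) = \<psi> (\<phi> ` V) \<one>\<^bsub>?A\<^esub>"
      using t e f by (simp add: superalg_hom_mult[OF h] superalg_hom_one[OF h])
    then have "e \<otimes>\<^bsub>?A\<^esub> f = \<one>\<^bsub>?A\<^esub>"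
      using chart_inject[OF V] superdomain_mult_closed[OF W e(1) f] superdomain_one_closed[OF W] by blast
    then have "e {} (\<phi> x) * f {} (\<phi> x) = 1" if "x \<in> V" for x
      using that superdomain_mult_body[where f = e and h = f and q = q and x = "\<phi> x" and W = "\<phi> ` V"] by (simp add: superdomain_one)
    then show "\<forall>x \<in> V. f {} (\<phi> x) \<noteq> 0"
      by force
  }
  assume "\<forall>x \<in> V. f {} (\<phi> x) \<noteq> 0"
  then obtain e where e: "e \<in> carrier ?A" "e \<otimes>\<^bsub>?A\<^esub> f = \<one>\<^bsub>?A\<^esub>" "f \<otimes>\<^bsub>?A\<^esub> e = \<one>\<^bsub>?A\<^esub>"
    using superdomain_inverse[OF W q f] by blast
  then have "f \<in> Units ?A"
    using f unfolding Units_def by blast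
  then show "\<psi> (\<phi> ` V) f \<in> Units (sec N V)"
    by (rule superalg_hom_Units[OF h])
qed

text \<open>Subtraction is carried out in \<open>sec N V\<close>, a ring by hypothesis. The body of
  the preimage \<open>d\<close> is then read off from the fact that \<open>d\<close> plus the
  constant \<open>r\<close> is \<open>f\<close>, a computation with addition only.\<close>

lemma chart_shift:
  assumes V: "V \<in> opens N U" and f: "f \<in> carrier (superdomain_alg q (\<phi> ` V))"
  obtains d where "d \<in> carrier (superdomain_alg q (\<phi> ` V))" "\<And>x. x \<in> V \<Longrightarrow> d {} (\<phi> x) = f {} (\<phi> x) - r"
    "\<psi> (\<phi> ` V) d = \<psi> (\<phi> ` V) f \<ominus>\<^bsub>sec N V\<^esub> (r \<odot>\<^bsub>sec N V\<^esub> \<one>\<^bsub>sec N V\<^esub>)"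
proof -
  let ?A = "superdomain_alg q (\<phi> ` V)"
  let ?S = "sec N V"
  note W = chart_image_open[OF V] and h = chart_hom(1)[OF V] and V' = opens_imp_points[OF V]
  interpret ring ?S by (rule superalgebra_ring[OF sec_superalgebra[OF V']])
  note c1 = superdomain_smult_closed[OF W superdomain_one_closed[OF W], of q r]
  have c: "r \<odot>\<^bsub>?S\<^esub> \<one>\<^bsub>?S\<^esub> \<in> carrier ?S" "\<psi> (\<phi> ` V) f \<in> carrier ?S"
    using superalgebra_smult_closed[OF sec_superalgebra[OF V']] superalg_hom_closed[OF h f] by auto
  obtain d where d: "d \<in> carrier ?A" "\<psi> (\<phi> ` V) f \<ominus>\<^bsub>?S\<^esub> (r \<odot>\<^bsub>?S\<^esub> \<one>\<^bsub>?S\<^esub>) = \<psi> (\<phi> ` V) d"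
    using chart_section[OF V, of "\<psi> (\<phi> ` V) f \<ominus>\<^bsub>?S\<^esub> (r \<odot>\<^bsub>?S\<^esub> \<one>\<^bsub>?S\<^esub>)"] c by auto
  have "\<psi> (\<phi> ` V) (d \<oplus>\<^bsub>?A\<^esub> (r \<odot>\<^bsub>?A\<^esub> \<one>\<^bsub>?A\<^esub>)) = \<psi> (\<phi> ` V) f"
    using d c c1 superdomain_one_closed[OF W, of q]
    by (simp add: superalg_hom_add[OF h] superalg_hom_smult[OF h] superalg_hom_one[OF h] d(2)[symmetric]
        a_minus_def a_assoc l_neg)
  then have "d \<oplus>\<^bsub>?A\<^esub> (r \<odot>\<^bsub>?A\<^esub> \<one>\<^bsub>?A\<^esub>) = f"
    using chart_inject[OF V _ f] superdomain_add_closed[OF W d(1) c1] by blast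
  then have "d {} (\<phi> x) = f {} (\<phi> x) - r" if "x \<in> V" for x
    using that superdomain_add[of "{}" q "\<phi> x" "\<phi> ` V" d] by (auto simp: superdomain_smult superdomain_one)
  with d show ?thesis using that by simp
qed

text \<open>The invertibility test singles out the body. A section minus its body value at
  \<open>m\<close> has a body vanishing at \<open>m\<close>; any other number is avoided by the
  continuous body on a whole neighbourhood, where the difference is a unit.\<close>

lemma chart_eps:
  assumes V: "V \<in> opens N U" and f: "f \<in> carrier (superdomain_alg q (\<phi> ` V))" and m: "m \<in> V"
  shows "eps N V (\<psi> (\<phi> ` V) f) m = f {} (\<phi> m)"
proof -
  \<comment> \<open>\<open>bad r W\<close> says that the section minus \<open>r\<close> is
    invertible over \<open>W\<close>, which excludes \<open>r\<close> as the value at points of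
    \<open>W\<close>.\<close>
  define bad where "bad r W \<longleftrightarrow> res N V W (\<psi> (\<phi> ` V) f) \<ominus>\<^bsub>sec N W\<^esub> (r \<odot>\<^bsub>sec N W\<^esub> \<one>\<^bsub>sec N W\<^esub>) \<in> Units (sec N W)" for r W
  have bad: "bad r W \<longleftrightarrow> (\<forall>x \<in> W. f {} (\<phi> x) \<noteq> r)" if W: "W \<in> opens N V" for r W
  proof -
    let ?f = "superdomain_res q (\<phi> ` W) f"
    have f': "?f \<in> carrier (superdomain_alg q (\<phi> ` W))"
      by (rule superdomain_res_carrier[OF V W f])
    have W': "W \<in> opens N U" using V W opens_trans by blast
    obtain d where d: "d \<in> carrier (superdomain_alg q (\<phi> ` W))" "\<And>x. x \<in> W \<Longrightarrow> d {} (\<phi> x) = ?f {} (\<phi> x) - r"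
      "\<psi> (\<phi> ` W) d = \<psi> (\<phi> ` W) ?f \<ominus>\<^bsub>sec N W\<^esub> (r \<odot>\<^bsub>sec N W\<^esub> \<one>\<^bsub>sec N W\<^esub>)"
      using chart_shift[OF W' f'] by blast
    have "bad r W \<longleftrightarrow> \<psi> (\<phi> ` W) d \<in> Units (sec N W)"
      by (simp add: bad_def d(3) chart_res[OF V W f])
    also have "\<dots> \<longleftrightarrow> (\<forall>x \<in> W. f {} (\<phi> x) \<noteq> r)"
      by (auto simp: chart_Units[OF W' d(1)] d(2) superdomain_res_def)
    finally show ?thesis .
  qed
  have sub: "W \<in> opens N V" if "W \<in> nbhds N m" "W \<subseteq> V" for W
    using that by (auto simp: nbhds_def opens_def)
  have "(THE r. \<forall>W \<in> nbhds N m. W \<subseteq> V \<longrightarrow> \<not> bad r W) = f {} (\<phi> m)"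
  proof (rule the_equality)
    show "\<forall>W \<in> nbhds N m. W \<subseteq> V \<longrightarrow> \<not> bad (f {} (\<phi> m)) W"
      using bad sub by (auto simp: nbhds_def)
    fix r assume r: "\<forall>W \<in> nbhds N m. W \<subseteq> V \<longrightarrow> \<not> bad r W"
    show "r = f {} (\<phi> m)"
    proof (rule ccontr)
      assume ne: "r \<noteq> f {} (\<phi> m)"
      have W: "open (\<phi> ` V)" by (rule chart_image_open[OF V])
      \<comment> \<open>Continuity of the body makes the set where it differs from \<open>r\<close>
        a neighbourhood of \<open>m\<close>.\<close>
      have "continuous_on (\<phi> ` V) (f {})"
        using superdomain_comp[OF f, of "{}"] by (auto dest: smooth_funsD(1) smooth_on_imp_continuous_on)
      then have "open (\<phi> ` V \<inter> f {} -` (- {r}))"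
        by (rule continuous_open_preimage[OF _ W]) auto
      then have o: "V \<inter> \<phi> -` (\<phi> ` V \<inter> f {} -` (- {r})) \<in> opens N V" (is "?W \<in> _")
        by (rule chart_preimage_open[OF V])
      moreover have "?W \<in> nbhds N m" "?W \<subseteq> V"
        using o m ne opens_imp_points[OF o] by (auto simp: nbhds_iff)
      ultimately have "\<not> bad r ?W" using r by blast
      then show False using bad[OF o] by auto
    qed
  qed
  then show ?thesis
    using m by (simp add: eps_def bad_def)
qed

end

section \<open>Vector fields\<close>

context superringed
begin

lemma vect_homD:
  assumes "X \<in> vect_hom N U p" "W \<in> opens N U"
  shows vect_hom_closed: "s \<in> carrier (sec N W) \<Longrightarrow> X W s \<in> carrier (sec N W)"
    and vect_hom_add: "s \<in> carrier (sec N W) \<Longrightarrow> t \<in> carrier (sec N W) \<Longrightarrow>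
      X W (s \<oplus>\<^bsub>sec N W\<^esub> t) = X W s \<oplus>\<^bsub>sec N W\<^esub> X W t"
    and vect_hom_smult: "s \<in> carrier (sec N W) \<Longrightarrow> X W (r \<odot>\<^bsub>sec N W\<^esub> s) = r \<odot>\<^bsub>sec N W\<^esub> X W s"
    and vect_hom_gr: "s \<in> gr (sec N W) q \<Longrightarrow> X W s \<in> gr (sec N W) (p + q)"
    and vect_hom_leibniz: "s \<in> gr (sec N W) q \<Longrightarrow> t \<in> carrier (sec N W) \<Longrightarrow>
      X W (s \<otimes>\<^bsub>sec N W\<^esub> t) =
        (X W s \<otimes>\<^bsub>sec N W\<^esub> t) \<oplus>\<^bsub>sec N W\<^esub> (ksign p q \<odot>\<^bsub>sec N W\<^esub> (s \<otimes>\<^bsub>sec N W\<^esub> X W t))"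
    and vect_hom_res: "W' \<in> opens N W \<Longrightarrow> s \<in> carrier (sec N W) \<Longrightarrow> X W' (res N W W' s) = res N W W' (X W s)"
  using assms by (auto simp: vect_hom_def PiE_iff image_subset_iff)

text \<open>The function space of fields, with \<open>undefined\<close> off the domain; membership
  is what turns agreement on sections into equality of fields.\<close>

definition vf_family :: "'a set \<Rightarrow> ('a, 's) vf set" where
  "vf_family U = (\<Pi>\<^sub>E W \<in> opens N U. carrier (sec N W) \<rightarrow>\<^sub>E carrier (sec N W))"

lemma vect_hom_family: "X \<in> vect_hom N U p \<Longrightarrow> X \<in> vf_family U"
  by (simp add: vect_hom_def vf_family_def)

lemma vf_familyI:
  "(\<And>W s. W \<in> opens N U \<Longrightarrow> s \<in> carrier (sec N W) \<Longrightarrow> X W s \<in> carrier (sec N W)) \<Longrightarrow>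
    (\<lambda>W \<in> opens N U. \<lambda>s \<in> carrier (sec N W). X W s) \<in> vf_family U"
  by (auto simp: vf_family_def)

lemma vf_eqI:
  assumes "X \<in> vf_family U" "Y \<in> vf_family U"
    "\<And>W s. W \<in> opens N U \<Longrightarrow> s \<in> carrier (sec N W) \<Longrightarrow> X W s = Y W s"
  shows "X = Y"
proof (rule PiE_ext[OF assms(1,2)[unfolded vf_family_def]])
  fix W assume W: "W \<in> opens N U"
  show "X W = Y W"
    by (rule extensionalityI[where A = "carrier (sec N W)"])
      (use assms W in \<open>auto simp: vf_family_def PiE_iff\<close>)
qed

lemma vect_homI:
  assumes "X \<in> vf_family U"
    and "\<And>W s t. W \<in> opens N U \<Longrightarrow> s \<in> carrier (sec N W) \<Longrightarrow> t \<in> carrier (sec N W) \<Longrightarrow>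
      X W (s \<oplus>\<^bsub>sec N W\<^esub> t) = X W s \<oplus>\<^bsub>sec N W\<^esub> X W t"
    and "\<And>W r s. W \<in> opens N U \<Longrightarrow> s \<in> carrier (sec N W) \<Longrightarrow> X W (r \<odot>\<^bsub>sec N W\<^esub> s) = r \<odot>\<^bsub>sec N W\<^esub> X W s"
    and "\<And>W q s. W \<in> opens N U \<Longrightarrow> s \<in> gr (sec N W) q \<Longrightarrow> X W s \<in> gr (sec N W) (p + q)"
    and "\<And>W q s t. W \<in> opens N U \<Longrightarrow> s \<in> gr (sec N W) q \<Longrightarrow> t \<in> carrier (sec N W) \<Longrightarrow>
      X W (s \<otimes>\<^bsub>sec N W\<^esub> t) =
        (X W s \<otimes>\<^bsub>sec N W\<^esub> t) \<oplus>\<^bsub>sec N W\<^esub> (ksign p q \<odot>\<^bsub>sec N W\<^esub> (s \<otimes>\<^bsub>sec N W\<^esub> X W t))"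
    and "\<And>W W' s. W \<in> opens N U \<Longrightarrow> W' \<in> opens N W \<Longrightarrow> s \<in> carrier (sec N W) \<Longrightarrow>
      X W' (res N W W' s) = res N W W' (X W s)"
  shows "X \<in> vect_hom N U p"
  unfolding vect_hom_def
  by (intro CollectI conjI ballI allI image_subsetI assms assms(1)[unfolded vf_family_def]; assumption)

text \<open>Zero is homogeneous of either parity. Thus a homogeneous field becomes an element of
  \<open>vect\<close> by adding the zero field of the other parity.\<close>

lemma vf_zero_vect_hom:
  assumes U: "U \<in> opens N (points N)"
  shows "vf_zero N U \<in> vect_hom N U p"
proof -
  have W: "W \<in> opens N (points N)" if "W \<in> opens N U" for W
    using that U opens_trans by blast
  have r: "ring (sec N W)" if "W \<in> opens N U" for W
    using superalgebra_ring[OF sec_superalgebra[OF W[OF that]]] .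
  have z: "r \<odot>\<^bsub>sec N W\<^esub> \<zero>\<^bsub>sec N W\<^esub> = \<zero>\<^bsub>sec N W\<^esub>" if "W \<in> opens N U" for r W
    using module.smult_r_null[OF superalgebra_module[OF sec_superalgebra[OF W[OF that]]], of r]
    by (simp add: real_ring_def)
  have h: "res N W W' \<zero>\<^bsub>sec N W\<^esub> = \<zero>\<^bsub>sec N W'\<^esub>" if "W \<in> opens N U" "W' \<in> opens N W" for W W'
  proof -
    interpret A: ring "sec N W" using r that by blast
    interpret B: ring "sec N W'" using r that opens_trans by blast
    interpret ring_hom_ring "sec N W" "sec N W'" "res N W W'"
      using res_hom[OF W that(2)] that(1) by (intro ring_hom_ringI2 A.ring_axioms B.ring_axioms) (simp add: superalg_hom_def)
    show ?thesis by simp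
  qed
  have ap: "vf_zero N U W s = \<zero>\<^bsub>sec N W\<^esub>" if "W \<in> opens N U" "s \<in> carrier (sec N W)" for W s
    using that by (simp add: vf_zero_def)
  have c: "s \<in> carrier (sec N W)" if "W \<in> opens N U" "s \<in> gr (sec N W) q" for W s q
    using superalgebra_gr[OF sec_superalgebra[OF W]] that by blast
  show ?thesis
  proof (rule vect_homI)
    show "vf_zero N U \<in> vf_family U"
      unfolding vf_zero_def by (rule vf_familyI) (use r in \<open>auto simp: ring.ring_simprules(2)\<close>)
  next
    fix W s t assume W: "W \<in> opens N U" and s: "s \<in> carrier (sec N W)" and t: "t \<in> carrier (sec N W)"
    interpret ring "sec N W" by (rule r[OF W])
    show "vf_zero N U W (s \<oplus>\<^bsub>sec N W\<^esub> t) = vf_zero N U W s \<oplus>\<^bsub>sec N W\<^esub> vf_zero N U W t"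
      using W s t by (simp add: ap)
  next
    fix W r s assume W: "W \<in> opens N U" and s: "s \<in> carrier (sec N W)"
    show "vf_zero N U W (r \<odot>\<^bsub>sec N W\<^esub> s) = r \<odot>\<^bsub>sec N W\<^esub> vf_zero N U W s"
      using W s superalgebra_smult_closed[OF sec_superalgebra[OF opens_trans[OF U W]]]
      by (simp add: ap z)
  next
    fix W q s assume W: "W \<in> opens N U" and s: "s \<in> gr (sec N W) q"
    show "vf_zero N U W s \<in> gr (sec N W) (p + q)"
      using c[OF W s] superalgebra_gr_zero[OF sec_superalgebra[OF opens_trans[OF U W]]] W by (simp add: ap)
  next
    fix W q s t assume W: "W \<in> opens N U" and s: "s \<in> gr (sec N W) q" and t: "t \<in> carrier (sec N W)"
    interpret ring "sec N W" by (rule r[OF W])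
    show "vf_zero N U W (s \<otimes>\<^bsub>sec N W\<^esub> t) =
        (vf_zero N U W s \<otimes>\<^bsub>sec N W\<^esub> t) \<oplus>\<^bsub>sec N W\<^esub> (ksign p q \<odot>\<^bsub>sec N W\<^esub> (s \<otimes>\<^bsub>sec N W\<^esub> vf_zero N U W t))"
      using W c[OF W s] t by (simp add: ap z)
  next
    fix W W' s assume W: "W \<in> opens N U" and W': "W' \<in> opens N W" and s: "s \<in> carrier (sec N W)"
    have "W' \<in> opens N U" "res N W W' s \<in> carrier (sec N W')"
      using opens_trans[OF W W'] superalg_hom_closed[OF res_hom[OF _ W'] s] opens_trans[OF U W] by auto
    then show "vf_zero N U W' (res N W W' s) = res N W W' (vf_zero N U W s)"
      using W W' s by (simp add: ap h)
  qed
qed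

lemma vf_restrict_vect_hom:
  assumes X: "X \<in> vect_hom N U p" and W: "W \<in> opens N U" and U: "U \<in> opens N (points N)"
  shows "vf_restrict N W X \<in> vect_hom N W p"
proof -
  have sub: "V \<in> opens N U" if "V \<in> opens N W" for V
    using that W opens_trans by blast
  have ap: "vf_restrict N W X V = X V" if "V \<in> opens N W" for V
    using that by (simp add: vf_restrict_def)
  have "vf_restrict N W X \<in> vf_family W"
    using vect_hom_family[OF X] sub by (auto simp: vf_family_def PiE_iff vf_restrict_def)
  then show ?thesis
  proof (rule vect_homI)
    show "vf_restrict N W X V s \<in> gr (sec N V) (p + q)" if "V \<in> opens N W" "s \<in> gr (sec N V) q" for V q s
      using vect_hom_gr[OF X sub] that by (simp only: ap)
  qed (use sub opens_trans[of _ N W] in \<open>simp_all add: ap vect_hom_add[OF X] vect_hom_smult[OF X] vect_hom_leibniz[OF X] vect_hom_res[OF X]\<close>)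
qed

end

section \<open>Sections of a supermanifold with Shander charts\<close>

locale shander_space = superringed M
  for M :: "('a, 's) superspace" +
  fixes n :: "'n::finite itself" and Q P :: "('a, 's) vf"
  assumes Q: "Q \<in> vect_hom M (points M) 1"
    and shander: "\<And>m. m \<in> points M \<Longrightarrow> \<exists>U (\<phi> :: 'a \<Rightarrow> real ^ 'n) \<psi> k. m \<in> U \<and> shander_chart M Q P U \<phi> \<psi> k"
begin

section \<open>The two chart-free components of a section\<close>

abbreviation e0 :: "'a set \<Rightarrow> 's \<Rightarrow> 'a \<Rightarrow> real" where
  "e0 \<equiv> eps M"

definition e1 :: "'a set \<Rightarrow> 's \<Rightarrow> 'a \<Rightarrow> real" where
  "e1 V s = eps M V (Q V s)"

abbreviation opn :: "'a set \<Rightarrow> bool" where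
  "opn V \<equiv> V \<in> opens M (points M)"

lemma Q_closed: "opn V \<Longrightarrow> s \<in> carrier (sec M V) \<Longrightarrow> Q V s \<in> carrier (sec M V)"
  using vect_hom_closed[OF Q] .

lemma res_closed: "opn V \<Longrightarrow> W \<in> opens M V \<Longrightarrow> s \<in> carrier (sec M V) \<Longrightarrow> res M V W s \<in> carrier (sec M W)"
  using superalg_hom_closed[OF res_hom] .

lemma e0_res: "opn V \<Longrightarrow> W \<in> opens M V \<Longrightarrow> s \<in> carrier (sec M V) \<Longrightarrow> m \<in> W \<Longrightarrow> e0 W (res M V W s) m = e0 V s m"
  by (rule eps_res)

lemma e1_res: "opn V \<Longrightarrow> W \<in> opens M V \<Longrightarrow> s \<in> carrier (sec M V) \<Longrightarrow> m \<in> W \<Longrightarrow> e1 W (res M V W s) m = e1 V s m"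
  using eps_res[of V W "Q V s"] Q_closed vect_hom_res[OF Q] by (simp add: e1_def)

lemma shander_chartE:
  assumes "m \<in> points M"
  obtains U and \<phi> :: "'a \<Rightarrow> real ^ 'n" and \<psi> where "m \<in> U" "chart M (Suc 0) U \<phi> \<psi>"
    "\<And>V f x. V \<in> opens M U \<Longrightarrow> f \<in> carrier (superdomain_alg (Suc 0) (\<phi> ` V)) \<Longrightarrow> x \<in> V \<Longrightarrow>
      e1 V (\<psi> (\<phi> ` V) f) x = f {0} (\<phi> x)"
proof -
  obtain U and \<phi> :: "'a \<Rightarrow> real ^ 'n" and \<psi> k where m: "m \<in> U" and S: "shander_chart M Q P U \<phi> \<psi> k"
    using shander[OF assms] by blast
  have "super_chart 1 M U \<phi> \<psi>"
    using S unfolding shander_chart_def One_nat_def by (rule conjunct1)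
  then interpret chart M "Suc 0" U \<phi> \<psi>
    by unfold_locales simp_all
  have "e1 V (\<psi> (\<phi> ` V) f) x = f {0} (\<phi> x)"
    if V: "V \<in> opens M U" and f: "f \<in> carrier (superdomain_alg (Suc 0) (\<phi> ` V))" and x: "x \<in> V" for V f x
  proof -
    let ?W = "\<phi> ` V"
    let ?A = "superdomain_alg (Suc 0) ?W"
    note W = chart_image_open[OF V]
    have "\<forall>W. open W \<and> W \<subseteq> \<phi> ` U \<longrightarrow> (\<forall>f \<in> carrier (superdomain_alg (Suc 0) W).
        Q (U \<inter> \<phi> -` W) (\<psi> W f) =
          \<psi> W (odd_partial (Suc 0) W 0 f \<oplus>\<^bsub>superdomain_alg (Suc 0) W\<^esub>
                (theta (Suc 0) W 0 \<otimes>\<^bsub>superdomain_alg (Suc 0) W\<^esub> even_partial (Suc 0) W k f)))"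
      using S unfolding shander_chart_def One_nat_def by blast
    from this[rule_format, of ?W f]
    have QV: "Q V (\<psi> ?W f) = \<psi> ?W (odd_partial (Suc 0) ?W 0 f \<oplus>\<^bsub>?A\<^esub> (theta (Suc 0) ?W 0 \<otimes>\<^bsub>?A\<^esub> even_partial (Suc 0) ?W k f))"
      using W opensD(2)[OF V] f by (simp add: chart_vimage image_mono)
    have c: "odd_partial (Suc 0) ?W 0 f \<in> carrier ?A" "theta (Suc 0) ?W 0 \<in> carrier ?A" "even_partial (Suc 0) ?W k f \<in> carrier ?A"
    proof -
      show "odd_partial (Suc 0) ?W 0 f \<in> carrier ?A"
        unfolding odd_partial_def
      proof (rule superdomain_memI[OF W])
        fix K :: "nat set" assume "K \<subseteq> {..<Suc 0}"
        then have "insert 0 K \<subseteq> {..<Suc 0}" by auto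
        then have "smooth_on ?W (\<lambda>x. grass_sign {0} K * f (insert 0 K) x)"
          by (intro smooth_on_mult[OF W] smooth_on_const smooth_funsD(1)[OF superdomain_comp[OF f]])
        then show "smooth_on ?W (\<lambda>x. if 0 \<in> K then 0 else grass_sign {0} K * f (insert 0 K) x)"
          by (cases "0 \<in> K") (simp_all add: smooth_on_const)
      qed
      show "theta (Suc 0) ?W 0 \<in> carrier ?A"
        unfolding theta_def by (rule superdomain_memI[OF W]) (simp add: smooth_on_const)
      show "even_partial (Suc 0) ?W k f \<in> carrier ?A"
        unfolding even_partial_def
        by (rule superdomain_memI[OF W]) (rule smooth_on_partial[OF smooth_funsD(1)[OF superdomain_comp[OF f]]])
    qed
    have "e1 V (\<psi> ?W f) x = (odd_partial (Suc 0) ?W 0 f \<oplus>\<^bsub>?A\<^esub> (theta (Suc 0) ?W 0 \<otimes>\<^bsub>?A\<^esub> even_partial (Suc 0) ?W k f)) {} (\<phi> x)"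
      unfolding e1_def QV
      by (rule chart_eps[OF V superdomain_add_closed[OF W c(1) superdomain_mult_closed[OF W c(2,3)]] x])
    also have "\<dots> = f {0} (\<phi> x)"
      using x by (subst superdomain_add) (auto simp: superdomain_mult_body odd_partial_def theta_def)
    finally show ?thesis .
  qed
  then show ?thesis
    using that[OF m chart_axioms] by blast
qed

text \<open>What is used of a Shander chart over a single open set: a homomorphism whose
  coefficients are read off by the two components. Surjectivity is replaced by the representatives
  that \<open>localE\<close> supplies.\<close>

definition trivialises :: "('a \<Rightarrow> real ^ 'n) \<Rightarrow> ('n superfun \<Rightarrow> 's) \<Rightarrow> 'a set \<Rightarrow> bool" where
  "trivialises \<phi> h V \<longleftrightarrow> open (\<phi> ` V) \<and> h \<in> superalg_hom (superdomain_alg (Suc 0) (\<phi> ` V)) (sec M V) \<and>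
    (\<forall>u \<in> carrier (superdomain_alg (Suc 0) (\<phi> ` V)). \<forall>x \<in> V. e0 V (h u) x = u {} (\<phi> x) \<and> e1 V (h u) x = u {0} (\<phi> x))"

text \<open>Two sections are represented at once, so that sums and products can be computed in one
  chart.\<close>

lemma localE:
  assumes V: "opn V" and m: "m \<in> V" and s: "s \<in> carrier (sec M V)" and t: "t \<in> carrier (sec M V)"
  obtains V' \<phi> h f f' where "V' \<in> opens M V" "m \<in> V'" "trivialises \<phi> h V'"
    "f \<in> carrier (superdomain_alg (Suc 0) (\<phi> ` V'))" "f' \<in> carrier (superdomain_alg (Suc 0) (\<phi> ` V'))"
    "res M V V' s = h f" "res M V V' t = h f'"
proof -
  have "m \<in> points M" using V m opensD(2) by blast
  then obtain U and \<phi> :: "'a \<Rightarrow> real ^ 'n" and \<psi> where U: "m \<in> U" "chart M (Suc 0) U \<phi> \<psi>"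
    and e1: "\<And>V f x. V \<in> opens M U \<Longrightarrow> f \<in> carrier (superdomain_alg (Suc 0) (\<phi> ` V)) \<Longrightarrow> x \<in> V \<Longrightarrow>
      e1 V (\<psi> (\<phi> ` V) f) x = f {0} (\<phi> x)"
    using shander_chartE by metis
  interpret chart M "Suc 0" U \<phi> \<psi> by fact
  let ?V = "V \<inter> U"
  have V': "?V \<in> opens M V" "?V \<in> opens M U"
    using opens_Int[OF V chart_dom] by auto
  obtain f where f: "f \<in> carrier (superdomain_alg (Suc 0) (\<phi> ` ?V))" "res M V ?V s = \<psi> (\<phi> ` ?V) f"
    using chart_section[OF V'(2) res_closed[OF V V'(1) s]] .
  obtain f' where f': "f' \<in> carrier (superdomain_alg (Suc 0) (\<phi> ` ?V))" "res M V ?V t = \<psi> (\<phi> ` ?V) f'"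
    using chart_section[OF V'(2) res_closed[OF V V'(1) t]] .
  have "trivialises \<phi> (\<psi> (\<phi> ` ?V)) ?V"
    unfolding trivialises_def
    by (intro conjI ballI chart_image_open[OF V'(2)] chart_hom(1)[OF V'(2)] chart_eps[OF V'(2)] e1[OF V'(2)])
  then show ?thesis
    using that[OF V'(1) _ _ f(1) f'(1) f(2) f'(2)] m U by blast
qed

text \<open>All rules are read off from one local representation. The product rule for
  \<open>e1\<close> carries no Koszul sign although Q is odd: the sign would stand before the body
  of an odd section, which is zero.\<close>

lemma e_add:
  assumes V: "opn V" and s: "s \<in> carrier (sec M V)" and t: "t \<in> carrier (sec M V)" and m: "m \<in> V"
  shows e0_add: "e0 V (s \<oplus>\<^bsub>sec M V\<^esub> t) m = e0 V s m + e0 V t m"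
    and e1_add: "e1 V (s \<oplus>\<^bsub>sec M V\<^esub> t) m = e1 V s m + e1 V t m"
    and e0_mult: "e0 V (s \<otimes>\<^bsub>sec M V\<^esub> t) m = e0 V s m * e0 V t m"
    and e1_mult: "e1 V (s \<otimes>\<^bsub>sec M V\<^esub> t) m = e1 V s m * e0 V t m + e0 V s m * e1 V t m"
    and e0_smult_aux: "e0 V (r \<odot>\<^bsub>sec M V\<^esub> s) m = r * e0 V s m"
    and e1_smult_aux: "e1 V (r \<odot>\<^bsub>sec M V\<^esub> s) m = r * e1 V s m"
    and e0_one_aux: "e0 V \<one>\<^bsub>sec M V\<^esub> m = 1"
    and e1_one_aux: "e1 V \<one>\<^bsub>sec M V\<^esub> m = 0"
proof -
  obtain V' \<phi> h f f' where V': "V' \<in> opens M V" and m': "m \<in> V'" and triv: "trivialises \<phi> h V'"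
    and f: "f \<in> carrier (superdomain_alg (Suc 0) (\<phi> ` V'))" and f': "f' \<in> carrier (superdomain_alg (Suc 0) (\<phi> ` V'))"
    and rs: "res M V V' s = h f" and rt: "res M V V' t = h f'"
    by (rule localE[OF V m s t]) (rule that)
  have W: "open (\<phi> ` V')" and h: "h \<in> superalg_hom (superdomain_alg (Suc 0) (\<phi> ` V')) (sec M V')"
    and e0: "\<And>u x. u \<in> carrier (superdomain_alg (Suc 0) (\<phi> ` V')) \<Longrightarrow> x \<in> V' \<Longrightarrow> e0 V' (h u) x = u {} (\<phi> x)"
    and e1: "\<And>u x. u \<in> carrier (superdomain_alg (Suc 0) (\<phi> ` V')) \<Longrightarrow> x \<in> V' \<Longrightarrow> e1 V' (h u) x = u {0} (\<phi> x)"
    using triv unfolding trivialises_def by blast+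
  let ?A = "superdomain_alg (Suc 0) (\<phi> ` V')"
  note rh = res_hom[OF V V']
  interpret ring "sec M V" by (rule superalgebra_ring[OF sec_superalgebra[OF V]])
  have c: "s \<oplus>\<^bsub>sec M V\<^esub> t \<in> carrier (sec M V)" "s \<otimes>\<^bsub>sec M V\<^esub> t \<in> carrier (sec M V)"
    "r \<odot>\<^bsub>sec M V\<^esub> s \<in> carrier (sec M V)" "\<one>\<^bsub>sec M V\<^esub> \<in> carrier (sec M V)"
    using s t superalgebra_smult_closed[OF sec_superalgebra[OF V]] by auto
  have r: "res M V V' (s \<oplus>\<^bsub>sec M V\<^esub> t) = h (f \<oplus>\<^bsub>?A\<^esub> f')" "res M V V' (s \<otimes>\<^bsub>sec M V\<^esub> t) = h (f \<otimes>\<^bsub>?A\<^esub> f')"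
    "res M V V' (r \<odot>\<^bsub>sec M V\<^esub> s) = h (r \<odot>\<^bsub>?A\<^esub> f)" "res M V V' \<one>\<^bsub>sec M V\<^esub> = h \<one>\<^bsub>?A\<^esub>"
    using s t f f' rs rt by (simp_all add: superalg_hom_add[OF h] superalg_hom_mult[OF h] superalg_hom_smult[OF h]
        superalg_hom_one[OF h] superalg_hom_add[OF rh] superalg_hom_mult[OF rh] superalg_hom_smult[OF rh]
        superalg_hom_one[OF rh])
  have st: "e0 V s m = f {} (\<phi> m)" "e1 V s m = f {0} (\<phi> m)" "e0 V t m = f' {} (\<phi> m)" "e1 V t m = f' {0} (\<phi> m)"
    using e0_res[OF V V' s m'] e1_res[OF V V' s m'] e0_res[OF V V' t m'] e1_res[OF V V' t m'] e0 e1 f f' m' rs rt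
    by auto
  note C = superdomain_add_closed[OF W f f'] superdomain_mult_closed[OF W f f'] superdomain_smult_closed[OF W f]
    superdomain_one_closed[OF W]
  have x: "\<phi> m \<in> \<phi> ` V'" using m' by simp
  note x1 = superdomain_add[OF _ x] superdomain_smult[OF _ x] superdomain_one[OF _ x]
    superdomain_mult_body[OF x] superdomain_mult_soul[OF x]
  show "e0 V (s \<oplus>\<^bsub>sec M V\<^esub> t) m = e0 V s m + e0 V t m"
    using e0_res[OF V V' c(1) m'] C by (simp add: st r e0 m' x1)
  show "e1 V (s \<oplus>\<^bsub>sec M V\<^esub> t) m = e1 V s m + e1 V t m"
    using e1_res[OF V V' c(1) m'] C by (simp add: st r e1 m' x1)
  show "e0 V (s \<otimes>\<^bsub>sec M V\<^esub> t) m = e0 V s m * e0 V t m"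
    using e0_res[OF V V' c(2) m'] C by (simp add: st r e0 m' x1)
  show "e1 V (s \<otimes>\<^bsub>sec M V\<^esub> t) m = e1 V s m * e0 V t m + e0 V s m * e1 V t m"
    using e1_res[OF V V' c(2) m'] C by (simp add: st r e1 m' x1)
  show "e0 V (r \<odot>\<^bsub>sec M V\<^esub> s) m = r * e0 V s m"
    using e0_res[OF V V' c(3) m'] C by (simp add: st r e0 m' x1)
  show "e1 V (r \<odot>\<^bsub>sec M V\<^esub> s) m = r * e1 V s m"
    using e1_res[OF V V' c(3) m'] C by (simp add: st r e1 m' x1)
  show "e0 V \<one>\<^bsub>sec M V\<^esub> m = 1"
    using e0_res[OF V V' c(4) m'] C by (simp add: st r e0 m' x1)
  show "e1 V \<one>\<^bsub>sec M V\<^esub> m = 0"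
    using e1_res[OF V V' c(4) m'] C by (simp add: st r e1 m' x1)
qed

lemma zero_closed: "opn V \<Longrightarrow> \<zero>\<^bsub>sec M V\<^esub> \<in> carrier (sec M V)"
  and one_closed: "opn V \<Longrightarrow> \<one>\<^bsub>sec M V\<^esub> \<in> carrier (sec M V)"
  and add_closed: "opn V \<Longrightarrow> s \<in> carrier (sec M V) \<Longrightarrow> t \<in> carrier (sec M V) \<Longrightarrow> s \<oplus>\<^bsub>sec M V\<^esub> t \<in> carrier (sec M V)"
  and mult_closed: "opn V \<Longrightarrow> s \<in> carrier (sec M V) \<Longrightarrow> t \<in> carrier (sec M V) \<Longrightarrow> s \<otimes>\<^bsub>sec M V\<^esub> t \<in> carrier (sec M V)"
  and smult_closed: "opn V \<Longrightarrow> s \<in> carrier (sec M V) \<Longrightarrow> r \<odot>\<^bsub>sec M V\<^esub> s \<in> carrier (sec M V)"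
  and gr_closed: "opn V \<Longrightarrow> s \<in> gr (sec M V) p \<Longrightarrow> s \<in> carrier (sec M V)"
  using superalgebra_ring[OF sec_superalgebra] superalgebra_smult_closed[OF sec_superalgebra]
    superalgebra_gr[OF sec_superalgebra]
  by (blast intro: ring.ring_simprules)+

lemma e_zero:
  assumes "opn V" "m \<in> V"
  shows e0_zero: "e0 V \<zero>\<^bsub>sec M V\<^esub> m = 0" and e1_zero: "e1 V \<zero>\<^bsub>sec M V\<^esub> m = 0"
proof -
  interpret ring "sec M V" by (rule superalgebra_ring[OF sec_superalgebra[OF assms(1)]])
  show "e0 V \<zero>\<^bsub>sec M V\<^esub> m = 0" "e1 V \<zero>\<^bsub>sec M V\<^esub> m = 0"
    using e0_add[of V "\<zero>\<^bsub>sec M V\<^esub>" "\<zero>\<^bsub>sec M V\<^esub>" m] e1_add[of V "\<zero>\<^bsub>sec M V\<^esub>" "\<zero>\<^bsub>sec M V\<^esub>" m] assms by simp_all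
qed

lemma e_smult:
  assumes "opn V" "s \<in> carrier (sec M V)" "m \<in> V"
  shows e0_smult: "e0 V (r \<odot>\<^bsub>sec M V\<^esub> s) m = r * e0 V s m"
    and e1_smult: "e1 V (r \<odot>\<^bsub>sec M V\<^esub> s) m = r * e1 V s m"
  using e0_smult_aux[OF assms(1,2,2,3)] e1_smult_aux[OF assms(1,2,2,3)] by auto

lemma e_one:
  assumes "opn V" "m \<in> V"
  shows e0_one: "e0 V \<one>\<^bsub>sec M V\<^esub> m = 1" and e1_one: "e1 V \<one>\<^bsub>sec M V\<^esub> m = 0"
  using e0_one_aux[OF assms(1) zero_closed zero_closed assms(2)] e1_one_aux[OF assms(1) zero_closed zero_closed assms(2)]
    assms(1) by auto

lemmas e_simps = e0_res e1_res e0_add e1_add e0_mult e1_mult e0_smult e1_smult e0_one e1_one e0_zero e1_zero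
lemmas closed = zero_closed one_closed add_closed mult_closed smult_closed gr_closed Q_closed res_closed

text \<open>Over a Shander chart the two components are all the coefficients a section has. This
  turns identities between sections into identities between real functions and is the main device
  below.\<close>

lemma sec_eqI:
  assumes V: "opn V" and s: "s \<in> carrier (sec M V)" and t: "t \<in> carrier (sec M V)"
    and e: "\<And>m. m \<in> V \<Longrightarrow> e0 V s m = e0 V t m" "\<And>m. m \<in> V \<Longrightarrow> e1 V s m = e1 V t m"
  shows "s = t"
proof (rule sec_eq_local[OF V s t])
  fix m assume m: "m \<in> V"
  obtain V' \<phi> h f f' where V': "V' \<in> opens M V" and m': "m \<in> V'" and triv: "trivialises \<phi> h V'"
    and f: "f \<in> carrier (superdomain_alg (Suc 0) (\<phi> ` V'))" and f': "f' \<in> carrier (superdomain_alg (Suc 0) (\<phi> ` V'))"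
    and rs: "res M V V' s = h f" and rt: "res M V V' t = h f'"
    by (rule localE[OF V m s t]) (rule that)
  have W: "open (\<phi> ` V')" and h: "h \<in> superalg_hom (superdomain_alg (Suc 0) (\<phi> ` V')) (sec M V')"
    and e0: "\<And>u x. u \<in> carrier (superdomain_alg (Suc 0) (\<phi> ` V')) \<Longrightarrow> x \<in> V' \<Longrightarrow> e0 V' (h u) x = u {} (\<phi> x)"
    and e1: "\<And>u x. u \<in> carrier (superdomain_alg (Suc 0) (\<phi> ` V')) \<Longrightarrow> x \<in> V' \<Longrightarrow> e1 V' (h u) x = u {0} (\<phi> x)"
    using triv unfolding trivialises_def by blast+
  have "f = f'"
  proof (rule superdomain_eqI[OF f f'])
    fix K x assume K: "K \<subseteq> {..<Suc 0}" and "x \<in> \<phi> ` V'"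
    then obtain y where y: "y \<in> V'" "x = \<phi> y" by blast
    then have yV: "y \<in> V" using V' opensD(2) by blast
    have "f {} x = f' {} x"
      using e0[OF f y(1)] e0[OF f' y(1)] e(1)[OF yV] e0_res[OF V V' s y(1)] e0_res[OF V V' t y(1)] rs rt y by simp
    moreover have "f {0} x = f' {0} x"
      using e1[OF f y(1)] e1[OF f' y(1)] e(2)[OF yV] e1_res[OF V V' s y(1)] e1_res[OF V V' t y(1)] rs rt y by simp
    ultimately show "f K x = f' K x"
      using subsets_le_1[OF _ K] by auto
  qed
  then show "\<exists>W \<in> opens M V. m \<in> W \<and> res M V W s = res M V W t"
    using V' m' rs rt by auto
qed

section \<open>Sections with prescribed components and the grading in components\<close>

lemma e0_red_funs: "opn V \<Longrightarrow> s \<in> carrier (sec M V) \<Longrightarrow> e0 V s \<in> red_funs M V"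
  unfolding red_funs_def by (force simp: eps_def nbhds_iff)

lemma e1_red_funs: "opn V \<Longrightarrow> s \<in> carrier (sec M V) \<Longrightarrow> e1 V s \<in> red_funs M V"
  unfolding e1_def by (intro e0_red_funs Q_closed)

lemma red_funs_extensional: "a \<in> red_funs M V \<Longrightarrow> a \<in> extensional V"
  by (simp add: red_funs_def)

text \<open>Both functions lift locally to sections. In a common chart the bodies of the two lifts
  are smooth, and they serve as the two coefficients of a new superfunction.\<close>

lemma red_funs_local_lift:
  assumes V: "opn V" and a: "a \<in> red_funs M V" and b: "b \<in> red_funs M V" and m: "m \<in> V"
  shows "\<exists>W \<in> opens M V. m \<in> W \<and> (\<exists>t \<in> carrier (sec M W). \<forall>x \<in> W. e0 W t x = a x \<and> e1 W t x = b x)"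
proof -
  obtain W1 s1 where 1: "W1 \<in> nbhds M m" "W1 \<subseteq> V" "s1 \<in> carrier (sec M W1)" "restrict a W1 = e0 W1 s1"
    using a m unfolding red_funs_def by blast
  obtain W2 s2 where 2: "W2 \<in> nbhds M m" "W2 \<subseteq> V" "s2 \<in> carrier (sec M W2)" "restrict b W2 = e0 W2 s2"
    using b m unfolding red_funs_def by blast
  let ?W = "W1 \<inter> W2"
  have W12: "opn W1" "opn W2" "m \<in> W1" "m \<in> W2" using 1 2 by (auto simp: nbhds_iff)
  have W: "?W \<in> opens M W1" "?W \<in> opens M W2" "opn ?W" "?W \<in> opens M V"
    using opens_Int[OF W12(1,2)] 1(2) by (auto simp: opens_def)
  have mW: "m \<in> ?W" using W12 by simp
  obtain V' \<phi> h f f' where V': "V' \<in> opens M ?W" and m': "m \<in> V'" and triv: "trivialises \<phi> h V'"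
    and f: "f \<in> carrier (superdomain_alg (Suc 0) (\<phi> ` V'))" and f': "f' \<in> carrier (superdomain_alg (Suc 0) (\<phi> ` V'))"
    and rs: "res M ?W V' (res M W1 ?W s1) = h f" and rt: "res M ?W V' (res M W2 ?W s2) = h f'"
    by (rule localE[OF W(3) mW res_closed[OF W12(1) W(1) 1(3)] res_closed[OF W12(2) W(2) 2(3)]]) (rule that)
  have W': "open (\<phi> ` V')" and h: "h \<in> superalg_hom (superdomain_alg (Suc 0) (\<phi> ` V')) (sec M V')"
    and e0: "\<And>u x. u \<in> carrier (superdomain_alg (Suc 0) (\<phi> ` V')) \<Longrightarrow> x \<in> V' \<Longrightarrow> e0 V' (h u) x = u {} (\<phi> x)"
    and e1: "\<And>u x. u \<in> carrier (superdomain_alg (Suc 0) (\<phi> ` V')) \<Longrightarrow> x \<in> V' \<Longrightarrow> e1 V' (h u) x = u {0} (\<phi> x)"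
    using triv unfolding trivialises_def by blast+
  \<comment> \<open>The body of the second lift is moved into the coefficient of the odd
    generator.\<close>
  define F where "F = (\<lambda>K \<in> Pow {..<Suc 0}. \<lambda>x \<in> \<phi> ` V'. if K = {} then f {} x else f' {} x)"
  have F: "F \<in> carrier (superdomain_alg (Suc 0) (\<phi> ` V'))"
    unfolding F_def
  proof (rule superdomain_memI[OF W'])
    show "smooth_on (\<phi> ` V') (\<lambda>x. if K = {} then f {} x else f' {} x)" for K :: "nat set"
      using smooth_funsD(1)[OF superdomain_comp[OF f, of "{}"]] smooth_funsD(1)[OF superdomain_comp[OF f', of "{}"]]
      by (cases "K = {}") simp_all
  qed
  have "e0 V' (h F) x = a x \<and> e1 V' (h F) x = b x" if x: "x \<in> V'" for x
  proof -
    have xW: "x \<in> ?W" using x V' opensD(2) by blast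
    have "e0 V' (h F) x = f {} (\<phi> x)" "e1 V' (h F) x = f' {} (\<phi> x)"
      using x by (simp_all add: e0[OF F x] e1[OF F x]) (simp_all add: F_def)
    moreover have "f {} (\<phi> x) = e0 W1 s1 x" "f' {} (\<phi> x) = e0 W2 s2 x"
      using e0[OF f x] e0[OF f' x] e0_res[OF W(3) V' res_closed[OF W12(1) W(1) 1(3)] x]
        e0_res[OF W(3) V' res_closed[OF W12(2) W(2) 2(3)] x]
        e0_res[OF W12(1) W(1) 1(3) xW] e0_res[OF W12(2) W(2) 2(3) xW] rs rt by simp_all
    moreover have "e0 W1 s1 x = a x" "e0 W2 s2 x = b x"
      using 1(4) 2(4) xW by (metis Int_iff restrict_apply')+
    ultimately show ?thesis by simp
  qed
  moreover have "h F \<in> carrier (sec M V')"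
    by (rule superalg_hom_closed[OF h F])
  moreover have "V' \<in> opens M V"
    using opens_trans[OF W(4) V'] .
  ultimately show ?thesis using m' by blast
qed

text \<open>By \<open>sec_eqI\<close> the components determine a section. Local solutions therefore
  agree on overlaps whatever choices \<open>\<sigma>\<close> makes, and the sheaf axiom glues
  them.\<close>

lemma mk_ex:
  assumes V: "opn V" and a: "a \<in> red_funs M V" and b: "b \<in> red_funs M V"
  shows "\<exists>t \<in> carrier (sec M V). \<forall>x \<in> V. e0 V t x = a x \<and> e1 V t x = b x"
proof -
  define good where "good W t \<longleftrightarrow> t \<in> carrier (sec M W) \<and> (\<forall>x \<in> W. e0 W t x = a x \<and> e1 W t x = b x)" for W t
  define \<U> where "\<U> = {W \<in> opens M V. \<exists>t. good W t}"
  define \<sigma> where "\<sigma> W = (SOME t. good W t)" for W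
  have \<sigma>: "good W (\<sigma> W)" if "W \<in> \<U>" for W
    using that unfolding \<sigma>_def \<U>_def by (auto intro: someI)
  have un: "\<Union>\<U> = V"
    using red_funs_local_lift[OF assms] unfolding \<U>_def good_def by (fastforce simp: opens_def)
  have opn: "opn W" if "W \<in> \<U>" for W
    using that opens_imp_points unfolding \<U>_def by blast
  have "\<exists>!t. t \<in> carrier (sec M (\<Union>\<U>)) \<and> (\<forall>W \<in> \<U>. res M (\<Union>\<U>) W t = \<sigma> W)"
  proof (rule glue)
    show "\<U> \<subseteq> opens M (points M)" using opn by blast
    show "\<sigma> W \<in> carrier (sec M W)" if "W \<in> \<U>" for W using \<sigma>[OF that] by (simp add: good_def)
    fix W W' assume W: "W \<in> \<U>" "W' \<in> \<U>"
    have I: "W \<inter> W' \<in> opens M W" "W \<inter> W' \<in> opens M W'" "opn (W \<inter> W')"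
      using opens_Int[OF opn[OF W(1)] opn[OF W(2)]] by auto
    show "res M W (W \<inter> W') (\<sigma> W) = res M W' (W \<inter> W') (\<sigma> W')"
      using \<sigma>[OF W(1)] \<sigma>[OF W(2)] I opn[OF W(1)] opn[OF W(2)]
      by (intro sec_eqI) (auto simp: good_def e_simps closed)
  qed
  then obtain t where t: "t \<in> carrier (sec M V)" "\<And>W. W \<in> \<U> \<Longrightarrow> res M V W t = \<sigma> W"
    unfolding un by blast
  have "e0 V t x = a x \<and> e1 V t x = b x" if x: "x \<in> V" for x
  proof -
    obtain W where W: "W \<in> \<U>" "x \<in> W" using un x by blast
    have W': "W \<in> opens M V" using W by (simp add: \<U>_def)
    show ?thesis
      using \<sigma>[OF W(1)] t(2)[OF W(1)] e0_res[OF V W' t(1) W(2)] e1_res[OF V W' t(1) W(2)] W(2) by (simp add: good_def)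
  qed
  with t show ?thesis by blast
qed

definition mk :: "'a set \<Rightarrow> ('a \<Rightarrow> real) \<Rightarrow> ('a \<Rightarrow> real) \<Rightarrow> 's" where
  "mk V a b = (SOME t. t \<in> carrier (sec M V) \<and> (\<forall>x \<in> V. e0 V t x = a x \<and> e1 V t x = b x))"

lemma mk:
  assumes "opn V" "a \<in> red_funs M V" "b \<in> red_funs M V"
  shows mk_closed: "mk V a b \<in> carrier (sec M V)"
    and e0_mk: "e0 V (mk V a b) = a" and e1_mk: "e1 V (mk V a b) = b"
proof -
  have *: "mk V a b \<in> carrier (sec M V) \<and> (\<forall>x \<in> V. e0 V (mk V a b) x = a x \<and> e1 V (mk V a b) x = b x)"
    unfolding mk_def by (rule someI_ex) (use mk_ex[OF assms] in blast)
  then show "mk V a b \<in> carrier (sec M V)" by blast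
  show "e0 V (mk V a b) = a" "e1 V (mk V a b) = b"
    using * assms red_funs_extensional
    by (auto intro!: extensionalityI[where A = V] simp: eps_def e1_def)
qed

text \<open>An odd section satisfies s s = - s s, so the square of its body vanishes; for an even
  section Q s is odd, so its second component vanishes. Conversely, a section with the vanishing
  component equals its homogeneous part of the right parity, since the other part has both
  components zero.\<close>

lemma gr_iff:
  assumes V: "opn V"
  shows gr1_iff: "s \<in> gr (sec M V) 1 \<longleftrightarrow> s \<in> carrier (sec M V) \<and> (\<forall>m \<in> V. e0 V s m = 0)"
    and gr0_iff: "s \<in> gr (sec M V) 0 \<longleftrightarrow> s \<in> carrier (sec M V) \<and> (\<forall>m \<in> V. e1 V s m = 0)"
proof -
  have odd: "e0 V s m = 0" if s: "s \<in> gr (sec M V) 1" and m: "m \<in> V" for s m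
  proof -
    have "s \<otimes>\<^bsub>sec M V\<^esub> s = ksign 1 1 \<odot>\<^bsub>sec M V\<^esub> (s \<otimes>\<^bsub>sec M V\<^esub> s)"
      using sec_superalgebra[OF V] s unfolding superalgebra_def by blast
    then have "e0 V (s \<otimes>\<^bsub>sec M V\<^esub> s) m = e0 V (ksign 1 1 \<odot>\<^bsub>sec M V\<^esub> (s \<otimes>\<^bsub>sec M V\<^esub> s)) m"
      by simp
    then show ?thesis
      using V m gr_closed[OF V s] by (simp add: e_simps closed ksign_def)
  qed
  have even: "e1 V s m = 0" if s: "s \<in> gr (sec M V) 0" and m: "m \<in> V" for s m
  proof -
    have "Q V s \<in> gr (sec M V) (1 + 0)"
      by (rule vect_hom_gr[OF Q V s])
    then show ?thesis using odd m by (simp add: e1_def)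
  qed
  show "s \<in> gr (sec M V) 1 \<longleftrightarrow> s \<in> carrier (sec M V) \<and> (\<forall>m \<in> V. e0 V s m = 0)"
  proof (intro iffI conjI)
    assume s: "s \<in> carrier (sec M V) \<and> (\<forall>m \<in> V. e0 V s m = 0)"
    then obtain y z where yz: "y \<in> gr (sec M V) 0" "z \<in> gr (sec M V) 1" "s = y \<oplus>\<^bsub>sec M V\<^esub> z"
      using superalgebra_decomp[OF sec_superalgebra[OF V]] by blast
    have "s = z"
    proof (rule sec_eqI[OF V])
      show "e1 V s m = e1 V z m" if "m \<in> V" for m
        using even[OF yz(1) that] that V gr_closed[OF V yz(1)] gr_closed[OF V yz(2)] by (simp add: yz(3) e_simps)
    qed (use s odd yz V gr_closed in auto)
    then show "s \<in> gr (sec M V) 1" using yz by simp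
  qed (use odd gr_closed V in auto)
  show "s \<in> gr (sec M V) 0 \<longleftrightarrow> s \<in> carrier (sec M V) \<and> (\<forall>m \<in> V. e1 V s m = 0)"
  proof (intro iffI conjI)
    assume s: "s \<in> carrier (sec M V) \<and> (\<forall>m \<in> V. e1 V s m = 0)"
    then obtain y z where yz: "y \<in> gr (sec M V) 0" "z \<in> gr (sec M V) 1" "s = y \<oplus>\<^bsub>sec M V\<^esub> z"
      using superalgebra_decomp[OF sec_superalgebra[OF V]] by blast
    have "s = y"
    proof (rule sec_eqI[OF V])
      show "e0 V s m = e0 V y m" if "m \<in> V" for m
        using odd[OF yz(2) that] that V gr_closed[OF V yz(1)] gr_closed[OF V yz(2)] by (simp add: yz(3) e_simps)
    qed (use s even yz V gr_closed in auto)
    then show "s \<in> gr (sec M V) 0" using yz by simp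
  qed (use even gr_closed V in auto)
qed

end

section \<open>The reduced manifold\<close>

text \<open>The section algebra of \<open>reduced\<close>, with the set of functions as a parameter
  so that the axioms follow from closure properties of that set.\<close>

definition fun_alg :: "'a set \<Rightarrow> ('a \<Rightarrow> real) set \<Rightarrow> ('a \<Rightarrow> real) superalg" where
  "fun_alg V F =
     \<lparr>carrier = F,
      mult = (\<lambda>f h. \<lambda>x \<in> V. f x * h x),
      one = (\<lambda>x \<in> V. 1),
      zero = (\<lambda>x \<in> V. 0),
      add = (\<lambda>f h. \<lambda>x \<in> V. f x + h x),
      smult = (\<lambda>r f. \<lambda>x \<in> V. r * f x),
      gr = (\<lambda>p. if p = 0 then F else {\<lambda>x \<in> V. 0})\<rparr>"

lemma fun_alg_simps [simp]:
  "carrier (fun_alg V F) = F"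
  "f \<otimes>\<^bsub>fun_alg V F\<^esub> h = (\<lambda>x \<in> V. f x * h x)"
  "\<one>\<^bsub>fun_alg V F\<^esub> = (\<lambda>x \<in> V. 1)"
  "\<zero>\<^bsub>fun_alg V F\<^esub> = (\<lambda>x \<in> V. 0)"
  "f \<oplus>\<^bsub>fun_alg V F\<^esub> h = (\<lambda>x \<in> V. f x + h x)"
  "r \<odot>\<^bsub>fun_alg V F\<^esub> f = (\<lambda>x \<in> V. r * f x)"
  "gr (fun_alg V F) p = (if p = 0 then F else {\<lambda>x \<in> V. 0})"
  by (simp_all add: fun_alg_def)

lemma cring_real_ring: "cring real_ring"
proof (rule cringI)
  show "abelian_group real_ring"
    by (rule abelian_groupI) (auto simp: real_ring_def intro: exI[of _ "- x" for x :: real] add.left_inverse)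
  show "comm_monoid real_ring"
    by (rule comm_monoidI) (auto simp: real_ring_def)
qed (auto simp: real_ring_def algebra_simps)

text \<open>Everything holds pointwise, with extensionality turning pointwise equality into
  equality. The odd part is zero, so the sign -1 only ever meets the zero function.\<close>

lemma superalgebra_fun_alg:
  assumes ext: "\<And>f. f \<in> F \<Longrightarrow> f \<in> extensional V"
    and add: "\<And>f h. f \<in> F \<Longrightarrow> h \<in> F \<Longrightarrow> (\<lambda>x \<in> V. f x + h x) \<in> F"
    and mult: "\<And>f h. f \<in> F \<Longrightarrow> h \<in> F \<Longrightarrow> (\<lambda>x \<in> V. f x * h x) \<in> F"
    and const: "\<And>c. (\<lambda>x \<in> V. c) \<in> F"
  shows "superalgebra (fun_alg V F)"
proof -
  have smult: "(\<lambda>x \<in> V. r * f x) \<in> F" if "f \<in> F" for r f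
  proof -
    have "(\<lambda>x \<in> V. (\<lambda>x \<in> V. r) x * f x) \<in> F"
      by (rule mult[OF const that])
    then show ?thesis by (simp cong: restrict_cong)
  qed
  have eqI: "f = h" if "f \<in> extensional V" "h \<in> extensional V" "\<And>x. x \<in> V \<Longrightarrow> f x = h x" for f h :: "'a \<Rightarrow> real"
    using that by (rule extensionalityI)
  have ab: "abelian_group (fun_alg V F)"
  proof (rule abelian_groupI)
    fix f assume f: "f \<in> carrier (fun_alg V F)"
    show "\<zero>\<^bsub>fun_alg V F\<^esub> \<oplus>\<^bsub>fun_alg V F\<^esub> f = f"
      using ext f by (intro eqI) auto
    have "(\<lambda>x \<in> V. - 1 * f x) \<in> F" by (rule smult) (use f in simp)
    moreover have "(\<lambda>x \<in> V. - 1 * f x) \<oplus>\<^bsub>fun_alg V F\<^esub> f = \<zero>\<^bsub>fun_alg V F\<^esub>"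
      by (intro eqI) auto
    ultimately show "\<exists>h \<in> carrier (fun_alg V F). h \<oplus>\<^bsub>fun_alg V F\<^esub> f = \<zero>\<^bsub>fun_alg V F\<^esub>"
      by (auto simp del: fun_alg_simps(4,5))
  qed (auto simp: add const ext algebra_simps intro!: eqI)
  have ring: "ring (fun_alg V F)"
  proof (rule ringI[OF ab])
    show "monoid (fun_alg V F)"
      by (rule monoidI) (auto simp: mult const ext algebra_simps intro!: eqI)
  qed (auto simp: algebra_simps intro!: eqI)
  have mod: "module real_ring (fun_alg V F)"
    by (rule moduleI[OF cring_real_ring ab]) (auto simp: smult ext real_ring_def algebra_simps intro!: eqI)
  interpret A: ring "fun_alg V F" by (rule ring)
  interpret module real_ring "fun_alg V F" by (rule mod)
  have z: "submodule {\<lambda>x \<in> V. 0 :: real} real_ring (fun_alg V F)"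
  proof (rule submoduleI)
    show "\<ominus>\<^bsub>fun_alg V F\<^esub> f \<in> {\<lambda>x \<in> V. 0}" if "f \<in> {\<lambda>x \<in> V. 0}" for f
      using A.minus_zero that by simp
  qed (auto simp: const intro!: eqI)
  have sub: "submodule (gr (fun_alg V F) p) real_ring (fun_alg V F)" for p
    using carrier_is_submodule z by simp
  have "gr (fun_alg V F) 0 <+>\<^bsub>fun_alg V F\<^esub> gr (fun_alg V F) 1 = carrier (fun_alg V F)"
  proof (intro equalityI subsetI)
    fix f assume "f \<in> gr (fun_alg V F) 0 <+>\<^bsub>fun_alg V F\<^esub> gr (fun_alg V F) 1"
    then obtain h k where hk: "h \<in> F" "k = (\<lambda>x \<in> V. 0)" "f = (\<lambda>x \<in> V. h x + k x)"
      unfolding set_add_def' by (elim UN_E) auto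
    then show "f \<in> carrier (fun_alg V F)"
      using add[OF hk(1) const[of 0]] by simp
  next
    fix f assume f: "f \<in> carrier (fun_alg V F)"
    then have "f = f \<oplus>\<^bsub>fun_alg V F\<^esub> (\<lambda>x \<in> V. 0)"
      using ext by (intro eqI) auto
    then show "f \<in> gr (fun_alg V F) 0 <+>\<^bsub>fun_alg V F\<^esub> gr (fun_alg V F) 1"
      using f unfolding set_add_def' by (auto simp del: fun_alg_simps(5) simp: fun_alg_simps)
  qed
  moreover have "\<forall>p q. \<forall>f \<in> gr (fun_alg V F) p. \<forall>h \<in> gr (fun_alg V F) q.
        f \<otimes>\<^bsub>fun_alg V F\<^esub> h \<in> gr (fun_alg V F) (p + q) \<and>
        f \<otimes>\<^bsub>fun_alg V F\<^esub> h = ksign p q \<odot>\<^bsub>fun_alg V F\<^esub> (h \<otimes>\<^bsub>fun_alg V F\<^esub> f)"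
    using mult[OF const const] by (auto simp: ksign_def mult const intro!: eqI split: if_splits)
  moreover have "\<forall>r. \<forall>f \<in> carrier (fun_alg V F). \<forall>h \<in> carrier (fun_alg V F).
        (r \<odot>\<^bsub>fun_alg V F\<^esub> f) \<otimes>\<^bsub>fun_alg V F\<^esub> h = r \<odot>\<^bsub>fun_alg V F\<^esub> (f \<otimes>\<^bsub>fun_alg V F\<^esub> h) \<and>
        f \<otimes>\<^bsub>fun_alg V F\<^esub> (r \<odot>\<^bsub>fun_alg V F\<^esub> h) = r \<odot>\<^bsub>fun_alg V F\<^esub> (f \<otimes>\<^bsub>fun_alg V F\<^esub> h)"
    by (auto simp: algebra_simps intro!: eqI)
  moreover have "gr (fun_alg V F) 0 \<inter> gr (fun_alg V F) 1 = {\<zero>\<^bsub>fun_alg V F\<^esub>}" "\<one>\<^bsub>fun_alg V F\<^esub> \<in> gr (fun_alg V F) 0"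
    using const by auto
  ultimately show ?thesis
    unfolding superalgebra_def using ring mod allI[OF sub] by (intro conjI)
qed

lemma base_reduced [simp]: "base (reduced M) = base M"
  and sec_reduced: "sec (reduced M) U = fun_alg U (red_funs M U)"
  and res_reduced [simp]: "res (reduced M) U W f = restrict f W"
  by (simp_all add: reduced_def fun_alg_def)

lemma opens_reduced [simp]: "opens (reduced M) = opens M"
  and nbhds_reduced [simp]: "nbhds (reduced M) = nbhds M"
  by (auto simp: opens_def nbhds_def fun_eq_iff)

lemma carrier_reduced [simp]: "carrier (sec (reduced M) U) = red_funs M U"
  by (simp add: sec_reduced)

section \<open>The reduced sheaf and its charts\<close>

context shander_space
begin

lemma red_funsI:
  "opn V \<Longrightarrow> s \<in> carrier (sec M V) \<Longrightarrow> a \<in> extensional V \<Longrightarrow> (\<And>x. x \<in> V \<Longrightarrow> a x = e0 V s x) \<Longrightarrow> a \<in> red_funs M V"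
  using extensionalityI[of a V "e0 V s"] e0_red_funs red_funs_extensional by metis

lemma red_const: "opn V \<Longrightarrow> (\<lambda>x \<in> V. c) \<in> red_funs M V"
  by (rule red_funsI[where s = "c \<odot>\<^bsub>sec M V\<^esub> \<one>\<^bsub>sec M V\<^esub>"]) (simp_all add: closed e_simps)

text \<open>Closure is inherited from sections: \<open>mk V a a\<close> is a section with body
  \<open>a\<close>, where the second component is arbitrary and \<open>a\<close> merely fills the
  slot.\<close>

lemma red_add: "opn V \<Longrightarrow> a \<in> red_funs M V \<Longrightarrow> b \<in> red_funs M V \<Longrightarrow> (\<lambda>x \<in> V. a x + b x) \<in> red_funs M V"
  by (rule red_funsI[where s = "mk V a a \<oplus>\<^bsub>sec M V\<^esub> mk V b b"]) (simp_all add: closed e_simps mk)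

lemma red_mult: "opn V \<Longrightarrow> a \<in> red_funs M V \<Longrightarrow> b \<in> red_funs M V \<Longrightarrow> (\<lambda>x \<in> V. a x * b x) \<in> red_funs M V"
  by (rule red_funsI[where s = "mk V a a \<otimes>\<^bsub>sec M V\<^esub> mk V b b"]) (simp_all add: closed e_simps mk)

lemma red_smult: "opn V \<Longrightarrow> a \<in> red_funs M V \<Longrightarrow> (\<lambda>x \<in> V. r * a x) \<in> red_funs M V"
  by (rule red_funsI[where s = "r \<odot>\<^bsub>sec M V\<^esub> mk V a a"]) (simp_all add: closed e_simps mk)

lemma red_restrict: "opn V \<Longrightarrow> W \<in> opens M V \<Longrightarrow> a \<in> red_funs M V \<Longrightarrow> restrict a W \<in> red_funs M W"
  by (rule red_funsI[where s = "res M V W (mk V a a)"])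
    (simp_all add: closed e_simps mk opens_trans[of V M "points M"])

lemma red_local:
  assumes "a \<in> extensional V" "\<And>m. m \<in> V \<Longrightarrow> \<exists>W \<in> opens M V. m \<in> W \<and> restrict a W \<in> red_funs M W"
  shows "a \<in> red_funs M V"
  unfolding red_funs_def
proof (intro CollectI conjI ballI assms(1))
  fix m assume "m \<in> V"
  then obtain W where W: "W \<in> opens M V" "m \<in> W" "restrict a W \<in> red_funs M W"
    using assms(2) by blast
  then obtain W' s where W': "W' \<in> nbhds M m" "W' \<subseteq> W" "s \<in> carrier (sec M W')" "restrict (restrict a W) W' = e0 W' s"
    unfolding red_funs_def by blast
  then show "\<exists>W \<in> nbhds M m. W \<subseteq> V \<and> (\<exists>s \<in> carrier (sec M W). restrict a W = e0 W s)"
    using opensD(2)[OF W(1)] by (intro bexI[of _ W'] conjI bexI[of _ s]) (auto simp: Int_absorb1 inf.absorb2)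
qed

lemma reduced_superalgebra: "opn V \<Longrightarrow> superalgebra (sec (reduced M) V)"
  unfolding sec_reduced by (rule superalgebra_fun_alg) (auto simp: red_add red_mult red_const red_funs_extensional)

lemma reduced_superringed: "superringed_space (reduced M)"
  unfolding superringed_space_def base_reduced opens_reduced
proof (intro conjI ballI allI impI)
  show "superalgebra (sec (reduced M) U)" if "opn U" for U
    by (rule reduced_superalgebra[OF that])
next
  fix U W assume U: "opn U" and W: "W \<in> opens M U"
  have sub: "W \<subseteq> U" using W opensD by blast
  have "res (reduced M) U W \<in> ring_hom (sec (reduced M) U) (sec (reduced M) W)"
    using sub red_restrict[OF U W] by (intro ring_hom_memI) (auto simp: sec_reduced fun_eq_iff)
  then show "res (reduced M) U W \<in> superalg_hom (sec (reduced M) U) (sec (reduced M) W)"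
    using sub red_restrict[OF U W] by (auto simp: superalg_hom_def sec_reduced fun_eq_iff split: if_splits)
next
  fix U s assume "opn U" "s \<in> carrier (sec (reduced M) U)"
  then show "res (reduced M) U U s = s"
    using red_funs_extensional by (simp add: extensional_restrict)
next
  fix U V W s assume "opn U" "V \<in> opens M U" "W \<in> opens M V"
  then show "res (reduced M) V W (res (reduced M) U V s) = res (reduced M) U W s"
    using opensD(2)[of W M V] by (auto simp: fun_eq_iff)
next
  fix \<U> s assume A: "\<U> \<subseteq> opens M (points M) \<and> (\<forall>W \<in> \<U>. s W \<in> carrier (sec (reduced M) W)) \<and>
     (\<forall>W \<in> \<U>. \<forall>W' \<in> \<U>. res (reduced M) W (W \<inter> W') (s W) = res (reduced M) W' (W \<inter> W') (s W'))"
  then have s: "s W \<in> red_funs M W" if "W \<in> \<U>" for W using that by simp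
  have agree: "s W x = s W' x" if "W \<in> \<U>" "W' \<in> \<U>" "x \<in> W" "x \<in> W'" for W W' x
  proof -
    have "restrict (s W) (W \<inter> W') = restrict (s W') (W \<inter> W')" using A that(1,2) by simp
    then show ?thesis using that(3,4) by (metis IntI restrict_apply')
  qed
  \<comment> \<open>The value at \<open>x\<close> is taken from an arbitrary member of the cover
    containing \<open>x\<close>; agreement on overlaps makes the choice immaterial.\<close>
  define t where "t = (\<lambda>x \<in> \<Union>\<U>. s (SOME W. W \<in> \<U> \<and> x \<in> W) x)"
  have tx: "t x = s W x" if "W \<in> \<U>" "x \<in> W" for W x
  proof -
    let ?W = "SOME W. W \<in> \<U> \<and> x \<in> W"
    have W: "?W \<in> \<U> \<and> x \<in> ?W"
      by (rule someI) (use that in blast)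
    have "x \<in> \<Union>\<U>" using that by blast
    then have "t x = s ?W x" unfolding t_def by (rule restrict_apply')
    also have "\<dots> = s W x"
      using W that by (intro agree) auto
    finally show ?thesis .
  qed
  have tW: "restrict t W = s W" if "W \<in> \<U>" for W
  proof (rule extensionalityI)
    show "s W \<in> extensional W" by (rule red_funs_extensional[OF s[OF that]])
    show "restrict t W \<in> extensional W" by (rule restrict_extensional)
    show "restrict t W x = s W x" if "x \<in> W" for x
      unfolding restrict_apply'[OF that] by (rule tx[OF \<open>W \<in> \<U>\<close> that])
  qed
  have "t \<in> red_funs M (\<Union>\<U>)"
  proof (rule red_local)
    fix m assume "m \<in> \<Union>\<U>"
    then obtain W where W: "W \<in> \<U>" "m \<in> W" by blast
    moreover have "W \<in> opens M (\<Union>\<U>)" using W A by (auto simp: opens_def)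
    ultimately show "\<exists>W \<in> opens M (\<Union>\<U>). m \<in> W \<and> restrict t W \<in> red_funs M W"
      using tW s by auto
  qed (simp add: t_def)
  moreover have "u = t" if u: "u \<in> red_funs M (\<Union>\<U>)" "\<And>W. W \<in> \<U> \<Longrightarrow> restrict u W = s W" for u
  proof (rule extensionalityI)
    show "u \<in> extensional (\<Union>\<U>)" using u red_funs_extensional by blast
    show "t \<in> extensional (\<Union>\<U>)" by (simp add: t_def)
    fix x assume "x \<in> \<Union>\<U>"
    then obtain W where W: "W \<in> \<U>" "x \<in> W" by blast
    then show "u x = t x" using u(2)[OF W(1)] tx[OF W] by (metis restrict_apply')
  qed
  ultimately show "\<exists>!t. t \<in> carrier (sec (reduced M) (\<Union>\<U>)) \<and> (\<forall>W \<in> \<U>. res (reduced M) (\<Union>\<U>) W t = s W)"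
    unfolding carrier_reduced res_reduced using tW by (intro ex1I[of _ t]) blast+
qed

text \<open>In a chart, \<epsilon> is the body coefficient, so reduced functions are exactly the
  pullbacks of smooth functions of the even coordinates.\<close>

lemma shander_chart_red_funs:
  assumes "chart M (Suc 0) U \<phi> \<psi>" and V: "V \<in> opens M U"
  shows "smooth_on (\<phi> ` V) F \<Longrightarrow> (\<lambda>x \<in> V. F (\<phi> x)) \<in> red_funs M V"
    and "a \<in> red_funs M V \<Longrightarrow> \<exists>F \<in> smooth_funs (\<phi> ` V). a = (\<lambda>x \<in> V. F (\<phi> x))"
proof -
  interpret chart M "Suc 0" U \<phi> \<psi> by fact
  note W = chart_image_open[OF V]
  have V': "opn V" using V opens_imp_points by blast
  show "(\<lambda>x \<in> V. F (\<phi> x)) \<in> red_funs M V" if F: "smooth_on (\<phi> ` V) F"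
  proof -
    \<comment> \<open>\<open>F\<close> is placed in both coefficients; only the body is
      read.\<close>
    define f where "f = (\<lambda>K \<in> Pow {..<Suc 0}. \<lambda>x \<in> \<phi> ` V. F x)"
    have f: "f \<in> carrier (superdomain_alg (Suc 0) (\<phi> ` V))"
      unfolding f_def by (rule superdomain_memI[OF W F])
    show ?thesis
      by (rule red_funsI[OF V' superalg_hom_closed[OF chart_hom(1)[OF V] f]])
        (simp_all add: chart_eps[OF V f], simp add: f_def)
  qed
  show "\<exists>F \<in> smooth_funs (\<phi> ` V). a = (\<lambda>x \<in> V. F (\<phi> x))" if a: "a \<in> red_funs M V"
  proof -
    obtain f where f: "f \<in> carrier (superdomain_alg (Suc 0) (\<phi> ` V))" "mk V a a = \<psi> (\<phi> ` V) f"
      using chart_section[OF V mk_closed[OF V' a a]] .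
    have "a = (\<lambda>x \<in> V. f {} (\<phi> x))"
    proof (rule extensionalityI[OF red_funs_extensional[OF a] restrict_extensional])
      fix x assume x: "x \<in> V"
      have "a x = e0 V (mk V a a) x" by (simp add: e0_mk[OF V' a a])
      then show "a x = (\<lambda>x \<in> V. f {} (\<phi> x)) x"
        using x by (simp add: f(2) chart_eps[OF V f(1) x])
    qed
    then show ?thesis using superdomain_comp[OF f(1), of "{}"] by auto
  qed
qed

text \<open>With \<open>q = 0\<close> the coefficient at \<open>{}\<close> is the only one, and the
  description of reduced functions in charts makes reading it off a bijection.\<close>

lemma reduced_super_chart:
  assumes c: "chart M (Suc 0) U \<phi> \<psi>"
  shows "super_chart 0 (reduced M) U \<phi> (\<lambda>W f. \<lambda>x \<in> U \<inter> \<phi> -` W. f {} (\<phi> x))"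
proof -
  interpret chart M "Suc 0" U \<phi> \<psi> by fact
  let ?\<psi> = "\<lambda>W f. \<lambda>x \<in> U \<inter> \<phi> -` W. f {} (\<phi> x)"
  have main: "?\<psi> W \<in> superalg_hom (superdomain_alg 0 W) (sec (reduced M) (U \<inter> \<phi> -` W)) \<and>
      bij_betw (?\<psi> W) (carrier (superdomain_alg 0 W)) (carrier (sec (reduced M) (U \<inter> \<phi> -` W)))"
    if W: "open W" "W \<subseteq> \<phi> ` U" for W
  proof
    let ?V = "U \<inter> \<phi> -` W"
    let ?A = "superdomain_alg 0 W"
    have V: "?V \<in> opens M U"
      by (rule chart_preimage_open[OF opens_self[OF chart_dom] W(1)])
    have im: "\<phi> ` ?V = W" using W by auto
    have V': "opn ?V" using V opens_imp_points by blast
    have closed: "?\<psi> W f \<in> red_funs M ?V" if "f \<in> carrier ?A" for f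
      using shander_chart_red_funs(1)[OF c V, of "f {}"] smooth_funsD(1)[OF superdomain_comp[OF that, of "{}"]] im by simp
    have "?\<psi> W \<in> ring_hom ?A (sec (reduced M) ?V)"
      by (rule ring_hom_memI)
        (auto simp: closed sec_reduced fun_eq_iff superdomain_mult_body superdomain_add superdomain_one)
    moreover have "?\<psi> W ` gr ?A p \<subseteq> gr (sec (reduced M) ?V) p" for p
    proof
      fix a assume "a \<in> ?\<psi> W ` gr ?A p"
      then obtain f where f: "f \<in> gr ?A p" "a = ?\<psi> W f" by blast
      then have f': "f \<in> carrier ?A" and z: "p \<noteq> 0 \<Longrightarrow> f {} = (\<lambda>x \<in> W. 0)"
        by (auto simp: superdomain_alg_def)
      show "a \<in> gr (sec (reduced M) ?V) p"
      proof (cases "p = 0")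
        case True
        then show ?thesis using closed[OF f'] by (simp add: sec_reduced f(2))
      next
        case False
        have "a = (\<lambda>x \<in> ?V. 0)" using z[OF False] by (auto simp: f(2) fun_eq_iff)
        then show ?thesis using False by (simp add: sec_reduced)
      qed
    qed
    ultimately show "?\<psi> W \<in> superalg_hom ?A (sec (reduced M) ?V)"
      by (auto simp: superalg_hom_def sec_reduced fun_eq_iff superdomain_smult)
    show "bij_betw (?\<psi> W) (carrier ?A) (carrier (sec (reduced M) ?V))"
    proof (rule bij_betw_imageI)
      show "inj_on (?\<psi> W) (carrier ?A)"
      proof (rule inj_onI)
        fix f f' assume f: "f \<in> carrier ?A" "f' \<in> carrier ?A" and eq: "?\<psi> W f = ?\<psi> W f'"
        show "f = f'"
        proof (rule superdomain_eqI[OF f])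
          fix K x assume K: "K \<subseteq> {..<0::nat}" and x: "x \<in> W"
          then obtain y where y: "y \<in> ?V" "x = \<phi> y" using im by blast
          have "?\<psi> W f y = ?\<psi> W f' y" by (simp only: eq)
          then show "f K x = f' K x" using y K by simp
        qed
      qed
      show "?\<psi> W ` carrier ?A = carrier (sec (reduced M) ?V)"
      proof (intro equalityI subsetI)
        fix a assume "a \<in> carrier (sec (reduced M) ?V)"
        then obtain F where F: "F \<in> smooth_funs W" "a = (\<lambda>x \<in> ?V. F (\<phi> x))"
          using shander_chart_red_funs(2)[OF c V, of a] im by auto
        have "(\<lambda>K \<in> Pow {..<0::nat}. F) \<in> carrier ?A"
          using F by (simp add: superdomain_carrier_iff)
        moreover have "a = ?\<psi> W (\<lambda>K \<in> Pow {..<0::nat}. F)"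
          using F(2) by simp
        ultimately show "a \<in> ?\<psi> W ` carrier ?A" by blast
      qed (use closed in auto)
    qed
  qed
  moreover have "openin (base M) U" "open (\<phi> ` U)"
    using opensD(1)[OF chart_dom] chart_image_open[OF opens_self[OF chart_dom]] by auto
  moreover have "?\<psi> W' (superdomain_res 0 W' f) = res (reduced M) (U \<inter> \<phi> -` W) (U \<inter> \<phi> -` W') (?\<psi> W f)"
    if "W' \<subseteq> W" for W W' f
    using that by (auto simp: fun_eq_iff superdomain_res_def)
  ultimately show ?thesis
    using chart_homeo unfolding super_chart_def base_reduced by blast
qed

lemma reduced_supermanifold:
  assumes "Hausdorff_space (base M)" "second_countable (base M)"
  shows "supermanifold TYPE('n) 0 (reduced M)"
proof -
  have "\<exists>U (\<phi> :: 'a \<Rightarrow> real ^ 'n) \<psi>. m \<in> U \<and> super_chart 0 (reduced M) U \<phi> \<psi>" if "m \<in> points M" for m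
    using shander_chartE[OF that] reduced_super_chart by metis
  then show ?thesis
    using assms reduced_superringed by (simp add: supermanifold_def)
qed

text \<open>\<open>eps\<close> is defined abstractly through invertibility, so on the reduced space
  it has to be identified with the identity. The chart with no odd coordinate does this through
  \<open>chart_eps\<close>.\<close>

lemma eps_reduced:
  assumes V: "opn V" and a: "a \<in> red_funs M V"
  shows "eps (reduced M) V a = a"
proof (rule extensionalityI[OF _ red_funs_extensional[OF a]])
  show "eps (reduced M) V a \<in> extensional V" by (simp add: eps_def)
  fix m assume m: "m \<in> V"
  then have "m \<in> points M" using V opensD(2) by blast
  then obtain U and \<phi> :: "'a \<Rightarrow> real ^ 'n" and \<psi> where U: "m \<in> U" and c: "chart M (Suc 0) U \<phi> \<psi>"
    using shander_chartE by metis
  interpret C: chart M "Suc 0" U \<phi> \<psi> by fact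
  define \<psi>' where "\<psi>' = (\<lambda>W (f :: 'n superfun). \<lambda>x \<in> U \<inter> \<phi> -` W. f {} (\<phi> x) :: real)"
  interpret R: chart "reduced M" 0 U \<phi> \<psi>'
    unfolding \<psi>'_def by unfold_locales (use reduced_superringed reduced_super_chart[OF c] in auto)
  let ?V = "V \<inter> U"
  have V': "?V \<in> opens M V" "?V \<in> opens M U" "m \<in> ?V"
    using opens_Int[OF V C.chart_dom] m U by auto
  have "restrict a ?V \<in> carrier (sec (reduced M) ?V)"
    using red_restrict[OF V V'(1) a] by simp
  then obtain f where f: "f \<in> carrier (superdomain_alg 0 (\<phi> ` ?V))" "restrict a ?V = \<psi>' (\<phi> ` ?V) f"
    using R.chart_section[of ?V] V'(2) by auto
  have "eps (reduced M) V a m = eps (reduced M) ?V (restrict a ?V) m"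
    using R.eps_res[of V ?V a m] V V' a by simp
  also have "\<dots> = f {} (\<phi> m)"
    using R.chart_eps[of ?V f m] f V' by simp
  also have "\<dots> = restrict a ?V m"
    unfolding f(2) \<psi>'_def using V' U by simp
  finally show "eps (reduced M) V a m = a m" using V' by simp
qed

text \<open>A chart expressed through points and reduced functions only, without pullback maps of
  superfunctions. The last clause is smoothness of coordinate expressions, the one before it its
  converse.\<close>

definition red_chart :: "'a set \<Rightarrow> ('a \<Rightarrow> real ^ 'n) \<Rightarrow> bool" where
  "red_chart U \<phi> \<longleftrightarrow> opn U \<and> inj_on \<phi> U \<and> (\<forall>V \<in> opens M U. open (\<phi> ` V)) \<and>
     (\<forall>V \<in> opens M U. \<forall>A. open A \<longrightarrow> V \<inter> \<phi> -` A \<in> opens M V) \<and>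
     (\<forall>V \<in> opens M U. \<forall>F. smooth_on (\<phi> ` V) F \<longrightarrow> (\<lambda>x \<in> V. F (\<phi> x)) \<in> red_funs M V) \<and>
     (\<forall>V \<in> opens M U. \<forall>a \<in> red_funs M V. smooth_on (\<phi> ` V) (\<lambda>y. a (inv_into U \<phi> y)))"

lemma red_chart_exists:
  assumes "m \<in> points M"
  obtains U \<phi> where "m \<in> U" "red_chart U \<phi>"
proof -
  obtain U and \<phi> :: "'a \<Rightarrow> real ^ 'n" and \<psi> where U: "m \<in> U" and c: "chart M (Suc 0) U \<phi> \<psi>"
    using shander_chartE[OF assms] by metis
  interpret chart M "Suc 0" U \<phi> \<psi> by fact
  have "smooth_on (\<phi> ` V) (\<lambda>y. a (inv_into U \<phi> y))" if V: "V \<in> opens M U" and a: "a \<in> red_funs M V" for V a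
  proof -
    obtain F where F: "F \<in> smooth_funs (\<phi> ` V)" "a = (\<lambda>x \<in> V. F (\<phi> x))"
      using shander_chart_red_funs(2)[OF c V a] by blast
    show ?thesis
    proof (rule smooth_on_cong[OF chart_image_open[OF V] _ smooth_funsD(1)[OF F(1)]])
      fix y assume "y \<in> \<phi> ` V"
      then obtain x where "x \<in> V" "y = \<phi> x" by blast
      moreover have "inv_into U \<phi> (\<phi> x) = x"
        using calculation opensD(2)[OF V] chart_inj by (auto intro: inv_into_f_f)
      ultimately show "F y = a (inv_into U \<phi> y)" by (simp add: F(2))
    qed
  qed
  then have "red_chart U \<phi>"
    unfolding red_chart_def
    using chart_dom chart_inj chart_image_open chart_preimage_open shander_chart_red_funs(1)[OF c] by blast
  then show ?thesis using that U by blast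
qed

end

section \<open>Tensors on the reduced manifold\<close>

lemma bit_neq_0: "(q :: bit) \<noteq> 0 \<longleftrightarrow> q = 1"
  by (cases q) auto

lemma opens_Int_left: "W \<in> nbhds N m \<Longrightarrow> U \<in> nbhds N m \<Longrightarrow> W \<inter> U \<in> opens N W \<and> W \<inter> U \<in> opens N U \<and> W \<inter> U \<in> nbhds N m"
  by (auto simp: nbhds_def opens_def)

lemma tvec_eqI:
  assumes "v \<in> (\<Pi>\<^sub>E W\<in>nbhds N m. carrier (sec N W) \<rightarrow>\<^sub>E UNIV)" "w \<in> (\<Pi>\<^sub>E W\<in>nbhds N m. carrier (sec N W) \<rightarrow>\<^sub>E UNIV)"
    "\<And>W s. W \<in> nbhds N m \<Longrightarrow> s \<in> carrier (sec N W) \<Longrightarrow> v W s = w W s"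
  shows "v = w"
proof (rule PiE_ext[OF assms(1,2)])
  fix W assume W: "W \<in> nbhds N m"
  then show "v W = w W"
    using assms by (intro extensionalityI[of _ "carrier (sec N W)"]) (auto simp: PiE_iff)
qed

lemma super_metricD:
  assumes g: "super_metric N g" and U: "U \<in> opens N (points N)"
  shows super_metric_gr: "X \<in> vect_hom N U p \<Longrightarrow> Y \<in> vect_hom N U q \<Longrightarrow> g U X Y \<in> gr (sec N U) (p + q)"
    and super_metric_sym: "X \<in> vect_hom N U p \<Longrightarrow> Y \<in> vect_hom N U q \<Longrightarrow> g U X Y = ksign p q \<odot>\<^bsub>sec N U\<^esub> g U Y X"
    and super_metric_lin: "f \<in> carrier (sec N U) \<Longrightarrow> X \<in> vect N U \<Longrightarrow> Y \<in> vect N U \<Longrightarrow> Z \<in> vect N U \<Longrightarrow>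
      g U (vf_add N U (vf_scale N U f X) Y) Z = (f \<otimes>\<^bsub>sec N U\<^esub> g U X Z) \<oplus>\<^bsub>sec N U\<^esub> g U Y Z"
    and super_metric_add: "X \<in> vect N U \<Longrightarrow> Y \<in> vect N U \<Longrightarrow> Z \<in> vect N U \<Longrightarrow>
      g U X (vf_add N U Y Z) = g U X Y \<oplus>\<^bsub>sec N U\<^esub> g U X Z"
    and super_metric_res: "W \<in> opens N U \<Longrightarrow> X \<in> vect N U \<Longrightarrow> Y \<in> vect N U \<Longrightarrow>
      g W (vf_restrict N W X) (vf_restrict N W Y) = res N U W (g U X Y)"
proof -
  note m = g[unfolded super_metric_def, THEN bspec, OF U]
  note 1 = m[THEN conjunct1, THEN spec, THEN spec, THEN bspec, THEN bspec, of X p Y q]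
  show "g U X Y \<in> gr (sec N U) (p + q)" "g U X Y = ksign p q \<odot>\<^bsub>sec N U\<^esub> g U Y X"
    if "X \<in> vect_hom N U p" "Y \<in> vect_hom N U q"
    by (rule conjunct1[OF 1[OF that]], rule conjunct2[OF 1[OF that]])
  note m = m[THEN conjunct2]
  note 2 = m[THEN conjunct1, THEN bspec, THEN bspec, THEN bspec, THEN bspec, of f X Y Z]
  show "g U (vf_add N U (vf_scale N U f X) Y) Z = (f \<otimes>\<^bsub>sec N U\<^esub> g U X Z) \<oplus>\<^bsub>sec N U\<^esub> g U Y Z"
    if "f \<in> carrier (sec N U)" "X \<in> vect N U" "Y \<in> vect N U" "Z \<in> vect N U"
    by (rule 2[OF that])
  note m = m[THEN conjunct2]
  note 3 = m[THEN conjunct1, THEN bspec, THEN bspec, THEN bspec, of X Y Z]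
  show "g U X (vf_add N U Y Z) = g U X Y \<oplus>\<^bsub>sec N U\<^esub> g U X Z" if "X \<in> vect N U" "Y \<in> vect N U" "Z \<in> vect N U"
    by (rule 3[OF that])
  note m = m[THEN conjunct2]
  note 4 = m[THEN bspec, THEN bspec, THEN bspec, of W X Y]
  show "g W (vf_restrict N W X) (vf_restrict N W Y) = res N U W (g U X Y)"
    if "W \<in> opens N U" "X \<in> vect N U" "Y \<in> vect N U"
    by (rule 4[OF that])
qed

section \<open>Vector fields and tangent vectors of the reduced manifold\<close>

context shander_space
begin

abbreviation R :: "('a, 'a \<Rightarrow> real) superspace" where
  "R \<equiv> reduced M"

sublocale red: superringed "reduced M"
  by unfold_locales (rule reduced_superringed)

lemma R_simps [simp]:
  "a \<oplus>\<^bsub>sec R V\<^esub> b = (\<lambda>x \<in> V. a x + b x)" "a \<otimes>\<^bsub>sec R V\<^esub> b = (\<lambda>x \<in> V. a x * b x)"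
  "r \<odot>\<^bsub>sec R V\<^esub> a = (\<lambda>x \<in> V. r * a x)" "\<zero>\<^bsub>sec R V\<^esub> = (\<lambda>x \<in> V. 0)" "\<one>\<^bsub>sec R V\<^esub> = (\<lambda>x \<in> V. 1)"
  "gr (sec R V) p = (if p = 0 then red_funs M V else {\<lambda>x \<in> V. 0})"
  by (simp_all add: sec_reduced)

lemma red_eqI:
  "a \<in> red_funs M V \<Longrightarrow> b \<in> red_funs M V \<Longrightarrow> (\<And>x. x \<in> V \<Longrightarrow> a x = b x) \<Longrightarrow> a = b"
  using red_funs_extensional extensionalityI by metis

lemma red_vf_closed: "X \<in> vect_hom R U p \<Longrightarrow> W \<in> opens M U \<Longrightarrow> a \<in> red_funs M W \<Longrightarrow> X W a \<in> red_funs M W"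
  using red.vect_hom_closed[of X U p W a] by simp

lemma red_vfD:
  assumes X: "X \<in> vect_hom R U 0" and W: "W \<in> opens M U" and a: "a \<in> red_funs M W" and b: "b \<in> red_funs M W" and x: "x \<in> W"
  shows red_vf_add: "X W (\<lambda>x \<in> W. a x + b x) x = X W a x + X W b x"
    and red_vf_smult: "X W (\<lambda>x \<in> W. r * a x) x = r * X W a x"
    and red_vf_mult: "X W (\<lambda>x \<in> W. a x * b x) x = X W a x * b x + a x * X W b x"
    and red_vf_res: "W' \<in> opens M W \<Longrightarrow> x \<in> W' \<Longrightarrow> X W' (restrict a W') x = X W a x"
  using red.vect_hom_add[OF X, of W a b] red.vect_hom_smult[OF X, of W a r] red.vect_hom_leibniz[OF X, of W a 0 b]
    red.vect_hom_res[OF X, of W W' a] assms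
  by (simp_all add: ksign_def)

text \<open>On a space without odd functions the graded conditions reduce to those of an ordinary
  derivation; what is left of the parity conditions is that zero goes to zero.\<close>

lemma red_vfI:
  assumes U: "opn U" and closed: "X \<in> red.vf_family U"
    and add: "\<And>W a b x. W \<in> opens M U \<Longrightarrow> a \<in> red_funs M W \<Longrightarrow> b \<in> red_funs M W \<Longrightarrow> x \<in> W \<Longrightarrow>
      X W (\<lambda>x \<in> W. a x + b x) x = X W a x + X W b x"
    and smult: "\<And>W a r x. W \<in> opens M U \<Longrightarrow> a \<in> red_funs M W \<Longrightarrow> x \<in> W \<Longrightarrow> X W (\<lambda>x \<in> W. r * a x) x = r * X W a x"
    and mult: "\<And>W a b x. W \<in> opens M U \<Longrightarrow> a \<in> red_funs M W \<Longrightarrow> b \<in> red_funs M W \<Longrightarrow> x \<in> W \<Longrightarrow>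
      X W (\<lambda>x \<in> W. a x * b x) x = X W a x * b x + a x * X W b x"
    and res: "\<And>W W' a x. W \<in> opens M U \<Longrightarrow> a \<in> red_funs M W \<Longrightarrow> W' \<in> opens M W \<Longrightarrow> x \<in> W' \<Longrightarrow>
      X W' (restrict a W') x = X W a x"
  shows "X \<in> vect_hom R U 0"
proof (rule red.vect_homI[OF closed])
  have Xc: "X W a \<in> red_funs M W" if "W \<in> opens M U" "a \<in> red_funs M W" for W a
    using closed that by (auto simp: red.vf_family_def PiE_iff)
  have W': "opn W" if "W \<in> opens M U" for W using that U opens_trans by blast
  \<comment> \<open>The zero function is 0 times itself, so homogeneity gives the value.\<close>
  have zero: "X W (\<lambda>x \<in> W. 0) = (\<lambda>x \<in> W. 0)" if W: "W \<in> opens M U" for W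
  proof (rule red_eqI[OF Xc[OF W red_const[OF W'[OF W]]] red_const[OF W'[OF W]]])
    fix x assume x: "x \<in> W"
    have "(\<lambda>x \<in> W. 0 * (\<lambda>x \<in> W. 0) x) = (\<lambda>x \<in> W. 0 :: real)" by auto
    then show "X W (\<lambda>x \<in> W. 0) x = (\<lambda>x \<in> W. 0) x"
      using smult[OF W red_const[OF W'[OF W], of 0] x, of 0] x by simp
  qed
  {
    fix W a b assume W: "W \<in> opens R U" and a: "a \<in> carrier (sec R W)" and b: "b \<in> carrier (sec R W)"
    show "X W (a \<oplus>\<^bsub>sec R W\<^esub> b) = X W a \<oplus>\<^bsub>sec R W\<^esub> X W b"
      using W a b W' Xc by (intro red_eqI[of _ W]) (simp_all add: red_add add)
  next
    fix W r a assume W: "W \<in> opens R U" and a: "a \<in> carrier (sec R W)"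
    show "X W (r \<odot>\<^bsub>sec R W\<^esub> a) = r \<odot>\<^bsub>sec R W\<^esub> X W a"
      using W a W' Xc by (intro red_eqI[of _ W]) (simp_all add: red_smult smult)
  next
    fix W q a assume W: "W \<in> opens R U" and a: "a \<in> gr (sec R W) q"
    show "X W a \<in> gr (sec R W) (0 + q)"
      using W a Xc zero by (cases "q = 0") auto
  next
    fix W q a b assume W: "W \<in> opens R U" and a: "a \<in> gr (sec R W) q" and b: "b \<in> carrier (sec R W)"
    have a': "a \<in> red_funs M W" using a W red_const[OF W'] by (auto split: if_splits)
    have k: "ksign 0 q = 1" by (simp add: ksign_def)
    show "X W (a \<otimes>\<^bsub>sec R W\<^esub> b) = (X W a \<otimes>\<^bsub>sec R W\<^esub> b) \<oplus>\<^bsub>sec R W\<^esub> (ksign 0 q \<odot>\<^bsub>sec R W\<^esub> (a \<otimes>\<^bsub>sec R W\<^esub> X W b))"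
    proof (unfold k R_simps, rule red_eqI)
      have W0: "W \<in> opens M U" "b \<in> red_funs M W" using W b by simp_all
      show "X W (\<lambda>x \<in> W. a x * b x) \<in> red_funs M W"
        by (intro Xc W0 red_mult W' a')
      show "(\<lambda>x \<in> W. (\<lambda>x \<in> W. X W a x * b x) x + (\<lambda>x \<in> W. 1 * (\<lambda>x \<in> W. a x * X W b x) x) x) \<in> red_funs M W"
        by (intro red_add red_smult red_mult W' W0 Xc a')
      fix x assume "x \<in> W"
      then show "X W (\<lambda>x \<in> W. a x * b x) x = (\<lambda>x \<in> W. (\<lambda>x \<in> W. X W a x * b x) x + (\<lambda>x \<in> W. 1 * (\<lambda>x \<in> W. a x * X W b x) x) x) x"
        using mult[OF W0(1) a' W0(2)] by simp
    qed
  next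
    fix W V a assume W: "W \<in> opens R U" and V: "V \<in> opens R W" and a: "a \<in> carrier (sec R W)"
    then have V': "V \<in> opens M U" using opens_trans[of W M U V] by simp
    show "X V (res R W V a) = res R W V (X W a)"
      using W V a V' W' Xc red_restrict[of W V] by (intro red_eqI[of _ V]) (simp_all add: res)
  }
qed

lemma red_vf_zero: "opn U \<Longrightarrow> vf_zero R U \<in> vect_hom R U p"
  using red.vf_zero_vect_hom[of U p] by simp

text \<open>Every reduced function is even, and an odd field sends it to an odd function, that is,
  to zero.\<close>

lemma red_odd_vf:
  assumes U: "opn U" and X: "X \<in> vect_hom R U 1"
  shows "X = vf_zero R U"
proof (rule red.vf_eqI[OF red.vect_hom_family[OF X] red.vect_hom_family[OF red_vf_zero[OF U, of 1]]])
  fix W a assume W: "W \<in> opens R U" and a: "a \<in> carrier (sec R W)"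
  have "X W a \<in> gr (sec R W) (1 + 0)"
    by (rule red.vect_hom_gr[OF X W]) (use a in simp)
  then show "X W a = vf_zero R U W a"
    using W a by (simp add: vf_zero_def)
qed

lemma red_vf_add_zero:
  assumes U: "opn U" and X: "X \<in> vect_hom R U p"
  shows "vf_add R U X (vf_zero R U) = X"
proof -
  have eq: "X W a = X W a \<oplus>\<^bsub>sec R W\<^esub> vf_zero R U W a" if "W \<in> opens M U" "a \<in> red_funs M W" for W a
  proof -
    have "X W a \<in> red_funs M W" by (rule red_vf_closed[OF X that])
    then show ?thesis
      using that red_funs_extensional by (intro extensionalityI[of _ W]) (auto simp: vf_zero_def)
  qed
  have "vf_add R U X (vf_zero R U) \<in> red.vf_family U"
    unfolding vf_add_def by (rule red.vf_familyI) (simp only: carrier_reduced opens_reduced red_vf_closed[OF X] eq[symmetric])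
  then show ?thesis
    by (rule red.vf_eqI[OF _ red.vect_hom_family[OF X]])
      (simp only: vf_add_def opens_reduced carrier_reduced restrict_apply' eq[symmetric])
qed

lemma red_vect:
  assumes U: "opn U"
  shows "vect R U = vect_hom R U 0"
proof (intro equalityI subsetI)
  fix X assume "X \<in> vect R U"
  then obtain A B where AB: "A \<in> vect_hom R U 0" "B \<in> vect_hom R U 1" "X = vf_add R U A B"
    unfolding vect_def by blast
  have "X = A"
    unfolding AB(3) red_odd_vf[OF U AB(2)] by (rule red_vf_add_zero[OF U AB(1)])
  then show "X \<in> vect_hom R U 0" using AB(1) by simp
next
  fix X assume X: "X \<in> vect_hom R U 0"
  have "X = vf_add R U X (vf_zero R U)" using red_vf_add_zero[OF U X] by simp
  then show "X \<in> vect R U" unfolding vect_def using X red_vf_zero[OF U, of 1] by blast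
qed

text \<open>Closure under the combination \<open>f X + Y\<close>, the only one in which linearity of
  a metric is stated.\<close>

lemma red_lincomb:
  assumes U: "opn U" and f: "f \<in> red_funs M U" and X: "X \<in> vect_hom R U 0" and Y: "Y \<in> vect_hom R U 0"
  shows "vf_add R U (vf_scale R U f X) Y \<in> vect_hom R U 0"
    and "W \<in> opens M U \<Longrightarrow> a \<in> red_funs M W \<Longrightarrow> x \<in> W \<Longrightarrow>
      vf_add R U (vf_scale R U f X) Y W a x = f x * X W a x + Y W a x"
proof -
  have W': "opn W" if "W \<in> opens M U" for W using that U opens_trans by blast
  show ap: "vf_add R U (vf_scale R U f X) Y W a x = f x * X W a x + Y W a x"
    if "W \<in> opens M U" "a \<in> red_funs M W" "x \<in> W" for W a x
    using that by (simp add: vf_add_def vf_scale_def)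
  have fam: "vf_add R U (vf_scale R U f X) Y \<in> red.vf_family U"
    unfolding vf_add_def
  proof (rule red.vf_familyI)
    fix W a assume "W \<in> opens R U" "a \<in> carrier (sec R W)"
    then have W: "W \<in> opens M U" and a: "a \<in> red_funs M W" by simp_all
    then have "vf_scale R U f X W a = (\<lambda>x \<in> W. restrict f W x * X W a x)" by (simp add: vf_scale_def)
    then show "vf_scale R U f X W a \<oplus>\<^bsub>sec R W\<^esub> Y W a \<in> carrier (sec R W)"
      unfolding R_simps carrier_reduced
      by (simp only:) (intro red_add red_mult W' W red_vf_closed[OF X] red_vf_closed[OF Y] a red_restrict[OF U _ f])
  qed
  show "vf_add R U (vf_scale R U f X) Y \<in> vect_hom R U 0" (is "?L \<in> _")
  proof (rule red_vfI[OF U fam])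
    fix W a assume W: "W \<in> opens M U" and a: "a \<in> red_funs M W"
    note Wo = W'[OF W]
    have fx: "x \<in> W \<Longrightarrow> x \<in> U" for x using opensD(2)[OF W] by blast
    {
      fix b x assume b: "b \<in> red_funs M W" and x: "x \<in> W"
      show "?L W (\<lambda>x \<in> W. a x + b x) x = ?L W a x + ?L W b x"
        by (simp add: ap[OF W _ x] red_add[OF Wo] a b red_vf_add[OF X W a b x] red_vf_add[OF Y W a b x] algebra_simps)
      show "?L W (\<lambda>x \<in> W. a x * b x) x = ?L W a x * b x + a x * ?L W b x"
        by (simp add: ap[OF W _ x] red_mult[OF Wo] a b red_vf_mult[OF X W a b x] red_vf_mult[OF Y W a b x] algebra_simps)
    next
      fix r x assume x: "x \<in> W"
      show "?L W (\<lambda>x \<in> W. r * a x) x = r * ?L W a x"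
        by (simp add: ap[OF W _ x] red_smult[OF Wo] a red_vf_smult[OF X W a a x] red_vf_smult[OF Y W a a x] algebra_simps)
    next
      fix V x assume V: "V \<in> opens M W" and x: "x \<in> V"
      have V': "V \<in> opens M U" "x \<in> W" using opens_trans[OF W V] x opensD(2)[OF V] by auto
      show "?L V (restrict a V) x = ?L W a x"
        by (simp add: ap[OF V'(1) red_restrict[OF Wo V a] x] ap[OF W a V'(2)]
            red_vf_res[OF X W a a V'(2) V x] red_vf_res[OF Y W a a V'(2) V x])
    }
  qed
qed

lemma red_tangentD:
  assumes v: "v \<in> tangent_hom R m 0" and W: "W \<in> nbhds M m" and a: "a \<in> red_funs M W" and b: "b \<in> red_funs M W"
  shows red_tangent_add: "v W (\<lambda>x \<in> W. a x + b x) = v W a + v W b"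
    and red_tangent_smult: "v W (\<lambda>x \<in> W. r * a x) = r * v W a"
    and red_tangent_mult: "v W (\<lambda>x \<in> W. a x * b x) = v W a * b m + a m * v W b"
    and red_tangent_res: "W' \<in> nbhds M m \<Longrightarrow> W' \<subseteq> W \<Longrightarrow> v W' (restrict a W') = v W a"
proof -
  have W': "opn W" using W by (simp add: nbhds_iff)
  have "\<forall>W \<in> nbhds M m. (\<forall>s \<in> red_funs M W. \<forall>t \<in> red_funs M W. v W (\<lambda>x \<in> W. s x + t x) = v W s + v W t) \<and>
     (\<forall>r. \<forall>s \<in> red_funs M W. v W (\<lambda>x \<in> W. r * s x) = r * v W s) \<and>
     (\<forall>q. \<forall>s \<in> gr (sec R W) q. \<forall>t \<in> red_funs M W.
       v W (\<lambda>x \<in> W. s x * t x) = v W s * eps R W t m + ksign 0 q * eps R W s m * v W t)"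
    using v unfolding tangent_hom_def by simp
  from this[THEN bspec, OF W] a b show "v W (\<lambda>x \<in> W. a x + b x) = v W a + v W b" "v W (\<lambda>x \<in> W. r * a x) = r * v W a"
    "v W (\<lambda>x \<in> W. a x * b x) = v W a * b m + a m * v W b"
    by (auto simp: eps_reduced[OF W'] ksign_def dest: spec[of _ 0])
  show "v W' (restrict a W') = v W a" if "W' \<in> nbhds M m" "W' \<subseteq> W"
    using v W a that unfolding tangent_hom_def by simp
qed

text \<open>The Leibniz rule for 1 = 1 * 1 gives v 1 = 2 v 1; homogeneity does the rest.\<close>

lemma red_tangent_const:
  assumes v: "v \<in> tangent_hom R m 0" and W: "W \<in> nbhds M m"
  shows "v W (\<lambda>x \<in> W. c) = 0"
proof -
  have W': "opn W" "m \<in> W" using W by (simp_all add: nbhds_iff)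
  have "v W (\<lambda>x \<in> W. (\<lambda>x \<in> W. 1) x * (\<lambda>x \<in> W. 1) x) = v W (\<lambda>x \<in> W. 1) * 1 + 1 * v W (\<lambda>x \<in> W. 1)"
    using red_tangent_mult[OF v W red_const[OF W'(1), of 1] red_const[OF W'(1), of 1]] W' by simp
  moreover have "(\<lambda>x \<in> W. (\<lambda>x \<in> W. 1 :: real) x * (\<lambda>x \<in> W. 1) x) = (\<lambda>x \<in> W. 1)" by auto
  ultimately have "v W (\<lambda>x \<in> W. 1) = 0" by simp
  moreover have "(\<lambda>x \<in> W. c * (\<lambda>x \<in> W. 1) x) = (\<lambda>x \<in> W. c)" by auto
  ultimately show ?thesis
    using red_tangent_smult[OF v W red_const[OF W'(1), of 1] red_const[OF W'(1), of 1], of c] by simp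
qed

lemma red_tangent_sum:
  assumes v: "v \<in> tangent_hom R m 0" and W: "W \<in> nbhds M m" and I: "finite I" and b: "\<And>i. i \<in> I \<Longrightarrow> b i \<in> red_funs M W"
  shows "(\<lambda>x \<in> W. \<Sum>i\<in>I. b i x) \<in> red_funs M W \<and> v W (\<lambda>x \<in> W. \<Sum>i\<in>I. b i x) = (\<Sum>i\<in>I. v W (b i))"
  using I b
proof (induction I rule: finite_induct)
  case empty
  show ?case
    unfolding sum.empty by (intro conjI red_const red_tangent_const[OF v W]) (use W in \<open>simp add: nbhds_iff\<close>)
next
  case (insert i I)
  let ?s = "\<lambda>x \<in> W. \<Sum>i\<in>I. b i x"
  have "?s \<in> red_funs M W \<and> v W ?s = (\<Sum>i\<in>I. v W (b i))"
    by (rule insert.IH) (rule insert.prems, simp)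
  then have s: "?s \<in> red_funs M W" "v W ?s = (\<Sum>i\<in>I. v W (b i))" by (rule conjunct1, elim conjE)
  have bi: "b i \<in> red_funs M W" by (rule insert.prems) simp
  have eq: "(\<lambda>x \<in> W. \<Sum>i\<in>insert i I. b i x) = (\<lambda>x \<in> W. b i x + ?s x)"
    using insert by auto
  have "opn W" using W by (simp add: nbhds_iff)
  then show ?case
    unfolding eq
    by (intro conjI red_add[OF \<open>opn W\<close> bi s(1)]) (simp only: red_tangent_add[OF v W bi s(1)] s(2) sum.insert[OF insert.hyps])
qed

text \<open>The coordinate expression of a function. The inverse is taken on all of
  \<open>U\<close>, so restricting \<open>a\<close> to a smaller open set leaves the expression
  unchanged near the remaining points.\<close>

definition crd :: "'a set \<Rightarrow> ('a \<Rightarrow> real ^ 'n) \<Rightarrow> ('a \<Rightarrow> real) \<Rightarrow> real ^ 'n \<Rightarrow> real" where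
  "crd U \<phi> a y = a (inv_into U \<phi> y)"

context
  fixes U :: "'a set" and \<phi> :: "'a \<Rightarrow> real ^ 'n"
  assumes chart: "red_chart U \<phi>"
begin

lemma red_chartD:
  shows rc_opn: "opn U" and rc_inj: "inj_on \<phi> U" and rc_open: "V \<in> opens M U \<Longrightarrow> open (\<phi> ` V)"
    and rc_vimage: "V \<in> opens M U \<Longrightarrow> open A \<Longrightarrow> V \<inter> \<phi> -` A \<in> opens M V"
    and rc_pullback: "V \<in> opens M U \<Longrightarrow> smooth_on (\<phi> ` V) F \<Longrightarrow> (\<lambda>x \<in> V. F (\<phi> x)) \<in> red_funs M V"
    and rc_smooth: "V \<in> opens M U \<Longrightarrow> a \<in> red_funs M V \<Longrightarrow> smooth_on (\<phi> ` V) (crd U \<phi> a)"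
proof -
  note c = chart[unfolded red_chart_def]
  show "opn U" "inj_on \<phi> U"
    using c by blast+
  note c = c[THEN conjunct2, THEN conjunct2]
  show "open (\<phi> ` V)" if "V \<in> opens M U"
    using c[THEN conjunct1] that by blast
  note c = c[THEN conjunct2]
  show "V \<inter> \<phi> -` A \<in> opens M V" if "V \<in> opens M U" "open A"
    using c[THEN conjunct1, THEN bspec, OF that(1)] that(2) by simp
  note c = c[THEN conjunct2]
  show "(\<lambda>x \<in> V. F (\<phi> x)) \<in> red_funs M V" if "V \<in> opens M U" "smooth_on (\<phi> ` V) F"
    using c[THEN conjunct1, THEN bspec, OF that(1)] that(2) by simp
  note c = c[THEN conjunct2]
  show "smooth_on (\<phi> ` V) (crd U \<phi> a)" if "V \<in> opens M U" "a \<in> red_funs M V"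
    using c[THEN bspec, OF that(1), THEN bspec, OF that(2)] by (simp add: crd_def[abs_def])
qed

lemma crd_eq: "x \<in> U \<Longrightarrow> crd U \<phi> a (\<phi> x) = a x"
  by (simp add: crd_def inv_into_f_f[OF rc_inj])

lemma crd_opn: "V \<in> opens M U \<Longrightarrow> opn V"
  using opens_imp_points .

text \<open>A partial derivative depends only on the function near the point, so values of
  \<open>crd\<close> off the image of \<open>V\<close>, which are junk, do no harm.\<close>

lemma crd_partial_cong:
  assumes V: "V \<in> opens M U" and x: "x \<in> V" and eq: "\<And>z. z \<in> V \<Longrightarrow> a z = F (\<phi> z)"
  shows "partial i (crd U \<phi> a) (\<phi> x) = partial i F (\<phi> x)"
proof (rule partial_cong_open[OF rc_open[OF V]])
  fix y assume "y \<in> \<phi> ` V"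
  then obtain z where z: "z \<in> V" "y = \<phi> z" by blast
  moreover have "z \<in> U" using z opensD(2)[OF V] by blast
  ultimately show "crd U \<phi> a y = F y" using eq by (simp add: crd_eq)
qed (use x in simp)

lemma crd_differentiable: "V \<in> opens M U \<Longrightarrow> a \<in> red_funs M V \<Longrightarrow> x \<in> V \<Longrightarrow> crd U \<phi> a differentiable at (\<phi> x)"
  by (rule smooth_on_imp_differentiable[OF rc_open rc_smooth]) auto

definition crd_fun :: "'n \<Rightarrow> 'a set \<Rightarrow> 'a \<Rightarrow> real" where
  "crd_fun i V = (\<lambda>x \<in> V. \<phi> x $ i)"

lemma crd_fun_red: "V \<in> opens M U \<Longrightarrow> crd_fun i V \<in> red_funs M V"
  unfolding crd_fun_def by (rule rc_pullback[where F = "\<lambda>y. y $ i"]) (auto intro: smooth_on_nth)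

text \<open>The field with coefficient functions \<open>c i\<close> in the given
  coordinates.\<close>

definition dirf :: "('n \<Rightarrow> 'a \<Rightarrow> real) \<Rightarrow> 'a set \<Rightarrow> ('a, 'a \<Rightarrow> real) vf" where
  "dirf c V = (\<lambda>W \<in> opens M V. \<lambda>a \<in> red_funs M W. \<lambda>x \<in> W. \<Sum>i\<in>UNIV. c i x * partial i (crd U \<phi> a) (\<phi> x))"

lemma dirf_apply:
  "W \<in> opens M V \<Longrightarrow> a \<in> red_funs M W \<Longrightarrow> x \<in> W \<Longrightarrow> dirf c V W a x = (\<Sum>i\<in>UNIV. c i x * partial i (crd U \<phi> a) (\<phi> x))"
  by (simp add: dirf_def)

lemma red_sum:
  assumes "opn V" "finite I" "\<And>i. i \<in> I \<Longrightarrow> b i \<in> red_funs M V"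
  shows "(\<lambda>x \<in> V. \<Sum>i\<in>I. b i x) \<in> red_funs M V"
  using assms(2,3)
proof (induction I rule: finite_induct)
  case empty
  show ?case unfolding sum.empty by (rule red_const[OF assms(1)])
next
  case (insert i I)
  have eq: "(\<lambda>x \<in> V. \<Sum>i\<in>insert i I. b i x) = (\<lambda>x \<in> V. b i x + (\<lambda>x \<in> V. \<Sum>i\<in>I. b i x) x)"
    using insert by auto
  show ?case unfolding eq using insert assms(1) by (intro red_add) auto
qed

lemma dirf_vect_hom:
  assumes V: "V \<in> opens M U" and c: "\<And>i. c i \<in> red_funs M V"
  shows "dirf c V \<in> vect_hom R V 0"
proof (rule red_vfI[OF crd_opn[OF V]])
  have W: "W \<in> opens M U" if "W \<in> opens M V" for W using that V opens_trans by blast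
  have cl: "(\<lambda>x \<in> W. \<Sum>i\<in>UNIV. c i x * partial i (crd U \<phi> a) (\<phi> x)) \<in> red_funs M W"
    if W': "W \<in> opens M V" and a: "a \<in> red_funs M W" for W a
  proof -
    have "(\<lambda>x \<in> W. restrict (c i) W x * (\<lambda>x \<in> W. partial i (crd U \<phi> a) (\<phi> x)) x) \<in> red_funs M W" for i
      by (intro red_mult crd_opn[OF W[OF W']] red_restrict[OF crd_opn[OF V] W'] c rc_pullback[OF W[OF W']]
          smooth_on_partial rc_smooth[OF W[OF W'] a])
    from red_sum[OF crd_opn[OF W[OF W']] finite this]
    show ?thesis by (simp cong: restrict_cong)
  qed
  show "dirf c V \<in> red.vf_family V"
    unfolding dirf_def using red.vf_familyI[of V "\<lambda>W a. \<lambda>x \<in> W. \<Sum>i\<in>UNIV. c i x * partial i (crd U \<phi> a) (\<phi> x)"] cl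
    by simp
  fix W a x assume W': "W \<in> opens M V" and a: "a \<in> red_funs M W"
  note WU = W[OF W'] and Wo = crd_opn[OF W[OF W']]
  {
    fix b x assume b: "b \<in> red_funs M W" and x: "x \<in> W"
    have xU: "x \<in> U" using x opensD(2)[OF WU] by blast
    note d = crd_differentiable[OF WU a x] crd_differentiable[OF WU b x]
    have eq: "(\<lambda>x \<in> W. a x + b x) z = crd U \<phi> a (\<phi> z) + crd U \<phi> b (\<phi> z)"
      "(\<lambda>x \<in> W. a x * b x) z = crd U \<phi> a (\<phi> z) * crd U \<phi> b (\<phi> z)" if "z \<in> W" for z
      using that opensD(2)[OF WU] by (auto simp: crd_eq)
    have pc: "partial i (crd U \<phi> (\<lambda>x \<in> W. a x + b x)) (\<phi> x) = partial i (\<lambda>y. crd U \<phi> a y + crd U \<phi> b y) (\<phi> x)"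
      "partial i (crd U \<phi> (\<lambda>x \<in> W. a x * b x)) (\<phi> x) = partial i (\<lambda>y. crd U \<phi> a y * crd U \<phi> b y) (\<phi> x)" for i
      by (rule crd_partial_cong[OF WU x], rule eq, assumption)+
    show "dirf c V W (\<lambda>x \<in> W. a x + b x) x = dirf c V W a x + dirf c V W b x"
      by (simp add: dirf_apply[OF W'] red_add[OF Wo] a b x pc(1) partial_add[OF d]
          sum.distrib algebra_simps)
    show "dirf c V W (\<lambda>x \<in> W. a x * b x) x = dirf c V W a x * b x + a x * dirf c V W b x"
      by (simp add: dirf_apply[OF W'] red_mult[OF Wo] a b x pc(2) partial_mult[OF d]
          sum.distrib sum_distrib_left algebra_simps crd_eq xU)
  }
  {
    fix r x assume x: "x \<in> W"
    have xU: "x \<in> U" using x opensD(2)[OF WU] by blast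
    have eq: "(\<lambda>x \<in> W. r * a x) z = r * crd U \<phi> a (\<phi> z)" if "z \<in> W" for z
      using that opensD(2)[OF WU] by (auto simp: crd_eq)
    have pc: "partial i (crd U \<phi> (\<lambda>x \<in> W. r * a x)) (\<phi> x) = partial i (\<lambda>y. r * crd U \<phi> a y) (\<phi> x)" for i
      by (rule crd_partial_cong[OF WU x]) (rule eq)
    \<comment> \<open>Multiplication by a number is treated as a product with a constant function,
      whose derivative vanishes.\<close>
    have z: "partial i (\<lambda>x. r) y = 0" for i and y :: "real ^ 'n"
      by (simp add: partial_eq[OF has_derivative_const])
    show "dirf c V W (\<lambda>x \<in> W. r * a x) x = r * dirf c V W a x"
      by (simp add: dirf_apply[OF W'] red_smult[OF Wo] a x pc
          partial_mult[OF differentiable_const crd_differentiable[OF WU a x]] z sum_distrib_left algebra_simps)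
  }
  fix W2 x assume W2: "W2 \<in> opens M W" and x: "x \<in> W2"
  have W2': "W2 \<in> opens M V" "W2 \<in> opens M U" "x \<in> W" using opens_trans[OF W' W2] opens_trans[OF WU W2] x opensD(2)[OF W2] by auto
  have "partial i (crd U \<phi> (restrict a W2)) (\<phi> x) = partial i (crd U \<phi> a) (\<phi> x)" for i
    by (rule crd_partial_cong[OF W2'(2) x]) (use opensD(2)[OF W2'(2)] in \<open>auto simp: crd_eq\<close>)
  then show "dirf c V W2 (restrict a W2) x = dirf c V W a x"
    by (simp add: dirf_apply[OF W2'(1) red_restrict[OF Wo W2 a] x] dirf_apply[OF W' a W2'(3)])
qed

text \<open>Hadamard's lemma makes every derivation of the stalk a combination of partial derivatives.\<close>

lemma tangent_chart:
  assumes v: "v \<in> tangent_hom R m 0" and m: "m \<in> U" and W: "W \<in> nbhds M m" and a: "a \<in> red_funs M W"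
  shows "v W a = (\<Sum>i\<in>UNIV. v U (crd_fun i U) * partial i (crd U \<phi> a) (\<phi> m))"
proof -
  have Un: "U \<in> nbhds M m" using rc_opn m by (simp add: nbhds_iff)
  have WU: "W \<inter> U \<in> opens M W" "W \<inter> U \<in> opens M U" "W \<inter> U \<in> nbhds M m"
    using opens_Int_left[OF W Un] by auto
  have "open (\<phi> ` (W \<inter> U))" "\<phi> m \<in> \<phi> ` (W \<inter> U)"
    using rc_open[OF WU(2)] WU(3) by (auto simp: nbhds_iff)
  then obtain e where e: "e > 0" "ball (\<phi> m) e \<subseteq> \<phi> ` (W \<inter> U)"
    using open_contains_ball by blast
  \<comment> \<open>Hadamard's lemma needs a convex domain, so the neighbourhood is shrunk to the
    preimage of a ball.\<close>
  let ?B = "ball (\<phi> m) e" and ?W = "W \<inter> U \<inter> \<phi> -` ball (\<phi> m) e"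
  have W': "?W \<in> opens M (W \<inter> U)" by (rule rc_vimage[OF WU(2)]) simp
  have W'U: "?W \<in> opens M U" "?W \<in> opens M W" using opens_trans[OF _ W'] WU by blast+
  have Wo: "opn ?W" using crd_opn[OF W'U(1)] .
  have mW: "m \<in> ?W" using e WU(3) by (auto simp: nbhds_iff)
  have Wn: "?W \<in> nbhds M m" using Wo mW by (simp add: nbhds_iff)
  have im: "\<phi> ` ?W = ?B" using e(2) by auto
  have "opn W" using W by (simp add: nbhds_iff)
  have ra: "restrict a ?W \<in> red_funs M ?W"
    by (rule red_restrict[OF \<open>opn W\<close> W'U(2) a])
  have sm: "smooth_on ?B (crd U \<phi> a)"
  proof (rule smooth_on_cong[OF open_ball])
    show "smooth_on ?B (crd U \<phi> (restrict a ?W))"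
      using rc_smooth[OF W'U(1) ra] im by simp
    fix y assume "y \<in> ?B"
    then obtain z where z: "z \<in> ?W" "y = \<phi> z" using im by (metis imageE)
    then have "z \<in> U" by simp
    then show "crd U \<phi> (restrict a ?W) y = crd U \<phi> a y" using z by (simp add: crd_eq)
  qed
  obtain h where h: "\<And>i. smooth_on ?B (h i)" "\<And>i. h i (\<phi> m) = partial i (crd U \<phi> a) (\<phi> m)"
    "\<And>x. x \<in> ?B \<Longrightarrow> crd U \<phi> a x = crd U \<phi> a (\<phi> m) + (\<Sum>i\<in>UNIV. (x $ i - \<phi> m $ i) * h i x)"
  proof -
    have "\<phi> m \<in> ?B" using e(1) by simp
    then have "\<exists>h. (\<forall>i. smooth_on ?B (h i)) \<and> (\<forall>i. h i (\<phi> m) = partial i (crd U \<phi> a) (\<phi> m)) \<and>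
        (\<forall>x \<in> ?B. crd U \<phi> a x = crd U \<phi> a (\<phi> m) + (\<Sum>i\<in>UNIV. (x $ i - \<phi> m $ i) * h i x))"
      by (rule hadamard[OF open_ball convex_ball _ sm]) blast
    then show ?thesis using that by blast
  qed
  define k where "k i = (\<lambda>x \<in> ?W. h i (\<phi> x))" for i
  \<comment> \<open>\<open>l i\<close> is the i-th coordinate minus its value at \<open>m\<close>,
    hence vanishes at \<open>m\<close>; the constant does not affect \<open>v\<close>.\<close>
  define l where "l i = (\<lambda>x \<in> ?W. crd_fun i ?W x + (\<lambda>x \<in> ?W. - \<phi> m $ i) x)" for i
  have k: "k i \<in> red_funs M ?W" for i
    unfolding k_def by (rule rc_pullback[OF W'U(1)]) (simp add: im h)
  have l: "l i \<in> red_funs M ?W" for i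
    unfolding l_def by (intro red_add Wo crd_fun_red W'U red_const)
  have vl: "v ?W (l i) = v U (crd_fun i U)" for i
  proof -
    have "v ?W (l i) = v ?W (crd_fun i ?W)"
      unfolding l_def using red_tangent_add[OF v Wn crd_fun_red[OF W'U(1)] red_const[OF Wo]] red_tangent_const[OF v Wn] by simp
    also have "crd_fun i ?W = restrict (crd_fun i U) ?W"
      by (auto simp: crd_fun_def fun_eq_iff)
    also have "v ?W \<dots> = v U (crd_fun i U)"
      using red_tangent_res[OF v Un crd_fun_red[OF opens_self[OF rc_opn]] crd_fun_red[OF opens_self[OF rc_opn]] Wn] by auto
    finally show ?thesis .
  qed
  define p where "p i = (\<lambda>x \<in> ?W. l i x * k i x)" for i
  have p: "p i \<in> red_funs M ?W" for i unfolding p_def by (rule red_mult[OF Wo l k])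
  \<comment> \<open>Since \<open>l i\<close> vanishes at \<open>m\<close>, only one term of the
    Leibniz rule survives, and \<open>k i\<close> takes the value of the partial derivative at
    \<open>m\<close>.\<close>
  have vp: "v ?W (p i) = v U (crd_fun i U) * partial i (crd U \<phi> a) (\<phi> m)" for i
    unfolding p_def using red_tangent_mult[OF v Wn l k, of i i] mW by (simp add: vl) (simp add: k_def l_def crd_fun_def h)
  have eq: "restrict a ?W = (\<lambda>x \<in> ?W. (\<lambda>x \<in> ?W. a m) x + (\<lambda>x \<in> ?W. \<Sum>i\<in>UNIV. p i x) x)"
  proof (rule extensionalityI[OF restrict_extensional restrict_extensional])
    fix x assume x: "x \<in> ?W"
    then have xU: "x \<in> U" "\<phi> x \<in> ?B" by auto
    have "a x = a m + (\<Sum>i\<in>UNIV. (\<phi> x $ i - \<phi> m $ i) * h i (\<phi> x))"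
      using h(3)[OF xU(2)] by (simp add: crd_eq xU m)
    also have "\<dots> = a m + (\<Sum>i\<in>UNIV. p i x)"
      using x by (simp add: p_def l_def k_def crd_fun_def)
    finally show "restrict a ?W x = (\<lambda>x \<in> ?W. (\<lambda>x \<in> ?W. a m) x + (\<lambda>x \<in> ?W. \<Sum>i\<in>UNIV. p i x) x) x"
      using x by simp
  qed
  have "v W a = v ?W (restrict a ?W)"
    by (rule red_tangent_res[OF v W a a Wn, symmetric]) auto
  also have "\<dots> = (\<Sum>i\<in>UNIV. v ?W (p i))"
    unfolding eq
    using red_tangent_sum[OF v Wn, of UNIV p] p red_tangent_add[OF v Wn red_const[OF Wo, of "a m"], of "\<lambda>x \<in> ?W. \<Sum>i\<in>UNIV. p i x"]
      red_tangent_const[OF v Wn, of "a m"] by simp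
  finally show ?thesis by (simp add: vp)
qed

end

section \<open>Values of fields at points and extension of tangent vectors\<close>

lemma vf_at_red:
  assumes U: "U \<in> nbhds M m" and X: "X \<in> vect_hom R U 0" and W: "W \<in> nbhds M m" and a: "a \<in> red_funs M W"
  shows "vf_at R U X m W a = X (W \<inter> U) (restrict a (W \<inter> U)) m"
proof -
  have WU: "W \<inter> U \<in> opens M W" "W \<inter> U \<in> opens M U" "opn (W \<inter> U)" "opn W"
    using opens_Int_left[OF W U] W by (auto simp: nbhds_iff)
  show ?thesis
    using W a red_vf_closed[OF X WU(2) red_restrict[OF WU(4,1) a]] by (simp add: vf_at_def eps_reduced[OF WU(3)])
qed

lemma vf_at_red_tangent:
  assumes U: "U \<in> nbhds M m" and X: "X \<in> vect_hom R U 0"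
  shows "vf_at R U X m \<in> tangent_hom R m 0"
proof -
  note va = vf_at_red[OF U X]
  have Uo: "opn U" "m \<in> U" using U by (simp_all add: nbhds_iff)
  have WU: "W \<inter> U \<in> opens M W \<and> W \<inter> U \<in> opens M U \<and> opn (W \<inter> U) \<and> opn W \<and> m \<in> W" if "W \<in> nbhds M m" for W
    using opens_Int_left[OF that U] that by (auto simp: nbhds_iff)
  have restr: "restrict (\<lambda>x \<in> W. F x) (W \<inter> U) = (\<lambda>x \<in> W \<inter> U. F x)" for W and F :: "'a \<Rightarrow> real" by auto
  have z: "vf_at R U X m W (\<lambda>x \<in> W. 0) = 0" if W: "W \<in> nbhds M m" for W
  proof -
    have "X (W \<inter> U) (\<lambda>x \<in> W \<inter> U. 0 * (\<lambda>x \<in> W \<inter> U. 0) x) m = 0"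
      using red_vf_smult[OF X, of "W \<inter> U" "\<lambda>x \<in> W \<inter> U. 0" "\<lambda>x \<in> W \<inter> U. 0" m 0] WU[OF W] Uo red_const by simp
    then show ?thesis using va[OF W red_const] WU[OF W] by (simp add: restr cong: restrict_cong)
  qed
  have add: "vf_at R U X m W (\<lambda>x \<in> W. a x + b x) = vf_at R U X m W a + vf_at R U X m W b"
    and mult: "vf_at R U X m W (\<lambda>x \<in> W. a x * b x) = vf_at R U X m W a * b m + a m * vf_at R U X m W b"
    and smult: "vf_at R U X m W (\<lambda>x \<in> W. r * a x) = r * vf_at R U X m W a"
    if W: "W \<in> nbhds M m" and a: "a \<in> red_funs M W" and b: "b \<in> red_funs M W" for W a b r
  proof -
    let ?V = "W \<inter> U"
    have m: "m \<in> ?V" using WU[OF W] Uo by blast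
    have ra: "restrict a ?V \<in> red_funs M ?V" "restrict b ?V \<in> red_funs M ?V"
      using WU[OF W] red_restrict a b by blast+
    have V: "?V \<in> opens M U" using WU[OF W] by blast
    have e: "(\<lambda>x \<in> ?V. a x + b x) = (\<lambda>x \<in> ?V. restrict a ?V x + restrict b ?V x)"
      "(\<lambda>x \<in> ?V. a x * b x) = (\<lambda>x \<in> ?V. restrict a ?V x * restrict b ?V x)"
      "(\<lambda>x \<in> ?V. r * a x) = (\<lambda>x \<in> ?V. r * restrict a ?V x)"
      by auto
    have o: "opn W" using WU[OF W] by blast
    show "vf_at R U X m W (\<lambda>x \<in> W. a x + b x) = vf_at R U X m W a + vf_at R U X m W b"
      using red_vf_add[OF X V ra m] va[OF W red_add[OF o a b]] va[OF W a] va[OF W b] by (simp only: restr e)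
    show "vf_at R U X m W (\<lambda>x \<in> W. a x * b x) = vf_at R U X m W a * b m + a m * vf_at R U X m W b"
      using red_vf_mult[OF X V ra m] va[OF W red_mult[OF o a b]] va[OF W a] va[OF W b]
      by (simp only: restr e restrict_apply'[OF m])
    show "vf_at R U X m W (\<lambda>x \<in> W. r * a x) = r * vf_at R U X m W a"
      using red_vf_smult[OF X V ra m, of r] va[OF W red_smult[OF o a, of r]] va[OF W a] by (simp only: restr e)
  qed
  have res: "vf_at R U X m W' (restrict a W') = vf_at R U X m W a"
    if W: "W \<in> nbhds M m" "W' \<in> nbhds M m" "W' \<subseteq> W" and a: "a \<in> red_funs M W" for W W' a
  proof -
    have o: "W' \<in> opens M W" "opn W" using W by (auto simp: nbhds_def opens_def dest: openin_subset)
    have V: "W' \<inter> U \<in> opens M (W \<inter> U)" "m \<in> W' \<inter> U" "m \<in> W \<inter> U"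
      using WU[OF W(2)] WU[OF W(1)] W(3) Uo by (auto simp: opens_def)
    have ra: "restrict a (W \<inter> U) \<in> red_funs M (W \<inter> U)" using WU[OF W(1)] red_restrict a by blast
    have "restrict (restrict a W') (W' \<inter> U) = restrict (restrict a (W \<inter> U)) (W' \<inter> U)"
      using W(3) by (auto simp: fun_eq_iff)
    then show ?thesis
      using red_vf_res[OF X _ ra ra V(3,1,2)] WU[OF W(1)] va[OF W(2) red_restrict[OF o(2,1) a]] va[OF W(1) a] by simp
  qed
  have k: "ksign 0 q = 1" for q by (simp add: ksign_def)
  have car: "a \<in> red_funs M W" if "W \<in> nbhds M m" "a \<in> gr (sec R W) q" for W q a
    using that WU[OF that(1)] red_const by (auto split: if_splits)
  show ?thesis
    unfolding tangent_hom_def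
  proof (intro CollectI conjI ballI allI impI)
    show "vf_at R U X m \<in> (\<Pi>\<^sub>E W\<in>nbhds R m. carrier (sec R W) \<rightarrow>\<^sub>E UNIV)"
      by (auto simp: vf_at_def)
  next
    fix W s t assume "W \<in> nbhds R m" "s \<in> carrier (sec R W)" "t \<in> carrier (sec R W)"
    then show "vf_at R U X m W (s \<oplus>\<^bsub>sec R W\<^esub> t) = vf_at R U X m W s + vf_at R U X m W t"
      using add by simp
  next
    fix W r s assume "W \<in> nbhds R m" "s \<in> carrier (sec R W)"
    then show "vf_at R U X m W (r \<odot>\<^bsub>sec R W\<^esub> s) = r * vf_at R U X m W s"
      using smult by simp
  next
    fix W s and q :: bit assume "W \<in> nbhds R m" "q \<noteq> 0" "s \<in> gr (sec R W) q"
    then show "vf_at R U X m W s = 0" using z by simp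
  next
    fix W q s t assume W: "W \<in> nbhds R m" and s: "s \<in> gr (sec R W) q" and t: "t \<in> carrier (sec R W)"
    have s': "s \<in> red_funs M W" using car[OF _ s] W by simp
    have o: "opn W" using W WU by simp
    show "vf_at R U X m W (s \<otimes>\<^bsub>sec R W\<^esub> t) = vf_at R U X m W s * eps R W t m + ksign 0 q * eps R W s m * vf_at R U X m W t"
      using mult[OF _ s'] W t s' by (simp add: k eps_reduced[OF o])
  next
    fix W W' s assume "W \<in> nbhds R m" "W' \<in> nbhds R m" "W' \<subseteq> W" "s \<in> carrier (sec R W)"
    then show "vf_at R U X m W' (res R W W' s) = vf_at R U X m W s" using res by simp
  qed
qed

text \<open>In coordinates a tangent vector is a combination of partial derivatives; the same
  coefficients, kept constant, define a field on the chart domain.\<close>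

lemma red_tangent_extension:
  assumes m: "m \<in> points M" and v: "v \<in> tangent_hom R m 0"
    and U: "m \<in> U" "red_chart U \<phi>"
  shows "\<exists>X \<in> vect_hom R U 0. vf_at R U X m = v"
proof -
  define c where "c i = (\<lambda>x \<in> U. v U (crd_fun \<phi> i U))" for i
  note Uo = rc_opn[OF U(2)]
  have Un: "U \<in> nbhds M m" using Uo U by (simp add: nbhds_iff)
  have X: "dirf U \<phi> c U \<in> vect_hom R U 0"
    by (rule dirf_vect_hom[OF U(2) opens_self[OF Uo]]) (simp add: c_def red_const[OF Uo])
  have "vf_at R U (dirf U \<phi> c U) m = v"
  proof (rule tvec_eqI[where N = R and m = m])
    show "vf_at R U (dirf U \<phi> c U) m \<in> (\<Pi>\<^sub>E W\<in>nbhds R m. carrier (sec R W) \<rightarrow>\<^sub>E UNIV)"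
      by (auto simp: vf_at_def)
    show "v \<in> (\<Pi>\<^sub>E W\<in>nbhds R m. carrier (sec R W) \<rightarrow>\<^sub>E UNIV)"
      using v by (simp add: tangent_hom_def)
    fix W a assume "W \<in> nbhds R m" "a \<in> carrier (sec R W)"
    then have W: "W \<in> nbhds M m" and a: "a \<in> red_funs M W" by auto
    have WU: "W \<inter> U \<in> opens M W" "W \<inter> U \<in> opens M U" "m \<in> W \<inter> U" "opn W"
      using opens_Int_left[OF W Un] W by (auto simp: nbhds_iff)
    have pc: "partial i (crd U \<phi> (restrict a (W \<inter> U))) (\<phi> m) = partial i (crd U \<phi> a) (\<phi> m)" for i
      by (rule crd_partial_cong[OF U(2) WU(2,3)]) (auto simp: crd_eq[OF U(2)])
    have "vf_at R U (dirf U \<phi> c U) m W a = (\<Sum>i\<in>UNIV. v U (crd_fun \<phi> i U) * partial i (crd U \<phi> a) (\<phi> m))"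
      using dirf_apply[OF U(2) WU(2) red_restrict[OF WU(4,1) a] WU(3)] U(1)
      by (simp add: vf_at_red[OF Un X W a] pc c_def)
    then show "vf_at R U (dirf U \<phi> c U) m W a = v W a"
      using tangent_chart[OF U(2) v U(1) W a] by simp
  qed
  then show ?thesis using X by blast
qed

text \<open>The values of a field are tangent vectors, so the coordinate formula for tangent vectors
  applies at each point.\<close>

lemma red_vf_chart:
  assumes U: "red_chart U \<phi>" and V: "V \<in> opens M U" and X: "X \<in> vect_hom R V 0"
    and W: "W \<in> opens M V" and a: "a \<in> red_funs M W" and x: "x \<in> W"
  shows "X W a x = (\<Sum>i\<in>UNIV. X V (crd_fun \<phi> i V) x * partial i (crd U \<phi> a) (\<phi> x))"
proof -
  have xV: "x \<in> V" "x \<in> U" using x opensD(2)[OF W] opensD(2)[OF V] by auto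
  have Vo: "opn V" and Wo: "opn W" using V W opens_imp_points by blast+
  have n: "V \<in> nbhds M x" "W \<in> nbhds M x" "U \<in> nbhds M x"
    using Vo Wo rc_opn[OF U] x xV by (auto simp: nbhds_iff)
  let ?v = "vf_at R V X x"
  have WV: "W \<inter> V = W" "U \<inter> V = V" using opensD(2)[OF W] opensD(2)[OF V] by auto
  have "restrict a W = a" using red_funs_extensional[OF a] by (rule extensional_restrict)
  then have "X W a x = ?v W a"
    using vf_at_red[OF n(1) X n(2) a] WV by simp
  also have "\<dots> = (\<Sum>i\<in>UNIV. ?v U (crd_fun \<phi> i U) * partial i (crd U \<phi> a) (\<phi> x))"
    by (rule tangent_chart[OF U vf_at_red_tangent[OF n(1) X] xV(2) n(2) a])
  finally have *: "X W a x = (\<Sum>i\<in>UNIV. ?v U (crd_fun \<phi> i U) * partial i (crd U \<phi> a) (\<phi> x))" .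
  have "?v U (crd_fun \<phi> i U) = X V (crd_fun \<phi> i V) x" for i
  proof -
    have "restrict (crd_fun \<phi> i U) V = crd_fun \<phi> i V"
      using opensD(2)[OF V] by (auto simp: crd_fun_def[OF U] fun_eq_iff)
    then show ?thesis
      using vf_at_red[OF n(1) X n(3) crd_fun_red[OF U opens_self[OF rc_opn[OF U]], of i]] WV by simp
  qed
  with * show ?thesis by simp
qed

end

text \<open>The tensor is kept abstract here: its pointwise nature rests on the axioms of a metric
  and on charts, not on lifts. It is later instantiated with the reduced metric.\<close>

locale reduced_tensor = shander_space M n Q P
  for M :: "('a, 's) superspace" and n :: "'n::finite itself" and Q P +
  fixes h :: "('a, 'a \<Rightarrow> real) tensor2"
  assumes metric: "super_metric (reduced M) h"
begin

lemma opn_R: "opn U \<Longrightarrow> U \<in> opens R (points R)"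
  by simp

lemma h_red_funs:
  assumes U: "opn U" and X: "X \<in> vect_hom R U 0" and Y: "Y \<in> vect_hom R U 0"
  shows "h U X Y \<in> red_funs M U"
  using super_metric_gr[OF metric opn_R[OF U] X Y] by simp

lemma h_sym:
  assumes U: "opn U" and X: "X \<in> vect_hom R U 0" and Y: "Y \<in> vect_hom R U 0"
  shows "h U X Y = h U Y X"
proof -
  have "(\<lambda>x \<in> U. 1 * h U Y X x) = h U Y X"
    using extensional_restrict[OF red_funs_extensional[OF h_red_funs[OF U Y X]]] by simp
  then show ?thesis
    using super_metric_sym[OF metric opn_R[OF U] X Y] by (simp add: ksign_def)
qed

lemma h_lin:
  assumes U: "opn U" and f: "f \<in> red_funs M U" and X: "X \<in> vect_hom R U 0" and Y: "Y \<in> vect_hom R U 0"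
    and Z: "Z \<in> vect_hom R U 0" and x: "x \<in> U"
  shows "h U (vf_add R U (vf_scale R U f X) Y) Z x = f x * h U X Z x + h U Y Z x"
  using super_metric_lin[OF metric opn_R[OF U], of f X Y Z] f X Y Z x by (simp add: red_vect[OF U])

lemma h_res:
  assumes U: "opn U" and X: "X \<in> vect_hom R U 0" and Y: "Y \<in> vect_hom R U 0" and W: "W \<in> opens M U" and x: "x \<in> W"
  shows "h W (vf_restrict R W X) (vf_restrict R W Y) x = h U X Y x"
  using super_metric_res[OF metric opn_R[OF U], of W X Y] X Y W x by (simp add: red_vect[OF U])

text \<open>Linearity at 1 * 0 + 0 = 0 gives a value equal to twice itself.\<close>

lemma h_zero:
  assumes U: "opn U" and Z: "Z \<in> vect_hom R U 0" and x: "x \<in> U"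
  shows "h U (vf_zero R U) Z x = 0"
proof -
  note z = red.vf_zero_vect_hom[of U 0, unfolded base_reduced opens_reduced, OF U]
  note o = red_const[OF U, of 1]
  have "vf_add R U (vf_scale R U (\<lambda>x \<in> U. 1) (vf_zero R U)) (vf_zero R U) = vf_zero R U"
  proof (rule red.vf_eqI[OF red.vect_hom_family[OF red_lincomb(1)[OF U o z z]] red.vect_hom_family[OF z]])
    fix W a assume "W \<in> opens R U" "a \<in> carrier (sec R W)"
    then show "vf_add R U (vf_scale R U (\<lambda>x \<in> U. 1) (vf_zero R U)) (vf_zero R U) W a = vf_zero R U W a"
      using red_lincomb(2)[OF U o z z, of W a] opensD(2)[of W M U] red_vf_closed[OF z] red_vf_closed[OF red_lincomb(1)[OF U o z z]]
      by (intro red_eqI[of _ W]) (auto simp: vf_zero_def)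
  qed
  then show ?thesis using h_lin[OF U o z z Z x] x by simp
qed

text \<open>Over a chart the field is a combination of coordinate fields with coefficients vanishing
  at \<open>m\<close>, and linearity over functions pulls these coefficients out. Restriction to the
  chart domain preserves the value, so the combination need only exist there.\<close>

lemma h_vanish:
  assumes U: "opn U" and X: "X \<in> vect_hom R U 0" and Z: "Z \<in> vect_hom R U 0" and m: "m \<in> U"
    and van: "\<And>W a. W \<in> opens M U \<Longrightarrow> m \<in> W \<Longrightarrow> a \<in> red_funs M W \<Longrightarrow> X W a m = 0"
  shows "h U X Z m = 0"
proof -
  have "m \<in> points M" using U m opensD(2) by blast
  then obtain C \<phi> where C: "m \<in> C" "red_chart C \<phi>" using red_chart_exists by blast
  let ?V = "U \<inter> C"
  have V: "?V \<in> opens M U" "?V \<in> opens M C" "opn ?V" "m \<in> ?V"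
    using opens_Int[OF U rc_opn[OF C(2)]] C m by auto
  define X' where "X' = vf_restrict R ?V X"
  define Z' where "Z' = vf_restrict R ?V Z"
  have X': "X' \<in> vect_hom R ?V 0" and Z': "Z' \<in> vect_hom R ?V 0"
    unfolding X'_def Z'_def using red.vf_restrict_vect_hom X Z U V by auto
  define c where "c i = X' ?V (crd_fun \<phi> i ?V)" for i
  have c: "c i \<in> red_funs M ?V" for i
    unfolding c_def by (rule red_vf_closed[OF X' opens_self[OF V(1)] crd_fun_red[OF C(2) V(2)]])
  \<comment> \<open>\<open>d I\<close> keeps the coefficients with index in \<open>I\<close> and
    \<open>\<delta> j\<close> gives the j-th coordinate field, so that coordinate fields are split
    off one at a time by the rule for \<open>f X + Y\<close>.\<close>
  define d where "d I i = (if i \<in> I then c i else (\<lambda>x \<in> ?V. 0))" for I i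
  define \<delta> where "\<delta> j i = (\<lambda>x \<in> ?V. if i = j then 1 else 0 :: real)" for i j :: 'n
  have d: "d I i \<in> red_funs M ?V" for I i unfolding d_def using c red_const[OF V(3)] by simp
  have \<delta>: "\<delta> j i \<in> red_funs M ?V" for j i unfolding \<delta>_def by (rule red_const[OF V(3)])
  let ?D = "dirf C \<phi>"
  have D: "?D (d I) ?V \<in> vect_hom R ?V 0" "?D (\<delta> j) ?V \<in> vect_hom R ?V 0" for I j
    by (rule dirf_vect_hom[OF C(2) V(2)], rule d \<delta>)+
  have sum: "h ?V (?D (d I) ?V) Z' m = (\<Sum>i\<in>I. c i m * h ?V (?D (\<delta> i) ?V) Z' m)" if "finite I" for I
    using that
  proof (induction I rule: finite_induct)
    case empty
    have "?D (d {}) ?V = vf_zero R ?V"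
      unfolding dirf_def[OF C(2)] vf_zero_def opens_reduced carrier_reduced R_simps
      by (intro restrict_ext) (auto simp: d_def dest!: subsetD[OF opensD(2)])
    then show ?case using h_zero[OF V(3) Z' V(4)] by simp
  next
    case (insert j I)
    have "?D (d (insert j I)) ?V = vf_add R ?V (vf_scale R ?V (c j) (?D (\<delta> j) ?V)) (?D (d I) ?V)"
    proof (rule red.vf_eqI[OF red.vect_hom_family[OF D(1)] red.vect_hom_family[OF red_lincomb(1)[OF V(3) c D(2) D(1)]]])
      fix W a assume "W \<in> opens R ?V" "a \<in> carrier (sec R W)"
      then have W: "W \<in> opens M ?V" and a: "a \<in> red_funs M W" by auto
      show "?D (d (insert j I)) ?V W a = vf_add R ?V (vf_scale R ?V (c j) (?D (\<delta> j) ?V)) (?D (d I) ?V) W a"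
      proof (rule red_eqI[OF red_vf_closed[OF D(1) W a] red_vf_closed[OF red_lincomb(1)[OF V(3) c D(2) D(1)] W a]])
        fix x assume x: "x \<in> W"
        have xV: "x \<in> ?V" using x opensD(2)[OF W] by blast
        have "d (insert j I) i x = c j x * \<delta> j i x + d I i x" for i
          using insert(2) xV by (auto simp: d_def \<delta>_def)
        then show "?D (d (insert j I)) ?V W a x = vf_add R ?V (vf_scale R ?V (c j) (?D (\<delta> j) ?V)) (?D (d I) ?V) W a x"
          by (simp add: red_lincomb(2)[OF V(3) c D(2) D(1) W a x] dirf_apply[OF C(2) W a x] algebra_simps sum.distrib sum_distrib_left)
      qed
    qed
    then show ?case using h_lin[OF V(3) c D(2) D(1) Z' V(4)] insert by simp
  qed
  have "X' = ?D (d UNIV) ?V"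
  proof (rule red.vf_eqI[OF red.vect_hom_family[OF X'] red.vect_hom_family[OF D(1)]])
    fix W a assume "W \<in> opens R ?V" "a \<in> carrier (sec R W)"
    then have W: "W \<in> opens M ?V" and a: "a \<in> red_funs M W" by auto
    show "X' W a = ?D (d UNIV) ?V W a"
      by (rule red_eqI[OF red_vf_closed[OF X' W a] red_vf_closed[OF D(1) W a]])
        (simp add: dirf_apply[OF C(2) W a] red_vf_chart[OF C(2) V(2) X' W a] d_def c_def)
  qed
  moreover have "c i m = 0" for i
    unfolding c_def X'_def using van[OF V(1,4) crd_fun_red[OF C(2) V(2)]] opens_self[OF V(1)] by (simp add: vf_restrict_def)
  ultimately have "h ?V X' Z' m = 0" using sum[of UNIV] by simp
  then show ?thesis using h_res[OF U X Z V(1,4)] by (simp add: X'_def Z'_def)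
qed

text \<open>The difference, written as - 1 times \<open>X'\<close> plus \<open>X\<close>, vanishes
  at \<open>m\<close>.\<close>

lemma h_pointwise_left:
  assumes U: "opn U" and X: "X \<in> vect_hom R U 0" and X': "X' \<in> vect_hom R U 0" and Z: "Z \<in> vect_hom R U 0" and m: "m \<in> U"
    and eq: "\<And>W a. W \<in> opens M U \<Longrightarrow> m \<in> W \<Longrightarrow> a \<in> red_funs M W \<Longrightarrow> X W a m = X' W a m"
  shows "h U X Z m = h U X' Z m"
proof -
  note c = red_const[OF U, of "- 1"]
  have "h U (vf_add R U (vf_scale R U (\<lambda>x \<in> U. - 1) X') X) Z m = 0"
    using m by (intro h_vanish[OF U red_lincomb(1)[OF U c X' X] Z m])
      (subst red_lincomb(2)[OF U c X' X], auto simp: eq)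
  then show ?thesis using h_lin[OF U c X' X Z m] m by simp
qed

text \<open>The two pairs may live on different neighbourhoods, so all fields are first restricted
  to the intersection; the slots are then exchanged one at a time by symmetry.\<close>

lemma h_pointwise:
  assumes U: "U \<in> nbhds M m" and X: "X \<in> vect_hom R U 0" and Y: "Y \<in> vect_hom R U 0"
    and U': "U' \<in> nbhds M m" and X': "X' \<in> vect_hom R U' 0" and Y': "Y' \<in> vect_hom R U' 0"
    and eq: "vf_at R U X m = vf_at R U' X' m" "vf_at R U Y m = vf_at R U' Y' m"
  shows "h U X Y m = h U' X' Y' m"
proof -
  let ?V = "U \<inter> U'"
  have V: "?V \<in> opens M U" "?V \<in> opens M U'" "opn ?V" "m \<in> ?V" "opn U" "opn U'"
    using opens_Int_left[OF U U'] U U' by (auto simp: nbhds_iff)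
  let ?r = "vf_restrict R ?V"
  have r: "?r X \<in> vect_hom R ?V 0" "?r Y \<in> vect_hom R ?V 0" "?r X' \<in> vect_hom R ?V 0" "?r Y' \<in> vect_hom R ?V 0"
    using red.vf_restrict_vect_hom X Y X' Y' V by auto
  have at: "?r A W a m = ?r A' W a m"
    if A: "A \<in> vect_hom R U 0" and A': "A' \<in> vect_hom R U' 0" and e: "vf_at R U A m = vf_at R U' A' m"
      and W: "W \<in> opens M ?V" and m: "m \<in> W" and a: "a \<in> red_funs M W" for A A' W a
  proof -
    have Wn: "W \<in> nbhds M m" using W m opens_imp_points by (auto simp: nbhds_iff)
    have i: "W \<inter> U = W" "W \<inter> U' = W" using opensD(2)[OF W] by auto
    have "restrict a W = a" using red_funs_extensional[OF a] by (rule extensional_restrict)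
    then show ?thesis
      using vf_at_red[OF U A Wn a] vf_at_red[OF U' A' Wn a] e i W by (simp add: vf_restrict_def)
  qed
  have "h U X Y m = h ?V (?r X) (?r Y) m"
    using h_res[OF V(5) X Y V(1,4)] by simp
  also have "\<dots> = h ?V (?r X') (?r Y) m"
    by (rule h_pointwise_left[OF V(3) r(1,3,2) V(4) at[OF X X' eq(1)]])
  also have "\<dots> = h ?V (?r Y) (?r X') m"
    by (simp add: h_sym[OF V(3) r(3,2)])
  also have "\<dots> = h ?V (?r Y') (?r X') m"
    by (rule h_pointwise_left[OF V(3) r(2,4,3) V(4) at[OF Y Y' eq(2)]])
  also have "\<dots> = h ?V (?r X') (?r Y') m"
    by (simp add: h_sym[OF V(3) r(3,4)])
  also have "\<dots> = h U' X' Y' m"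
    using h_res[OF V(6) X' Y' V(2,4)] by simp
  finally show ?thesis .
qed

text \<open>Independence of the extensions is exactly \<open>h_pointwise\<close>, so the definite
  description is evaluated by any single pair.\<close>

lemma form_at_red:
  assumes U: "U \<in> nbhds M m" and X: "X \<in> vect_hom R U 0" and Y: "Y \<in> vect_hom R U 0"
  shows "form_at R h m (vf_at R U X m) (vf_at R U Y m) = h U X Y m"
  unfolding form_at_def
proof (rule the_equality)
  have v: "vect R V = vect_hom R V 0" "eps R V (h V A B) = h V A B"
    if "V \<in> nbhds M m" "A \<in> vect_hom R V 0" "B \<in> vect_hom R V 0" for V A B
    using that red_vect eps_reduced h_red_funs by (auto simp: nbhds_iff)
  have v1: "vect R V = vect_hom R V 0" if "V \<in> nbhds M m" for V
    using that red_vect by (auto simp: nbhds_iff)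
  show "\<exists>V \<in> nbhds R m. \<exists>A \<in> vect R V. \<exists>B \<in> vect R V.
      vf_at R V A m = vf_at R U X m \<and> vf_at R V B m = vf_at R U Y m \<and> h U X Y m = eps R V (h V A B) m"
    using U X Y by (intro bexI[of _ U] bexI[of _ X] bexI[of _ Y]) (simp_all add: v v1)
  fix r assume "\<exists>V \<in> nbhds R m. \<exists>A \<in> vect R V. \<exists>B \<in> vect R V.
      vf_at R V A m = vf_at R U X m \<and> vf_at R V B m = vf_at R U Y m \<and> r = eps R V (h V A B) m"
  then obtain V A B where V: "V \<in> nbhds M m" and A: "A \<in> vect_hom R V 0" and B: "B \<in> vect_hom R V 0"
    and e: "vf_at R V A m = vf_at R U X m" "vf_at R V B m = vf_at R U Y m" "r = eps R V (h V A B) m"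
    using v1 by auto
  then show "r = h U X Y m"
    using h_pointwise[OF V A B U X Y e(1,2)] v(2)[OF V A B] by simp
qed

end

section \<open>Lifts of vector fields\<close>

context shander_space
begin

section \<open>Splitting sections and fields by \<open>ev\<close> and \<open>\<tau>\<close>\<close>

lemma opn_sub: "W \<in> opens M U \<Longrightarrow> opn W"
  by (rule opens_imp_points)

lemma e_fun:
  assumes V: "opn V" and s: "s \<in> carrier (sec M V)" and t: "t \<in> carrier (sec M V)"
  shows e0_add_fun: "e0 V (s \<oplus>\<^bsub>sec M V\<^esub> t) = (\<lambda>x \<in> V. e0 V s x + e0 V t x)"
    and e1_add_fun: "e1 V (s \<oplus>\<^bsub>sec M V\<^esub> t) = (\<lambda>x \<in> V. e1 V s x + e1 V t x)"
    and e0_mult_fun: "e0 V (s \<otimes>\<^bsub>sec M V\<^esub> t) = (\<lambda>x \<in> V. e0 V s x * e0 V t x)"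
    and e1_mult_fun: "e1 V (s \<otimes>\<^bsub>sec M V\<^esub> t) =
      (\<lambda>x \<in> V. (\<lambda>x \<in> V. e1 V s x * e0 V t x) x + (\<lambda>x \<in> V. e0 V s x * e1 V t x) x)"
  by (rule extensionalityI[of _ V],
      simp_all add: e_simps V s t closed red_funs_extensional[OF e0_red_funs] red_funs_extensional[OF e1_red_funs])+

lemma e_fun2:
  assumes V: "opn V" and s: "s \<in> carrier (sec M V)"
  shows e0_smult_fun: "e0 V (r \<odot>\<^bsub>sec M V\<^esub> s) = (\<lambda>x \<in> V. r * e0 V s x)"
    and e1_smult_fun: "e1 V (r \<odot>\<^bsub>sec M V\<^esub> s) = (\<lambda>x \<in> V. r * e1 V s x)"
    and e0_res_fun: "W \<in> opens M V \<Longrightarrow> e0 W (res M V W s) = restrict (e0 V s) W"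
    and e1_res_fun: "W \<in> opens M V \<Longrightarrow> e1 W (res M V W s) = restrict (e1 V s) W"
proof -
  show "e0 V (r \<odot>\<^bsub>sec M V\<^esub> s) = (\<lambda>x \<in> V. r * e0 V s x)"
    "e1 V (r \<odot>\<^bsub>sec M V\<^esub> s) = (\<lambda>x \<in> V. r * e1 V s x)"
    by (rule extensionalityI[of _ V],
      simp_all add: e_simps V s closed red_funs_extensional[OF e0_red_funs] red_funs_extensional[OF e1_red_funs])+
  assume W: "W \<in> opens M V"
  note c = opn_sub[OF W] res_closed[OF V W s]
  show "e0 W (res M V W s) = restrict (e0 V s) W" "e1 W (res M V W s) = restrict (e1 V s) W"
    by (rule extensionalityI[of _ W],
      simp_all add: e_simps V W s c red_funs_extensional[OF e0_red_funs] red_funs_extensional[OF e1_red_funs])+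
qed

text \<open>A splitting of \<epsilon>: its image consists of the even sections, and comparing
  components shows that it respects sums and products. It is global because the vanishing of
  \<open>e1\<close> is a chart-free condition.\<close>

definition ev :: "'a set \<Rightarrow> ('a \<Rightarrow> real) \<Rightarrow> 's" where
  "ev V a = mk V a (\<lambda>x \<in> V. 0)"

definition \<tau> :: "'a set \<Rightarrow> 's" where
  "\<tau> V = mk V (\<lambda>x \<in> V. 0) (\<lambda>x \<in> V. 1)"

lemma ev:
  assumes "opn V" "a \<in> red_funs M V"
  shows ev_closed: "ev V a \<in> carrier (sec M V)" and e0_ev: "e0 V (ev V a) = a"
    and e1_ev: "x \<in> V \<Longrightarrow> e1 V (ev V a) x = 0" and ev_gr: "ev V a \<in> gr (sec M V) 0"
  unfolding ev_def gr0_iff[OF assms(1)] using assms by (simp_all add: mk red_const)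

lemma tau:
  assumes "opn V"
  shows tau_closed: "\<tau> V \<in> carrier (sec M V)" and e0_tau: "x \<in> V \<Longrightarrow> e0 V (\<tau> V) x = 0"
    and e1_tau: "x \<in> V \<Longrightarrow> e1 V (\<tau> V) x = 1" and tau_gr: "\<tau> V \<in> gr (sec M V) 1"
  unfolding \<tau>_def gr1_iff[OF assms(1)] using assms by (simp_all add: mk red_const)

lemma ev_res: "opn V \<Longrightarrow> W \<in> opens M V \<Longrightarrow> a \<in> red_funs M V \<Longrightarrow> res M V W (ev V a) = ev W (restrict a W)"
  by (rule sec_eqI[of W])
    (use opensD(2)[of W M V] in \<open>auto simp: closed e_simps ev opn_sub red_restrict subset_iff\<close>)

lemma tau_res: "opn V \<Longrightarrow> W \<in> opens M V \<Longrightarrow> res M V W (\<tau> V) = \<tau> W"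
  by (rule sec_eqI[of W])
    (use opensD(2)[of W M V] in \<open>auto simp: closed e_simps tau opn_sub subset_iff\<close>)

text \<open>The even coefficient stands before \<open>\<tau>\<close>, so that the Leibniz rule for
  the product involves no sign.\<close>

lemma sec_decomp:
  assumes V: "opn V" and s: "s \<in> carrier (sec M V)"
  shows "s = ev V (e0 V s) \<oplus>\<^bsub>sec M V\<^esub> (ev V (e1 V s) \<otimes>\<^bsub>sec M V\<^esub> \<tau> V)"
  by (rule sec_eqI[OF V s])
    (simp_all add: V s closed e_simps ev tau e0_red_funs e1_red_funs)

text \<open>Apply the field to s0 + s1 \<tau>. By parity X s0 has no second component and X \<tau>
  no body. Hence an even field is determined by its action on reduced functions and by one further
  function, the second component of X \<tau>.\<close>

lemma even_field:
  assumes X: "X \<in> vect_hom M U 0" and W: "W \<in> opens M U" and s: "s \<in> carrier (sec M W)" and x: "x \<in> W"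
  shows even_field_e0: "e0 W (X W s) x = e0 W (X W (ev W (e0 W s))) x"
    and even_field_e1: "e1 W (X W s) x = e0 W (X W (ev W (e1 W s))) x + e1 W s x * e1 W (X W (\<tau> W)) x"
proof -
  note Wo = opn_sub[OF W]
  let ?s0 = "ev W (e0 W s)" and ?s1 = "ev W (e1 W s)"
  note r = e0_red_funs[OF Wo s] e1_red_funs[OF Wo s]
  note c = ev_closed[OF Wo r(1)] ev_closed[OF Wo r(2)] tau_closed[OF Wo]
  note Xc = vect_hom_closed[OF X W c(1)] vect_hom_closed[OF X W c(2)] vect_hom_closed[OF X W c(3)]
  have g: "e1 W (X W ?s0) x = 0" "e0 W (X W (\<tau> W)) x = 0"
    using vect_hom_gr[OF X W ev_gr[OF Wo r(1)]] vect_hom_gr[OF X W tau_gr[OF Wo]] x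
    by (simp_all add: gr0_iff[OF Wo] gr1_iff[OF Wo])
  have "X W s = X W (?s0 \<oplus>\<^bsub>sec M W\<^esub> (?s1 \<otimes>\<^bsub>sec M W\<^esub> \<tau> W))"
    using sec_decomp[OF Wo s] by simp
  also have "\<dots> = X W ?s0 \<oplus>\<^bsub>sec M W\<^esub>
      ((X W ?s1 \<otimes>\<^bsub>sec M W\<^esub> \<tau> W) \<oplus>\<^bsub>sec M W\<^esub> (ksign 0 0 \<odot>\<^bsub>sec M W\<^esub> (?s1 \<otimes>\<^bsub>sec M W\<^esub> X W (\<tau> W))))"
    using vect_hom_add[OF X W c(1) mult_closed[OF Wo c(2,3)]] vect_hom_leibniz[OF X W ev_gr[OF Wo r(2)] c(3)] by simp
  finally show "e0 W (X W s) x = e0 W (X W ?s0) x"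
    "e1 W (X W s) x = e0 W (X W ?s1) x + e1 W s x * e1 W (X W (\<tau> W)) x"
    using x by (simp_all add: e_simps closed Wo c Xc g tau e0_ev[OF Wo r(2)] e1_ev[OF Wo r(2)] ksign_def)
qed

text \<open>An odd field maps even sections to odd ones, which have no body, so modulo nilpotents
  only its value on \<open>\<tau>\<close> matters.\<close>

lemma odd_field_e0:
  assumes X: "X \<in> vect_hom M U 1" and W: "W \<in> opens M U" and s: "s \<in> carrier (sec M W)" and x: "x \<in> W"
  shows "e0 W (X W s) x = e1 W s x * e0 W (X W (\<tau> W)) x"
proof -
  note Wo = opn_sub[OF W]
  let ?s0 = "ev W (e0 W s)" and ?s1 = "ev W (e1 W s)"
  note r = e0_red_funs[OF Wo s] e1_red_funs[OF Wo s]
  note c = ev_closed[OF Wo r(1)] ev_closed[OF Wo r(2)] tau_closed[OF Wo]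
  note Xc = vect_hom_closed[OF X W c(1)] vect_hom_closed[OF X W c(2)] vect_hom_closed[OF X W c(3)]
  have "X W ?s0 \<in> gr (sec M W) 1"
    using vect_hom_gr[OF X W ev_gr[OF Wo r(1)]] by simp
  then have g: "e0 W (X W ?s0) x = 0"
    using x by (simp add: gr1_iff[OF Wo])
  have "X W s = X W (?s0 \<oplus>\<^bsub>sec M W\<^esub> (?s1 \<otimes>\<^bsub>sec M W\<^esub> \<tau> W))"
    using sec_decomp[OF Wo s] by simp
  also have "\<dots> = X W ?s0 \<oplus>\<^bsub>sec M W\<^esub>
      ((X W ?s1 \<otimes>\<^bsub>sec M W\<^esub> \<tau> W) \<oplus>\<^bsub>sec M W\<^esub> (ksign 1 0 \<odot>\<^bsub>sec M W\<^esub> (?s1 \<otimes>\<^bsub>sec M W\<^esub> X W (\<tau> W))))"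
    using vect_hom_add[OF X W c(1) mult_closed[OF Wo c(2,3)]] vect_hom_leibniz[OF X W ev_gr[OF Wo r(2)] c(3)] by simp
  finally show ?thesis
    using x by (simp add: e_simps closed Wo c Xc g tau e0_ev[OF Wo r(2)] e1_ev[OF Wo r(2)] ksign_def)
qed

lemma field_tau_res:
  assumes X: "X \<in> vect_hom M U p" and U: "opn U" and W: "W \<in> opens M U" and x: "x \<in> W"
  shows "e0 W (X W (\<tau> W)) x = e0 U (X U (\<tau> U)) x" "e1 W (X W (\<tau> W)) x = e1 U (X U (\<tau> U)) x"
proof -
  note Us = opens_self[OF U]
  have "X W (\<tau> W) = res M U W (X U (\<tau> U))"
    using vect_hom_res[OF X Us W tau_closed[OF U]] tau_res[OF U W] by simp
  then show "e0 W (X W (\<tau> W)) x = e0 U (X U (\<tau> U)) x" "e1 W (X W (\<tau> W)) x = e1 U (X U (\<tau> U)) x"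
    using e0_res[OF U W vect_hom_closed[OF X Us tau_closed[OF U]] x] e1_res[OF U W vect_hom_closed[OF X Us tau_closed[OF U]] x]
    by simp_all
qed

text \<open>Among the lifts of \<open>Y\<close> this is the one that annihilates
  \<open>\<tau>\<close>, whose components are the constants 0 and 1.\<close>

definition red_lift :: "'a set \<Rightarrow> ('a, 'a \<Rightarrow> real) vf \<Rightarrow> ('a, 's) vf" where
  "red_lift U Y = (\<lambda>W \<in> opens M U. \<lambda>s \<in> carrier (sec M W). mk W (Y W (e0 W s)) (Y W (e1 W s)))"

lemma red_lift:
  assumes Y: "Y \<in> vect_hom R U 0" and W: "W \<in> opens M U" and s: "s \<in> carrier (sec M W)"
  shows red_lift_closed: "red_lift U Y W s \<in> carrier (sec M W)"
    and e0_red_lift: "e0 W (red_lift U Y W s) = Y W (e0 W s)"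
    and e1_red_lift: "e1 W (red_lift U Y W s) = Y W (e1 W s)"
  using W s by (simp_all add: red_lift_def mk[OF opn_sub[OF W] red_vf_closed[OF Y W e0_red_funs] red_vf_closed[OF Y W e1_red_funs]]
      opn_sub[OF W])

lemma red_vf_zero_fun:
  assumes Y: "Y \<in> vect_hom R U 0" and W: "W \<in> opens M U" and x: "x \<in> W"
  shows "Y W (\<lambda>x \<in> W. 0) x = 0"
proof -
  note z = red_const[OF opn_sub[OF W], of 0]
  have "Y W (\<lambda>x \<in> W. 0 * (\<lambda>x \<in> W. 0) x) x = 0 * Y W (\<lambda>x \<in> W. 0) x"
    by (rule red_vf_smult[OF Y W z z x])
  moreover have "(\<lambda>x \<in> W. 0 * (\<lambda>x \<in> W. 0) x) = (\<lambda>x \<in> W. 0 :: real)" by auto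
  ultimately show ?thesis by simp
qed

lemma red_lift_vect_hom:
  assumes Y: "Y \<in> vect_hom R U 0"
  shows "red_lift U Y \<in> vect_hom M U 0"
proof (rule vect_homI)
  show "red_lift U Y \<in> vf_family U"
    unfolding red_lift_def
    by (rule vf_familyI) (intro mk_closed opn_sub red_vf_closed[OF Y] e0_red_funs e1_red_funs; assumption)
next
  fix W s t assume W: "W \<in> opens M U" and s: "s \<in> carrier (sec M W)" and t: "t \<in> carrier (sec M W)"
  note Wo = opn_sub[OF W]
  note r = e0_red_funs[OF Wo s] e0_red_funs[OF Wo t] e1_red_funs[OF Wo s] e1_red_funs[OF Wo t]
  show "red_lift U Y W (s \<oplus>\<^bsub>sec M W\<^esub> t) = red_lift U Y W s \<oplus>\<^bsub>sec M W\<^esub> red_lift U Y W t"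
    by (rule sec_eqI[OF Wo])
      (simp_all add: closed Wo s t red_lift[OF Y W] e_simps e0_add_fun e1_add_fun red_vf_add[OF Y W r(1,2)] red_vf_add[OF Y W r(3,4)])
next
  fix W r s assume W: "W \<in> opens M U" and s: "s \<in> carrier (sec M W)"
  note Wo = opn_sub[OF W]
  note r = e0_red_funs[OF Wo s] e1_red_funs[OF Wo s]
  show "red_lift U Y W (r \<odot>\<^bsub>sec M W\<^esub> s) = r \<odot>\<^bsub>sec M W\<^esub> red_lift U Y W s"
    by (rule sec_eqI[OF Wo])
      (simp_all add: closed Wo s red_lift[OF Y W] e_simps e0_smult_fun e1_smult_fun
        red_vf_smult[OF Y W r(1) r(1)] red_vf_smult[OF Y W r(2) r(2)])
next
  fix W q s assume W: "W \<in> opens M U" and s: "s \<in> gr (sec M W) q"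
  note Wo = opn_sub[OF W]
  have s': "s \<in> carrier (sec M W)" by (rule gr_closed[OF Wo s])
  have z: "a = (\<lambda>x \<in> W. 0)" if "a \<in> red_funs M W" "\<And>x. x \<in> W \<Longrightarrow> a x = 0" for a
    by (rule red_eqI[OF that(1) red_const[OF Wo]]) (simp add: that(2))
  show "red_lift U Y W s \<in> gr (sec M W) (0 + q)"
  proof (cases "q = 0")
    case True
    then have "e1 W s = (\<lambda>x \<in> W. 0)"
      using s by (intro z e1_red_funs[OF Wo s']) (simp add: gr0_iff[OF Wo])
    then show ?thesis
      using True by (simp add: gr0_iff[OF Wo] red_lift[OF Y W s'] red_vf_zero_fun[OF Y W])
  next
    case False
    then have q: "q = 1" by (simp add: bit_neq_0)
    then have "e0 W s = (\<lambda>x \<in> W. 0)"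
      using s by (intro z e0_red_funs[OF Wo s']) (simp add: gr1_iff[OF Wo])
    then show ?thesis
      using q by (simp add: gr1_iff[OF Wo] red_lift[OF Y W s'] red_vf_zero_fun[OF Y W])
  qed
next
  fix W q s t assume W: "W \<in> opens M U" and s: "s \<in> gr (sec M W) q" and t: "t \<in> carrier (sec M W)"
  note Wo = opn_sub[OF W]
  have s': "s \<in> carrier (sec M W)" by (rule gr_closed[OF Wo s])
  note r = e0_red_funs[OF Wo s'] e0_red_funs[OF Wo t] e1_red_funs[OF Wo s'] e1_red_funs[OF Wo t]
  have k: "ksign 0 q = 1" by (simp add: ksign_def)
  show "red_lift U Y W (s \<otimes>\<^bsub>sec M W\<^esub> t) =
      (red_lift U Y W s \<otimes>\<^bsub>sec M W\<^esub> t) \<oplus>\<^bsub>sec M W\<^esub> (ksign 0 q \<odot>\<^bsub>sec M W\<^esub> (s \<otimes>\<^bsub>sec M W\<^esub> red_lift U Y W t))"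
  proof (rule sec_eqI[OF Wo])
    fix x assume x: "x \<in> W"
    show "e0 W (red_lift U Y W (s \<otimes>\<^bsub>sec M W\<^esub> t)) x = e0 W ((red_lift U Y W s \<otimes>\<^bsub>sec M W\<^esub> t) \<oplus>\<^bsub>sec M W\<^esub>
        (ksign 0 q \<odot>\<^bsub>sec M W\<^esub> (s \<otimes>\<^bsub>sec M W\<^esub> red_lift U Y W t))) x"
      unfolding k by (simp add: closed Wo s' t x red_lift[OF Y W] e_simps e0_mult_fun red_vf_mult[OF Y W r(1,2)])
    \<comment> \<open>The second component of a product is a sum of two products of reduced
      functions, so additivity and two Leibniz rules of \<open>Y\<close> produce the four terms
      required.\<close>
    have "Y W (e1 W (s \<otimes>\<^bsub>sec M W\<^esub> t)) x = Y W (\<lambda>x \<in> W. e1 W s x * e0 W t x) x + Y W (\<lambda>x \<in> W. e0 W s x * e1 W t x) x"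
      unfolding e1_mult_fun[OF Wo s' t]
      by (rule red_vf_add[OF Y W red_mult[OF Wo r(3,2)] red_mult[OF Wo r(1,4)] x])
    then show "e1 W (red_lift U Y W (s \<otimes>\<^bsub>sec M W\<^esub> t)) x = e1 W ((red_lift U Y W s \<otimes>\<^bsub>sec M W\<^esub> t) \<oplus>\<^bsub>sec M W\<^esub>
        (ksign 0 q \<odot>\<^bsub>sec M W\<^esub> (s \<otimes>\<^bsub>sec M W\<^esub> red_lift U Y W t))) x"
      unfolding k by (simp add: closed Wo s' t x red_lift[OF Y W] e_simps red_vf_mult[OF Y W r(3,2)] red_vf_mult[OF Y W r(1,4)])
  qed (simp_all add: closed Wo s' t red_lift[OF Y W])
next
  fix W V s assume W: "W \<in> opens M U" and V: "V \<in> opens M W" and s: "s \<in> carrier (sec M W)"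
  note Wo = opn_sub[OF W] and Vo = opn_sub[OF V] and VU = opens_trans[OF W V]
  note r = e0_red_funs[OF Wo s] e1_red_funs[OF Wo s] and c = res_closed[OF Wo V s]
  have xW: "x \<in> W" if "x \<in> V" for x using that opensD(2)[OF V] by blast
  show "red_lift U Y V (res M W V s) = res M W V (red_lift U Y W s)"
    by (rule sec_eqI[OF Vo])
      (simp_all add: closed Wo V s c xW red_lift[OF Y W] red_lift[OF Y VU] e0_res_fun e1_res_fun e0_res e1_res
        red_vf_res[OF Y W r(1) r(1)] red_vf_res[OF Y W r(2) r(2)])
qed

lemma red_lift_is_lift: "Y \<in> vect_hom R U 0 \<Longrightarrow> is_lift M U Y (red_lift U Y)"
  unfolding is_lift_def by (simp add: red_lift_vect_hom e0_red_lift)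

text \<open>The field on the reduced manifold of which \<open>X\<close> is a lift. \<open>ev\<close>
  picks a representative of each reduced function; by \<open>even_field_e0\<close> any other section
  with the same body gives the same result.\<close>

definition reduction :: "'a set \<Rightarrow> ('a, 's) vf \<Rightarrow> ('a, 'a \<Rightarrow> real) vf" where
  "reduction U X = (\<lambda>W \<in> opens M U. \<lambda>a \<in> red_funs M W. e0 W (X W (ev W a)))"

lemma reduction_apply: "W \<in> opens M U \<Longrightarrow> a \<in> red_funs M W \<Longrightarrow> reduction U X W a = e0 W (X W (ev W a))"
  by (simp add: reduction_def)

lemma reduction_vect_hom:
  assumes U: "opn U" and X: "X \<in> vect_hom M U 0"
  shows "reduction U X \<in> vect_hom R U 0"
proof (rule red_vfI[OF U])
  show "reduction U X \<in> red.vf_family U"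
    unfolding reduction_def
    using red.vf_familyI[of U "\<lambda>W a. e0 W (X W (ev W a))"] e0_red_funs vect_hom_closed[OF X] ev_closed opn_sub by simp
  fix W a assume W: "W \<in> opens M U" and a: "a \<in> red_funs M W"
  note Wo = opn_sub[OF W]
  note ca = ev_closed[OF Wo a] and Xa = vect_hom_closed[OF X W ev_closed[OF Wo a]]
  {
    fix b x assume b: "b \<in> red_funs M W" and x: "x \<in> W"
    note cb = ev_closed[OF Wo b] and Xb = vect_hom_closed[OF X W ev_closed[OF Wo b]]
    have "ev W (\<lambda>x \<in> W. a x + b x) = ev W a \<oplus>\<^bsub>sec M W\<^esub> ev W b"
      by (rule sec_eqI[OF Wo]) (simp_all add: closed Wo ca cb ev a b red_add e_simps)
    then show "reduction U X W (\<lambda>x \<in> W. a x + b x) x = reduction U X W a x + reduction U X W b x"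
      by (simp add: reduction_apply[OF W] red_add Wo a b vect_hom_add[OF X W] ca cb Xa Xb e_simps x)
    have "ev W (\<lambda>x \<in> W. a x * b x) = ev W a \<otimes>\<^bsub>sec M W\<^esub> ev W b"
      by (rule sec_eqI[OF Wo]) (simp_all add: closed Wo ca cb ev a b red_mult e_simps)
    then show "reduction U X W (\<lambda>x \<in> W. a x * b x) x = reduction U X W a x * b x + a x * reduction U X W b x"
      by (simp add: reduction_apply[OF W] red_mult Wo a b vect_hom_leibniz[OF X W ev_gr] ca cb Xa Xb e_simps closed x ksign_def e0_ev)
  }
  {
    fix r x assume x: "x \<in> W"
    have "ev W (\<lambda>x \<in> W. r * a x) = r \<odot>\<^bsub>sec M W\<^esub> ev W a"
      by (rule sec_eqI[OF Wo]) (simp_all add: closed Wo ca ev a red_smult e_simps)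
    then show "reduction U X W (\<lambda>x \<in> W. r * a x) x = r * reduction U X W a x"
      by (simp add: reduction_apply[OF W] red_smult Wo a vect_hom_smult[OF X W] ca Xa e_simps x)
  }
  fix V x assume V: "V \<in> opens M W" and x: "x \<in> V"
  show "reduction U X V (restrict a V) x = reduction U X W a x"
    using vect_hom_res[OF X W V ca] e0_res[OF Wo V Xa x]
    by (simp add: reduction_apply[OF W a] reduction_apply[OF opens_trans[OF W V] red_restrict[OF Wo V a]] ev_res[OF Wo V a])
qed

lemma reduction_is_lift:
  assumes X: "X \<in> vect_hom M U 0"
  shows "is_lift M U (reduction U X) X"
  unfolding is_lift_def
proof (intro conjI ballI X)
  fix W s assume W: "W \<in> opens M U" and s: "s \<in> carrier (sec M W)"
  note Wo = opn_sub[OF W]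
  note r = e0_red_funs[OF Wo s]
  show "reduction U X W (e0 W s) = e0 W (X W s)"
    by (rule red_eqI[of _ W])
      (simp_all add: reduction_apply[OF W r] even_field_e0[OF X W s] e0_red_funs[OF Wo] vect_hom_closed[OF X W] s ev_closed[OF Wo r])
qed

lemma vect_hom_vect:
  assumes U: "opn U" and X: "X \<in> vect_hom M U p"
  shows "X \<in> vect M U"
proof -
  have eq: "vf_add M U X (vf_zero M U) = X" "vf_add M U (vf_zero M U) X = X"
  proof -
    have z: "X W s \<oplus>\<^bsub>sec M W\<^esub> vf_zero M U W s = X W s" "vf_zero M U W s \<oplus>\<^bsub>sec M W\<^esub> X W s = X W s"
      if W: "W \<in> opens M U" and s: "s \<in> carrier (sec M W)" for W s
    proof -
      interpret ring "sec M W" by (rule superalgebra_ring[OF sec_superalgebra[OF opn_sub[OF W]]])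
      show "X W s \<oplus>\<^bsub>sec M W\<^esub> vf_zero M U W s = X W s" "vf_zero M U W s \<oplus>\<^bsub>sec M W\<^esub> X W s = X W s"
        using vect_hom_closed[OF X W s] W s by (simp_all add: vf_zero_def)
    qed
    have "vf_add M U X (vf_zero M U) \<in> vf_family U" "vf_add M U (vf_zero M U) X \<in> vf_family U"
      unfolding vf_add_def by (rule vf_familyI, simp add: z vect_hom_closed[OF X])+
    then show "vf_add M U X (vf_zero M U) = X" "vf_add M U (vf_zero M U) X = X"
      using vf_eqI[OF _ vect_hom_family[OF X]] by (simp_all add: vf_add_def z)
  qed
  show ?thesis
  proof (cases "p = 0")
    case True
    then show ?thesis unfolding vect_def using X vf_zero_vect_hom[OF U, of 1] eq(1) by (metis (mono_tags, lifting) mem_Collect_eq)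
  next
    case False
    then have "p = 1" by (simp add: bit_neq_0)
    then show ?thesis unfolding vect_def using X vf_zero_vect_hom[OF U, of 0] eq(2) by (metis (mono_tags, lifting) mem_Collect_eq)
  qed
qed

text \<open>Used to make multiples of Q with prescribed value at a point. Evenness of
  \<open>f\<close>, that is \<open>e1 U f\<close> being zero, enters where the product has to be
  even again.\<close>

lemma vf_scale_even_vect_hom:
  assumes U: "opn U" and f: "f \<in> gr (sec M U) 0" and X: "X \<in> vect_hom M U p"
  shows "vf_scale M U f X \<in> vect_hom M U p"
proof -
  have fc: "f \<in> carrier (sec M U)" and f1: "\<And>x. x \<in> U \<Longrightarrow> e1 U f x = 0"
    using f by (auto simp: gr0_iff[OF U])
  have ap: "vf_scale M U f X W s = res M U W f \<otimes>\<^bsub>sec M W\<^esub> X W s" if "W \<in> opens M U" "s \<in> carrier (sec M W)" for W s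
    using that by (simp add: vf_scale_def)
  have xU: "x \<in> U" if "W \<in> opens M U" "x \<in> W" for W x using that opensD(2) by blast
  note rc = res_closed[OF U _ fc]
  show ?thesis
  proof (rule vect_homI)
    show "vf_scale M U f X \<in> vf_family U"
      unfolding vf_scale_def by (rule vf_familyI) (simp add: closed opn_sub rc vect_hom_closed[OF X])
  next
    fix W s t assume W: "W \<in> opens M U" and s: "s \<in> carrier (sec M W)" and t: "t \<in> carrier (sec M W)"
    note Wo = opn_sub[OF W]
    note c = Wo s t rc[OF W] vect_hom_closed[OF X W s] vect_hom_closed[OF X W t]
    show "vf_scale M U f X W (s \<oplus>\<^bsub>sec M W\<^esub> t) = vf_scale M U f X W s \<oplus>\<^bsub>sec M W\<^esub> vf_scale M U f X W t"
      by (rule sec_eqI[OF Wo]) (simp_all add: ap[OF W] closed c vect_hom_add[OF X W] e_simps algebra_simps)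
  next
    fix W r s assume W: "W \<in> opens M U" and s: "s \<in> carrier (sec M W)"
    note Wo = opn_sub[OF W]
    note c = Wo s rc[OF W] vect_hom_closed[OF X W s]
    show "vf_scale M U f X W (r \<odot>\<^bsub>sec M W\<^esub> s) = r \<odot>\<^bsub>sec M W\<^esub> vf_scale M U f X W s"
      by (rule sec_eqI[OF Wo]) (simp_all add: ap[OF W] closed c vect_hom_smult[OF X W] e_simps algebra_simps)
  next
    fix W q s assume W: "W \<in> opens M U" and s: "s \<in> gr (sec M W) q"
    note Wo = opn_sub[OF W]
    have s': "s \<in> carrier (sec M W)" by (rule gr_closed[OF Wo s])
    note c = Wo s' rc[OF W] vect_hom_closed[OF X W s']
    have g: "X W s \<in> gr (sec M W) (p + q)" by (rule vect_hom_gr[OF X W s])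
    show "vf_scale M U f X W s \<in> gr (sec M W) (p + q)"
    proof (cases "p + q = 0")
      case True
      then show ?thesis
        using g by (simp only: True gr0_iff[OF Wo] ap[OF W s']) (simp add: c closed e_simps U W fc f1 xU[OF W])
    next
      case False
      then have 1: "p + q = 1" by (simp only: bit_neq_0)
      show ?thesis
        using g by (simp only: 1 gr1_iff[OF Wo] ap[OF W s']) (simp add: c closed e_simps)
    qed
  next
    fix W q s t assume W: "W \<in> opens M U" and s: "s \<in> gr (sec M W) q" and t: "t \<in> carrier (sec M W)"
    note Wo = opn_sub[OF W]
    have s': "s \<in> carrier (sec M W)" by (rule gr_closed[OF Wo s])
    note c = Wo s' t rc[OF W] vect_hom_closed[OF X W s'] vect_hom_closed[OF X W t]
    show "vf_scale M U f X W (s \<otimes>\<^bsub>sec M W\<^esub> t) =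
        (vf_scale M U f X W s \<otimes>\<^bsub>sec M W\<^esub> t) \<oplus>\<^bsub>sec M W\<^esub> (ksign p q \<odot>\<^bsub>sec M W\<^esub> (s \<otimes>\<^bsub>sec M W\<^esub> vf_scale M U f X W t))"
      by (rule sec_eqI[OF Wo])
        (simp_all add: ap[OF W] closed c vect_hom_leibniz[OF X W s t] e_simps algebra_simps U W fc f1 xU[OF W])
  next
    fix W V s assume W: "W \<in> opens M U" and V: "V \<in> opens M W" and s: "s \<in> carrier (sec M W)"
    note Wo = opn_sub[OF W] and Vo = opn_sub[OF V] and VU = opens_trans[OF W V]
    note c = Wo Vo s res_closed[OF Wo V s] rc[OF W] vect_hom_closed[OF X W s]
    show "vf_scale M U f X V (res M W V s) = res M W V (vf_scale M U f X W s)"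
      using superalg_hom_mult[OF res_hom[OF Wo V] rc[OF W] vect_hom_closed[OF X W s]]
      by (simp add: ap[OF W] ap[OF VU] c vect_hom_res[OF X W V s] res_res[OF U W V fc])
  qed
qed

end

section \<open>The reduced metric\<close>

locale shander_metric = shander_space M n Q P
  for M :: "('a, 's) superspace" and n :: "'n::finite itself" and Q P +
  fixes g :: "('a, 's) tensor2"
  assumes metric: "super_metric M g"
begin

section \<open>Independence of the reduced metric from the lifts\<close>

abbreviation QU :: "'a set \<Rightarrow> ('a, 's) vf" where
  "QU U \<equiv> vf_restrict M U Q"

lemma QU_hom: "opn U \<Longrightarrow> QU U \<in> vect_hom M U 1"
  by (rule vf_restrict_vect_hom[OF Q]) (auto simp: opens_def)

lemma QU_apply: "W \<in> opens M U \<Longrightarrow> QU U W s = Q W s"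
  by (simp add: vf_restrict_def)

lemma e0_Q: "e0 W (Q W s) = e1 W s"
  by (simp add: e1_def)

lemma g_closed: "opn U \<Longrightarrow> X \<in> vect_hom M U p \<Longrightarrow> Y \<in> vect_hom M U q \<Longrightarrow> g U X Y \<in> carrier (sec M U)"
  using super_metric_gr[OF metric] gr_closed by blast

lemma g_sym_e0:
  assumes "opn U" "X \<in> vect_hom M U p" "Y \<in> vect_hom M U q" "x \<in> U"
  shows "e0 U (g U X Y) x = ksign p q * e0 U (g U Y X) x"
  unfolding super_metric_sym[OF metric assms(1-3)]
  by (rule e0_smult[OF assms(1) g_closed[OF assms(1,3,2)] assms(4)])

lemma g_mixed_e0:
  assumes "opn U" "X \<in> vect_hom M U p" "Y \<in> vect_hom M U q" "p + q = 1" "x \<in> U"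
  shows "e0 U (g U X Y) x = 0"
  using super_metric_gr[OF metric assms(1-3)] assms(5) unfolding assms(4) gr1_iff[OF assms(1)] by blast

text \<open>As 1 * 0 + 0 = 0, linearity makes both components equal to twice themselves. The zero
  field serves as the idle second summand when linearity is applied to a single multiple.\<close>

lemma g_zero:
  assumes U: "opn U" and Z: "Z \<in> vect_hom M U p" and x: "x \<in> U"
  shows "e0 U (g U (vf_zero M U) Z) x = 0" "e1 U (g U (vf_zero M U) Z) x = 0"
proof -
  let ?z = "vf_zero M U"
  note z = vf_zero_vect_hom[OF U, of 0] and o = one_closed[OF U]
  have "vf_add M U (vf_scale M U \<one>\<^bsub>sec M U\<^esub> ?z) ?z = ?z"
  proof -
    have "(res M U W \<one>\<^bsub>sec M U\<^esub> \<otimes>\<^bsub>sec M W\<^esub> \<zero>\<^bsub>sec M W\<^esub>) \<oplus>\<^bsub>sec M W\<^esub> \<zero>\<^bsub>sec M W\<^esub> = \<zero>\<^bsub>sec M W\<^esub>" if W: "W \<in> opens M U" for W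
    proof -
      interpret ring "sec M W" by (rule superalgebra_ring[OF sec_superalgebra[OF opn_sub[OF W]]])
      show ?thesis using res_closed[OF U W o] by simp
    qed
    then show ?thesis
      by (auto simp: vf_add_def vf_scale_def vf_zero_def intro!: restrict_ext)
  qed
  then have eq: "g U ?z Z = (\<one>\<^bsub>sec M U\<^esub> \<otimes>\<^bsub>sec M U\<^esub> g U ?z Z) \<oplus>\<^bsub>sec M U\<^esub> g U ?z Z"
    using super_metric_lin[OF metric U o vect_hom_vect[OF U z] vect_hom_vect[OF U z] vect_hom_vect[OF U Z]]
    by simp
  note c = g_closed[OF U z Z]
  have "e0 U (g U ?z Z) x = e0 U ((\<one>\<^bsub>sec M U\<^esub> \<otimes>\<^bsub>sec M U\<^esub> g U ?z Z) \<oplus>\<^bsub>sec M U\<^esub> g U ?z Z) x"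
    "e1 U (g U ?z Z) x = e1 U ((\<one>\<^bsub>sec M U\<^esub> \<otimes>\<^bsub>sec M U\<^esub> g U ?z Z) \<oplus>\<^bsub>sec M U\<^esub> g U ?z Z) x"
    using eq by simp_all
  then show "e0 U (g U ?z Z) x = 0" "e1 U (g U ?z Z) x = 0"
    using x by (simp_all add: e_simps closed U c)
qed

text \<open>Two lifts of the same field differ by \<open>f Q\<close> with \<open>f\<close> odd.\<close>

lemma g_lift_left:
  assumes U: "opn U" and X: "is_lift M U Y X" and X': "is_lift M U Y X'" and Z: "Z \<in> vect_hom M U p" and x: "x \<in> U"
  shows "e0 U (g U X Z) x = e0 U (g U X' Z) x"
proof -
  have Xh: "X \<in> vect_hom M U 0" and X'h: "X' \<in> vect_hom M U 0"
    and e: "\<And>W s. W \<in> opens M U \<Longrightarrow> s \<in> carrier (sec M W) \<Longrightarrow> e0 W (X W s) = e0 W (X' W s)"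
    using X X' by (auto simp: is_lift_def)
  note Us = opens_self[OF U]
  note c = tau_closed[OF U] vect_hom_closed[OF Xh Us tau_closed[OF U]] vect_hom_closed[OF X'h Us tau_closed[OF U]]
  \<comment> \<open>On \<open>\<tau>\<close> the two lifts differ by this second component. The zero
    body makes \<open>f\<close> odd; the difference is written as a sum with - 1 times the second
    term to fit the closure rules of \<open>red_funs\<close>.\<close>
  define f where "f = mk U (\<lambda>x \<in> U. 0) (\<lambda>x \<in> U. e1 U (X U (\<tau> U)) x + (\<lambda>x \<in> U. - 1 * e1 U (X' U (\<tau> U)) x) x)"
  have r: "(\<lambda>x \<in> U. e1 U (X U (\<tau> U)) x + (\<lambda>x \<in> U. - 1 * e1 U (X' U (\<tau> U)) x) x) \<in> red_funs M U"
    by (intro red_add red_smult U e1_red_funs c)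
  note f = mk[OF U red_const[OF U, of 0] r, folded f_def]
  have "X = vf_add M U (vf_scale M U f (QU U)) X'"
  proof (rule vf_eqI[OF vect_hom_family[OF Xh]])
    have ap: "vf_add M U (vf_scale M U f (QU U)) X' W s = (res M U W f \<otimes>\<^bsub>sec M W\<^esub> Q W s) \<oplus>\<^bsub>sec M W\<^esub> X' W s"
      if "W \<in> opens M U" "s \<in> carrier (sec M W)" for W s
      using that by (simp add: vf_add_def vf_scale_def QU_apply)
    have cl: "(res M U W f \<otimes>\<^bsub>sec M W\<^esub> Q W s) \<oplus>\<^bsub>sec M W\<^esub> X' W s \<in> carrier (sec M W)"
      if "W \<in> opens M U" "s \<in> carrier (sec M W)" for W s
      using that by (simp add: closed opn_sub U f(1) vect_hom_closed[OF X'h])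
    show "vf_add M U (vf_scale M U f (QU U)) X' \<in> vf_family U"
      unfolding vf_add_def by (rule vf_familyI) (use cl in \<open>simp add: vf_scale_def QU_apply\<close>)
    fix W s assume W: "W \<in> opens M U" and s: "s \<in> carrier (sec M W)"
    note Wo = opn_sub[OF W]
    show "X W s = vf_add M U (vf_scale M U f (QU U)) X' W s"
      unfolding ap[OF W s]
    proof (rule sec_eqI[OF Wo vect_hom_closed[OF Xh W s] cl[OF W s]])
      fix y assume y: "y \<in> W"
      then have yU: "y \<in> U" using opensD(2)[OF W] by blast
      note cc = Wo res_closed[OF U W f(1)] Q_closed[OF Wo s] vect_hom_closed[OF X'h W s] y
      show "e0 W (X W s) y = e0 W ((res M U W f \<otimes>\<^bsub>sec M W\<^esub> Q W s) \<oplus>\<^bsub>sec M W\<^esub> X' W s) y"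
        using yU by (simp add: e_simps cc closed U W f e[OF W s])
      \<comment> \<open>The summand of \<open>even_field_e1\<close> coming from the even coefficient
        is the same for both lifts, so only the difference on \<open>\<tau>\<close> remains, and
        \<open>f\<close> was chosen to be it.\<close>
      have "e0 W (X W (ev W (e1 W s))) = e0 W (X' W (ev W (e1 W s)))"
        by (rule e[OF W ev_closed[OF Wo e1_red_funs[OF Wo s]]])
      then show "e1 W (X W s) y = e1 W ((res M U W f \<otimes>\<^bsub>sec M W\<^esub> Q W s) \<oplus>\<^bsub>sec M W\<^esub> X' W s) y"
        using yU by (simp add: e_simps cc closed U W f e0_Q even_field_e1[OF Xh W s y] even_field_e1[OF X'h W s y]
            field_tau_res(2)[OF Xh U W y] field_tau_res(2)[OF X'h U W y] algebra_simps)
    qed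
  qed
  then have "g U X Z = (f \<otimes>\<^bsub>sec M U\<^esub> g U (QU U) Z) \<oplus>\<^bsub>sec M U\<^esub> g U X' Z"
    using super_metric_lin[OF metric U f(1) vect_hom_vect[OF U QU_hom[OF U]] vect_hom_vect[OF U X'h] vect_hom_vect[OF U Z]] by simp
  then show ?thesis
    using x by (simp add: e_simps closed U f g_closed[OF U QU_hom[OF U] Z] g_closed[OF U X'h Z])
qed

text \<open>Lifts are exchanged in the first slot, and in the second after swapping the arguments,
  which costs no sign for even fields. Hence the definite description is evaluated by any pair of
  lifts.\<close>

lemma reduced_metric_eq:
  assumes U: "opn U" and X: "is_lift M U A X" and Y: "is_lift M U B Y"
  shows "reduced_metric M g U A B = e0 U (g U X Y)"
  unfolding reduced_metric_def
proof (rule the_equality)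
  show "\<exists>X' Y'. is_lift M U A X' \<and> is_lift M U B Y' \<and> e0 U (g U X Y) = e0 U (g U X' Y')"
    using X Y by blast
  fix h assume "\<exists>X' Y'. is_lift M U A X' \<and> is_lift M U B Y' \<and> h = e0 U (g U X' Y')"
  then obtain X' Y' where X': "is_lift M U A X'" and Y': "is_lift M U B Y'" and h: "h = e0 U (g U X' Y')"
    by blast
  have hom: "X \<in> vect_hom M U 0" "Y \<in> vect_hom M U 0" "X' \<in> vect_hom M U 0" "Y' \<in> vect_hom M U 0"
    using X Y X' Y' by (auto simp: is_lift_def)
  have s: "e0 U (g U C D) x = e0 U (g U D C) x" if "C \<in> vect_hom M U 0" "D \<in> vect_hom M U 0" "x \<in> U" for C D x
    using g_sym_e0[OF U that] by (simp add: ksign_def)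
  show "h = e0 U (g U X Y)"
    unfolding h
  proof (rule red_eqI[OF e0_red_funs[OF U g_closed[OF U hom(3,4)]] e0_red_funs[OF U g_closed[OF U hom(1,2)]]])
    fix x assume x: "x \<in> U"
    have "e0 U (g U X' Y') x = e0 U (g U X Y') x" by (rule g_lift_left[OF U X' X hom(4) x])
    also have "\<dots> = e0 U (g U Y' X) x" by (rule s[OF hom(1,4) x])
    also have "\<dots> = e0 U (g U Y X) x" by (rule g_lift_left[OF U Y' Y hom(1) x])
    also have "\<dots> = e0 U (g U X Y) x" by (rule s[OF hom(2,1) x])
    finally show "e0 U (g U X' Y') x = e0 U (g U X Y) x" .
  qed
qed

abbreviation h :: "('a, 'a \<Rightarrow> real) tensor2" where
  "h \<equiv> reduced_metric M g"

section \<open>Tensor axioms for the reduced metric\<close>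

lemma h_eq: "opn U \<Longrightarrow> A \<in> vect_hom R U 0 \<Longrightarrow> B \<in> vect_hom R U 0 \<Longrightarrow> h U A B = e0 U (g U (red_lift U A) (red_lift U B))"
  by (rule reduced_metric_eq) (auto intro: red_lift_is_lift)

lemma h_closed: "opn U \<Longrightarrow> A \<in> vect_hom R U 0 \<Longrightarrow> B \<in> vect_hom R U 0 \<Longrightarrow> h U A B \<in> red_funs M U"
  using h_eq[of U A B] e0_red_funs[OF _ g_closed[OF _ red_lift_vect_hom red_lift_vect_hom]] by simp

lemma h_sym: "opn U \<Longrightarrow> A \<in> vect_hom R U 0 \<Longrightarrow> B \<in> vect_hom R U 0 \<Longrightarrow> h U A B = h U B A"
  using g_sym_e0[OF _ red_lift_vect_hom red_lift_vect_hom, of U A B]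
  by (intro red_eqI[of _ U]) (simp_all add: h_closed, simp add: h_eq ksign_def)

text \<open>The zero field is lifted by the zero field. The lemma handles the odd arguments in the
  axioms of a metric, since odd fields on the reduced manifold are zero.\<close>

lemma h_zero:
  assumes U: "opn U" and B: "B \<in> vect_hom R U 0"
  shows "h U (vf_zero R U) B = (\<lambda>x \<in> U. 0)"
proof -
  note z = vf_zero_vect_hom[OF U, of 0]
  have "is_lift M U (vf_zero R U) (vf_zero M U)"
    unfolding is_lift_def
  proof (intro conjI ballI z)
    fix W s assume W: "W \<in> opens M U" and s: "s \<in> carrier (sec M W)"
    note Wo = opn_sub[OF W]
    show "vf_zero R U W (e0 W s) = e0 W (vf_zero M U W s)"
      using W s e0_red_funs[OF Wo s] red_const[OF Wo, of 0] e0_red_funs[OF Wo zero_closed[OF Wo]]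
      by (intro red_eqI[of _ W]) (simp_all add: vf_zero_def e0_zero[OF Wo])
  qed
  then have "h U (vf_zero R U) B = e0 U (g U (vf_zero M U) (red_lift U B))"
    by (rule reduced_metric_eq[OF U _ red_lift_is_lift[OF B]])
  then show ?thesis
    using g_zero(1)[OF U red_lift_vect_hom[OF B]] e0_red_funs[OF U g_closed[OF U z red_lift_vect_hom[OF B]]] red_const[OF U, of 0]
    by (intro red_eqI[of _ U]) simp_all
qed

text \<open>The canonical lift is itself linear over functions, with \<open>ev U f\<close> in place
  of \<open>f\<close>; linearity of \<open>g\<close> then passes to bodies.\<close>

lemma h_lin:
  assumes U: "opn U" and f: "f \<in> red_funs M U" and A: "A \<in> vect_hom R U 0" and B: "B \<in> vect_hom R U 0" and C: "C \<in> vect_hom R U 0"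
  shows "h U (vf_add R U (vf_scale R U f A) B) C = (\<lambda>x \<in> U. (\<lambda>x \<in> U. f x * h U A C x) x + h U B C x)"
proof -
  let ?L = "vf_add R U (vf_scale R U f A) B"
  note L = red_lincomb(1)[OF U f A B]
  note lh = red_lift_vect_hom[OF A] red_lift_vect_hom[OF B] red_lift_vect_hom[OF C] red_lift_vect_hom[OF L]
  note fc = ev_closed[OF U f]
  have "red_lift U ?L = vf_add M U (vf_scale M U (ev U f) (red_lift U A)) (red_lift U B)"
  proof (rule vf_eqI[OF vect_hom_family[OF lh(4)]])
    let ?S = "\<lambda>W s. (res M U W (ev U f) \<otimes>\<^bsub>sec M W\<^esub> red_lift U A W s) \<oplus>\<^bsub>sec M W\<^esub> red_lift U B W s"
    have ap: "vf_add M U (vf_scale M U (ev U f) (red_lift U A)) (red_lift U B) W s = ?S W s"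
      if "W \<in> opens M U" "s \<in> carrier (sec M W)" for W s
      using that by (simp add: vf_add_def vf_scale_def)
    have cl: "?S W s \<in> carrier (sec M W)" if "W \<in> opens M U" "s \<in> carrier (sec M W)" for W s
      using that by (simp add: closed opn_sub U fc vect_hom_closed[OF lh(1)] vect_hom_closed[OF lh(2)])
    show "vf_add M U (vf_scale M U (ev U f) (red_lift U A)) (red_lift U B) \<in> vf_family U"
      unfolding vf_add_def by (rule vf_familyI) (use cl in \<open>simp add: vf_scale_def\<close>)
    fix W s assume W: "W \<in> opens M U" and s: "s \<in> carrier (sec M W)"
    note Wo = opn_sub[OF W]
    show "red_lift U ?L W s = vf_add M U (vf_scale M U (ev U f) (red_lift U A)) (red_lift U B) W s"
      unfolding ap[OF W s]
    proof (rule sec_eqI[OF Wo vect_hom_closed[OF lh(4) W s] cl[OF W s]])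
      fix y assume y: "y \<in> W"
      then have yU: "y \<in> U" using opensD(2)[OF W] by blast
      note cc = Wo res_closed[OF U W fc] vect_hom_closed[OF lh(1) W s] vect_hom_closed[OF lh(2) W s] y
      note l = red_lift[OF A W s] red_lift[OF B W s] red_lift[OF L W s]
      show "e0 W (red_lift U ?L W s) y = e0 W (?S W s) y"
        using yU by (simp add: l red_lincomb(2)[OF U f A B W e0_red_funs[OF Wo s] y] e_simps cc closed U W fc ev[OF U f])
      show "e1 W (red_lift U ?L W s) y = e1 W (?S W s) y"
        using yU by (simp add: l red_lincomb(2)[OF U f A B W e1_red_funs[OF Wo s] y] e_simps cc closed U W fc ev[OF U f])
    qed
  qed
  then have "g U (red_lift U ?L) (red_lift U C) =
      (ev U f \<otimes>\<^bsub>sec M U\<^esub> g U (red_lift U A) (red_lift U C)) \<oplus>\<^bsub>sec M U\<^esub> g U (red_lift U B) (red_lift U C)"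
    using super_metric_lin[OF metric U fc vect_hom_vect[OF U lh(1)] vect_hom_vect[OF U lh(2)] vect_hom_vect[OF U lh(3)]] by simp
  then have "h U ?L C x = f x * h U A C x + h U B C x" if "x \<in> U" for x
    using that by (simp add: h_eq[OF U] A B C L e_simps closed U fc g_closed[OF U lh(1,3)] g_closed[OF U lh(2,3)] ev[OF U f])
  moreover have "(\<lambda>x \<in> U. (\<lambda>x \<in> U. f x * h U A C x) x + h U B C x) \<in> red_funs M U"
    by (intro red_add red_mult U f h_closed A B C)
  ultimately show ?thesis
    by (intro red_eqI[OF h_closed[OF U L C]]) simp_all
qed

text \<open>Additivity on the left is the case of the constant function 1, and symmetry moves it to
  the right.\<close>

lemma h_add_right:
  assumes U: "opn U" and A: "A \<in> vect_hom R U 0" and B: "B \<in> vect_hom R U 0" and C: "C \<in> vect_hom R U 0"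
  shows "h U A (vf_add R U B C) = (\<lambda>x \<in> U. h U A B x + h U A C x)"
proof -
  note o = red_const[OF U, of 1]
  have "vf_scale R U (\<lambda>x \<in> U. 1) B W a = B W a" if W: "W \<in> opens M U" and a: "a \<in> red_funs M W" for W a
  proof -
    note b = red_vf_closed[OF B W a]
    have "vf_scale R U (\<lambda>x \<in> U. 1) B W a = (\<lambda>x \<in> W. restrict (\<lambda>x \<in> U. 1) W x * B W a x)"
      using W a by (simp add: vf_scale_def)
    also have "\<dots> = B W a"
      using opensD(2)[OF W] red_funs_extensional[OF b] by (intro extensionalityI[of _ W]) auto
    finally show ?thesis .
  qed
  then have eq: "vf_add R U B C = vf_add R U (vf_scale R U (\<lambda>x \<in> U. 1) B) C"
    unfolding vf_add_def by (intro restrict_ext) simp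
  note L = red_lincomb(1)[OF U o B C, folded eq]
  have "h U A (vf_add R U B C) = h U (vf_add R U B C) A"
    by (rule h_sym[OF U A L])
  also have "\<dots> = (\<lambda>x \<in> U. (\<lambda>x \<in> U. (\<lambda>x \<in> U. 1) x * h U B A x) x + h U C A x)"
    unfolding eq by (rule h_lin[OF U o B C A])
  also have "\<dots> = (\<lambda>x \<in> U. h U A B x + h U A C x)"
    using h_sym[OF U A B] h_sym[OF U A C] by (intro restrict_ext) simp
  finally show ?thesis .
qed

text \<open>The canonical lift commutes with restriction, so the sheaf property of \<open>g\<close>
  carries over.\<close>

lemma h_res:
  assumes U: "opn U" and A: "A \<in> vect_hom R U 0" and B: "B \<in> vect_hom R U 0" and W: "W \<in> opens M U"
  shows "h W (vf_restrict R W A) (vf_restrict R W B) = restrict (h U A B) W"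
proof -
  note Wo = opn_sub[OF W]
  have hom: "vf_restrict R W A \<in> vect_hom R W 0" "vf_restrict R W B \<in> vect_hom R W 0"
    using red.vf_restrict_vect_hom[of _ U 0 W] A B W U by auto
  have l: "red_lift W (vf_restrict R W C) = vf_restrict M W (red_lift U C)" for C
    using opens_trans[OF W] by (auto simp: red_lift_def vf_restrict_def fun_eq_iff)
  note lh = red_lift_vect_hom[OF A] red_lift_vect_hom[OF B]
  show ?thesis
    unfolding h_eq[OF Wo hom] h_eq[OF U A B] l
      super_metric_res[OF metric U W vect_hom_vect[OF U lh(1)] vect_hom_vect[OF U lh(2)]]
    by (rule e0_res_fun[OF U g_closed[OF U lh] W])
qed

lemma reduced_super_metric: "super_metric R h"
  unfolding super_metric_def base_reduced opens_reduced
proof (intro ballI conjI allI)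
  fix U p q A B assume U: "opn U" and A: "A \<in> vect_hom R U p" and B: "B \<in> vect_hom R U q"
  \<comment> \<open>Any homogeneous field on the reduced manifold is even, the odd ones being zero;
    every parity case thus reduces to even arguments or to the value zero.\<close>
  have z: "C \<in> vect_hom R U 0 \<and> (r \<noteq> 0 \<longrightarrow> C = vf_zero R U)" if "C \<in> vect_hom R U r" for C r
  proof (cases "r = 0")
    case False
    then have "C = vf_zero R U" using red_odd_vf[OF U] that by (simp add: bit_neq_0)
    then show ?thesis using red_vf_zero[OF U, of 0] by simp
  qed (use that in simp)
  have A0: "A \<in> vect_hom R U 0" and B0: "B \<in> vect_hom R U 0" using z A B by auto
  have odd: "h U A B = (\<lambda>x \<in> U. 0)" "h U B A = (\<lambda>x \<in> U. 0)" if "p \<noteq> 0 \<or> q \<noteq> 0"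
    using that z[OF A] z[OF B] h_zero[OF U A0] h_zero[OF U B0] h_sym[OF U A0 B0] by auto
  show "h U A B \<in> gr (sec R U) (p + q)"
  proof (cases "p \<noteq> 0 \<or> q \<noteq> 0")
    case True
    then show ?thesis using odd(1) red_const[OF U, of 0] by simp
  next
    case False
    then show ?thesis using h_closed[OF U A0 B0] by simp
  qed
  show "h U A B = ksign p q \<odot>\<^bsub>sec R U\<^esub> h U B A"
  proof (cases "p \<noteq> 0 \<or> q \<noteq> 0")
    case True
    then show ?thesis using odd by (auto simp: fun_eq_iff)
  next
    case False
    then have "ksign p q = 1" by (simp add: ksign_def)
    then show ?thesis
      using h_sym[OF U A0 B0] extensional_restrict[OF red_funs_extensional[OF h_closed[OF U B0 A0]]] by simp
  qed
next
  fix U f A B C assume U: "opn U" and "f \<in> carrier (sec R U)" "A \<in> vect R U" "B \<in> vect R U" "C \<in> vect R U"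
  then show "h U (vf_add R U (vf_scale R U f A) B) C = (f \<otimes>\<^bsub>sec R U\<^esub> h U A C) \<oplus>\<^bsub>sec R U\<^esub> h U B C"
    using h_lin[OF U, of f A B C] unfolding red_vect[OF U] R_simps carrier_reduced by blast
next
  fix U A B C assume U: "opn U" and "A \<in> vect R U" "B \<in> vect R U" "C \<in> vect R U"
  then show "h U A (vf_add R U B C) = h U A B \<oplus>\<^bsub>sec R U\<^esub> h U A C"
    using h_add_right[OF U, of A B C] unfolding red_vect[OF U] R_simps by blast
next
  fix U W A B assume U: "opn U" and "W \<in> opens M U" "A \<in> vect R U" "B \<in> vect R U"
  then show "h W (vf_restrict R W A) (vf_restrict R W B) = res R U W (h U A B)"
    using h_res[OF U, of A B W] unfolding red_vect[OF U] res_reduced by blast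
qed

text \<open>Compute \<open>g (\<tau> X) Z\<close> in two ways, since \<open>\<tau> X = \<tau> (X \<tau>) Q\<close> for odd \<open>X\<close>.\<close>

lemma g_odd_left:
  assumes U: "opn U" and X: "X \<in> vect_hom M U 1" and Z: "Z \<in> vect_hom M U p" and x: "x \<in> U"
  shows "e0 U (g U X Z) x = e0 U (X U (\<tau> U)) x * e0 U (g U (QU U) Z) x"
proof -
  note Us = opens_self[OF U]
  note t = tau_closed[OF U]
  note Xt = vect_hom_closed[OF X Us t]
  note z = vf_zero_vect_hom[OF U, of 0] and q = QU_hom[OF U]
  let ?f = "\<tau> U \<otimes>\<^bsub>sec M U\<^esub> X U (\<tau> U)"
  have f: "?f \<in> carrier (sec M U)" by (rule mult_closed[OF U t Xt])
  \<comment> \<open>Multiplication by \<open>\<tau>\<close> moves the body into the second component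
    and discards the rest, so only the body of X s is compared, which \<open>odd_field_e0\<close>
    expresses through Q s.\<close>
  have "vf_scale M U (\<tau> U) X = vf_scale M U ?f (QU U)"
    unfolding vf_scale_def
  proof (intro restrict_ext)
    fix W s assume W: "W \<in> opens M U" and s: "s \<in> carrier (sec M W)"
    note Wo = opn_sub[OF W]
    note c = Wo res_closed[OF U W t] res_closed[OF U W f] vect_hom_closed[OF X W s] Q_closed[OF Wo s]
    show "res M U W (\<tau> U) \<otimes>\<^bsub>sec M W\<^esub> X W s = res M U W ?f \<otimes>\<^bsub>sec M W\<^esub> QU U W s"
      unfolding QU_apply[OF W]
    proof (rule sec_eqI[OF Wo])
      fix y assume y: "y \<in> W"
      then have yU: "y \<in> U" using opensD(2)[OF W] by blast
      show "e0 W (res M U W (\<tau> U) \<otimes>\<^bsub>sec M W\<^esub> X W s) y = e0 W (res M U W ?f \<otimes>\<^bsub>sec M W\<^esub> Q W s) y"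
        "e1 W (res M U W (\<tau> U) \<otimes>\<^bsub>sec M W\<^esub> X W s) y = e1 W (res M U W ?f \<otimes>\<^bsub>sec M W\<^esub> Q W s) y"
        using yU by (simp_all add: e_simps closed c y U W t f Xt tau[OF U] e0_Q odd_field_e0[OF X W s y] field_tau_res(1)[OF X U W y])
    qed (simp_all add: closed c)
  qed
  then have "(\<tau> U \<otimes>\<^bsub>sec M U\<^esub> g U X Z) \<oplus>\<^bsub>sec M U\<^esub> g U (vf_zero M U) Z =
      (?f \<otimes>\<^bsub>sec M U\<^esub> g U (QU U) Z) \<oplus>\<^bsub>sec M U\<^esub> g U (vf_zero M U) Z"
    using super_metric_lin[OF metric U t vect_hom_vect[OF U X] vect_hom_vect[OF U z] vect_hom_vect[OF U Z]]
      super_metric_lin[OF metric U f vect_hom_vect[OF U q] vect_hom_vect[OF U z] vect_hom_vect[OF U Z]] by simp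
  \<comment> \<open>The second component of \<open>\<tau>\<close> times a section is the body of
    that section, so this step strips \<open>\<tau>\<close> off both sides.\<close>
  then have "e1 U ((\<tau> U \<otimes>\<^bsub>sec M U\<^esub> g U X Z) \<oplus>\<^bsub>sec M U\<^esub> g U (vf_zero M U) Z) x =
      e1 U ((?f \<otimes>\<^bsub>sec M U\<^esub> g U (QU U) Z) \<oplus>\<^bsub>sec M U\<^esub> g U (vf_zero M U) Z) x"
    by simp
  then show ?thesis
    using x by (simp add: e_simps closed U t f Xt g_closed[OF U X Z] g_closed[OF U z Z] g_closed[OF U q Z] tau[OF U])
qed

text \<open>Graded symmetry makes <Q|Q> its own negative, so its body is zero. Modulo nilpotents an
  odd field pairs like a multiple of Q, first in one slot, then in the other.\<close>

lemma g_odd_odd: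
  assumes U: "opn U" and X: "X \<in> vect_hom M U 1" and Y: "Y \<in> vect_hom M U 1" and x: "x \<in> U"
  shows "e0 U (g U X Y) x = 0"
proof -
  note q = QU_hom[OF U]
  have k: "ksign 1 1 = - 1" by (simp add: ksign_def)
  have "e0 U (g U (QU U) (QU U)) x = 0"
    using g_sym_e0[OF U q q x] by (simp add: k)
  then have "e0 U (g U (QU U) Y) x = 0"
    using g_sym_e0[OF U q Y x] g_odd_left[OF U Y q x] by simp
  then show ?thesis
    using g_odd_left[OF U X Y x] by simp
qed

text \<open>Of the four pairings of parity components, the mixed ones are odd and have no body, the
  odd-odd one vanishes by \<open>g_odd_odd\<close>, and the even-even one is the reduced metric, an
  even field being a lift of its reduction.\<close>

lemma g_vect:
  assumes U: "opn U" and X0: "X0 \<in> vect_hom M U 0" and X1: "X1 \<in> vect_hom M U 1"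
    and Y0: "Y0 \<in> vect_hom M U 0" and Y1: "Y1 \<in> vect_hom M U 1" and x: "x \<in> U"
  shows "e0 U (g U (vf_add M U X0 X1) (vf_add M U Y0 Y1)) x = h U (reduction U X0) (reduction U Y0) x"
proof -
  note o = one_closed[OF U]
  note v = vect_hom_vect[OF U X0] vect_hom_vect[OF U X1] vect_hom_vect[OF U Y0] vect_hom_vect[OF U Y1]
  have Yv: "vf_add M U Y0 Y1 \<in> vect M U" unfolding vect_def using Y0 Y1 by blast
  \<comment> \<open>Linearity is available only for \<open>f X + Y\<close>, so the even part is
    first written as 1 times itself.\<close>
  have "vf_scale M U \<one>\<^bsub>sec M U\<^esub> X0 W s = X0 W s" if W: "W \<in> opens M U" and s: "s \<in> carrier (sec M W)" for W s
  proof -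
    interpret ring "sec M W" by (rule superalgebra_ring[OF sec_superalgebra[OF opn_sub[OF W]]])
    show ?thesis
      using W s vect_hom_closed[OF X0 W s] superalg_hom_one[OF res_hom[OF U W]] by (simp add: vf_scale_def)
  qed
  then have "vf_add M U X0 X1 = vf_add M U (vf_scale M U \<one>\<^bsub>sec M U\<^esub> X0) X1"
    unfolding vf_add_def by (intro restrict_ext) simp
  then have "g U (vf_add M U X0 X1) (vf_add M U Y0 Y1) =
      (\<one>\<^bsub>sec M U\<^esub> \<otimes>\<^bsub>sec M U\<^esub> (g U X0 Y0 \<oplus>\<^bsub>sec M U\<^esub> g U X0 Y1)) \<oplus>\<^bsub>sec M U\<^esub> (g U X1 Y0 \<oplus>\<^bsub>sec M U\<^esub> g U X1 Y1)"
    using super_metric_lin[OF metric U o v(1,2) Yv] super_metric_add[OF metric U v(1) v(3,4)] super_metric_add[OF metric U v(2) v(3,4)]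
    by simp
  then have "e0 U (g U (vf_add M U X0 X1) (vf_add M U Y0 Y1)) x = e0 U (g U X0 Y0) x"
    using x g_mixed_e0[OF U X0 Y1 _ x] g_mixed_e0[OF U X1 Y0 _ x] g_odd_odd[OF U X1 Y1 x]
    by (simp add: e_simps closed U g_closed[OF U X0 Y0] g_closed[OF U X0 Y1] g_closed[OF U X1 Y0] g_closed[OF U X1 Y1])
  then show ?thesis
    using reduced_metric_eq[OF U reduction_is_lift[OF X0] reduction_is_lift[OF Y0]] by simp
qed

end

section \<open>Nondegeneracy\<close>

lemma tangent_homD:
  assumes v: "v \<in> tangent_hom N m p" and W: "W \<in> nbhds N m"
  shows tangent_hom_add: "s \<in> carrier (sec N W) \<Longrightarrow> t \<in> carrier (sec N W) \<Longrightarrow> v W (s \<oplus>\<^bsub>sec N W\<^esub> t) = v W s + v W t"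
    and tangent_hom_odd: "s \<in> gr (sec N W) q \<Longrightarrow> q \<noteq> p \<Longrightarrow> v W s = 0"
    and tangent_hom_leibniz: "s \<in> gr (sec N W) q \<Longrightarrow> t \<in> carrier (sec N W) \<Longrightarrow>
      v W (s \<otimes>\<^bsub>sec N W\<^esub> t) = v W s * eps N W t m + ksign p q * eps N W s m * v W t"
    and tangent_hom_smult: "s \<in> carrier (sec N W) \<Longrightarrow> v W (r \<odot>\<^bsub>sec N W\<^esub> s) = r * v W s"
    and tangent_hom_res: "W' \<in> nbhds N m \<Longrightarrow> W' \<subseteq> W \<Longrightarrow> s \<in> carrier (sec N W) \<Longrightarrow> v W' (res N W W' s) = v W s"
  using assms unfolding tangent_hom_def by blast+

lemma tangent_hom_family: "v \<in> tangent_hom N m p \<Longrightarrow> v \<in> (\<Pi>\<^sub>E W\<in>nbhds N m. carrier (sec N W) \<rightarrow>\<^sub>E UNIV)"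
  by (simp add: tangent_hom_def)

context superringed
begin

lemma tvec_zero_tangent_hom: "tvec_zero N m \<in> tangent_hom N m p"
proof -
  have ap: "tvec_zero N m W s = 0" if "W \<in> nbhds N m" "s \<in> carrier (sec N W)" for W s
    using that by (simp add: tvec_zero_def)
  have A: "superalgebra (sec N W)" if "W \<in> nbhds N m" for W
    using that sec_superalgebra by (simp add: nbhds_iff)
  note g = superalgebra_gr[OF A]
  have c: "s \<oplus>\<^bsub>sec N W\<^esub> t \<in> carrier (sec N W)" "s \<otimes>\<^bsub>sec N W\<^esub> t \<in> carrier (sec N W)" "r \<odot>\<^bsub>sec N W\<^esub> s \<in> carrier (sec N W)"
    if "W \<in> nbhds N m" "s \<in> carrier (sec N W)" "t \<in> carrier (sec N W)" for W s t r
    using that superalgebra_ring[OF A] superalgebra_smult_closed[OF A] by (auto intro: ring.ring_simprules)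
  have r: "res N W W' s \<in> carrier (sec N W')" if "W \<in> nbhds N m" "W' \<in> nbhds N m" "W' \<subseteq> W" "s \<in> carrier (sec N W)" for W W' s
    using superalg_hom_closed[OF res_hom] that by (auto simp: nbhds_iff opens_def)
  show ?thesis
    unfolding tangent_hom_def
  proof (intro CollectI conjI ballI allI impI)
    show "tvec_zero N m \<in> (\<Pi>\<^sub>E W\<in>nbhds N m. carrier (sec N W) \<rightarrow>\<^sub>E UNIV)"
      by (auto simp: tvec_zero_def)
  qed (simp_all add: ap c r g)
qed

lemma tvec_add_zero: "v \<in> tangent_hom N m p \<Longrightarrow> tvec_add N m v (tvec_zero N m) = v"
  by (rule tvec_eqI[OF _ tangent_hom_family]) (auto simp: tvec_add_def tvec_zero_def)

lemma tangent_hom_even_tangent: "v \<in> tangent_hom N m 0 \<Longrightarrow> v \<in> tangent N m"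
  unfolding tangent_def using tvec_zero_tangent_hom[of m 1] tvec_add_zero by force

end

section \<open>Even tangent vectors of \<open>M\<close> as tangent vectors of the reduced
  manifold\<close>

context shander_space
begin

lemma tangent_red: "tangent R m = tangent_hom R m 0"
proof (intro equalityI subsetI)
  fix v assume "v \<in> tangent R m"
  then obtain v0 v1 where v: "v0 \<in> tangent_hom R m 0" "v1 \<in> tangent_hom R m 1" "v = tvec_add R m v0 v1"
    unfolding tangent_def by blast
  have "v1 W a = 0" if "W \<in> nbhds R m" "a \<in> carrier (sec R W)" for W a
    using tangent_hom_odd[OF v(2) that(1), of a 0] that(2) by simp
  then have "v = v0"
    unfolding v(3) by (intro tvec_eqI[OF _ tangent_hom_family[OF v(1)]]) (auto simp: tvec_add_def)
  then show "v \<in> tangent_hom R m 0" using v by simp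
qed (rule red.tangent_hom_even_tangent)

lemma nbhds_opn: "W \<in> nbhds M m \<Longrightarrow> opn W" "W \<in> nbhds M m \<Longrightarrow> m \<in> W"
  by (auto simp: nbhds_iff)

text \<open>Composition with the splitting \<open>ev\<close>; \<open>sharp\<close> is composition
  with \<epsilon>, the differential of the canonical embedding of the reduced manifold. On even
  vectors they are inverse to each other, because an even vector ignores the part s1 \<tau> of a
  section.\<close>

definition flat :: "'a \<Rightarrow> ('a, 's) tvec \<Rightarrow> ('a, 'a \<Rightarrow> real) tvec" where
  "flat m w = (\<lambda>W \<in> nbhds M m. \<lambda>a \<in> red_funs M W. w W (ev W a))"

definition sharp :: "'a \<Rightarrow> ('a, 'a \<Rightarrow> real) tvec \<Rightarrow> ('a, 's) tvec" where
  "sharp m v = (\<lambda>W \<in> nbhds M m. \<lambda>s \<in> carrier (sec M W). v W (e0 W s))"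

lemma sharp_tangent_hom:
  assumes v: "v \<in> tangent_hom R m 0"
  shows "sharp m v \<in> tangent_hom M m 0"
proof -
  have ap: "sharp m v W s = v W (e0 W s)" if "W \<in> nbhds M m" "s \<in> carrier (sec M W)" for W s
    using that by (simp add: sharp_def)
  show ?thesis
    unfolding tangent_hom_def
  proof (intro CollectI conjI ballI allI impI)
    show "sharp m v \<in> (\<Pi>\<^sub>E W\<in>nbhds M m. carrier (sec M W) \<rightarrow>\<^sub>E UNIV)"
      by (auto simp: sharp_def)
  next
    fix W s t assume W: "W \<in> nbhds M m" and s: "s \<in> carrier (sec M W)" and t: "t \<in> carrier (sec M W)"
    note Wo = nbhds_opn(1)[OF W]
    show "sharp m v W (s \<oplus>\<^bsub>sec M W\<^esub> t) = sharp m v W s + sharp m v W t"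
      using red_tangent_add[OF v W e0_red_funs[OF Wo s] e0_red_funs[OF Wo t]]
      by (simp add: ap[OF W] closed Wo s t e0_add_fun)
  next
    fix W r s assume W: "W \<in> nbhds M m" and s: "s \<in> carrier (sec M W)"
    note Wo = nbhds_opn(1)[OF W]
    show "sharp m v W (r \<odot>\<^bsub>sec M W\<^esub> s) = r * sharp m v W s"
      using red_tangent_smult[OF v W e0_red_funs[OF Wo s] e0_red_funs[OF Wo s]]
      by (simp add: ap[OF W] closed Wo s e0_smult_fun)
  next
    fix W s and q :: bit assume W: "W \<in> nbhds M m" and q: "q \<noteq> 0" and s: "s \<in> gr (sec M W) q"
    note Wo = nbhds_opn(1)[OF W]
    have "s \<in> gr (sec M W) 1" using s q by (simp add: bit_neq_0)
    then have "e0 W s = (\<lambda>x \<in> W. 0)"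
      using gr_closed[OF Wo s] by (intro red_eqI[OF e0_red_funs[OF Wo] red_const[OF Wo]]) (simp_all add: gr1_iff[OF Wo])
    then show "sharp m v W s = 0"
      using red_tangent_const[OF v W, of 0] by (simp add: ap[OF W gr_closed[OF Wo s]])
  next
    fix W q s t assume W: "W \<in> nbhds M m" and s: "s \<in> gr (sec M W) q" and t: "t \<in> carrier (sec M W)"
    note Wo = nbhds_opn(1)[OF W]
    have s': "s \<in> carrier (sec M W)" by (rule gr_closed[OF Wo s])
    show "sharp m v W (s \<otimes>\<^bsub>sec M W\<^esub> t) = sharp m v W s * e0 W t m + ksign 0 q * e0 W s m * sharp m v W t"
      using red_tangent_mult[OF v W e0_red_funs[OF Wo s'] e0_red_funs[OF Wo t]]
      by (simp add: ap[OF W] closed Wo s' t e0_mult_fun ksign_def)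
  next
    fix W W' s assume W: "W \<in> nbhds M m" and W': "W' \<in> nbhds M m" and sub: "W' \<subseteq> W" and s: "s \<in> carrier (sec M W)"
    note Wo = nbhds_opn(1)[OF W]
    have o: "W' \<in> opens M W" using W' sub by (auto simp: nbhds_def opens_def)
    show "sharp m v W' (res M W W' s) = sharp m v W s"
      using red_tangent_res[OF v W e0_red_funs[OF Wo s] e0_red_funs[OF Wo s] W' sub]
      by (simp add: ap[OF W s] ap[OF W' res_closed[OF Wo o s]] e0_res_fun[OF Wo s o])
  qed
qed

lemma flat_tangent_hom:
  assumes w: "w \<in> tangent_hom M m 0"
  shows "flat m w \<in> tangent_hom R m 0"
proof -
  have ap: "flat m w W a = w W (ev W a)" if "W \<in> nbhds M m" "a \<in> red_funs M W" for W a
    using that by (simp add: flat_def)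
  have k: "ksign 0 q = 1" for q by (simp add: ksign_def)
  have smult: "flat m w W (\<lambda>x \<in> W. r * a x) = r * flat m w W a" if W: "W \<in> nbhds M m" and a: "a \<in> red_funs M W" for W r a
  proof -
    note Wo = nbhds_opn(1)[OF W]
    have "ev W (\<lambda>x \<in> W. r * a x) = r \<odot>\<^bsub>sec M W\<^esub> ev W a"
      by (rule sec_eqI[OF Wo]) (simp_all add: closed Wo ev a red_smult e_simps)
    then show ?thesis
      using tangent_hom_smult[OF w W ev_closed[OF Wo a]] by (simp add: ap[OF W] a red_smult Wo)
  qed
  have mult: "flat m w W (\<lambda>x \<in> W. a x * b x) = flat m w W a * b m + a m * flat m w W b"
    if W: "W \<in> nbhds M m" and a: "a \<in> red_funs M W" and b: "b \<in> red_funs M W" for W a b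
  proof -
    note Wo = nbhds_opn(1)[OF W]
    have "ev W (\<lambda>x \<in> W. a x * b x) = ev W a \<otimes>\<^bsub>sec M W\<^esub> ev W b"
      by (rule sec_eqI[OF Wo]) (simp_all add: closed Wo ev a b red_mult e_simps)
    then show ?thesis
      using tangent_hom_leibniz[OF w W ev_gr[OF Wo a] ev_closed[OF Wo b]]
      by (simp add: ap[OF W] a b red_mult Wo k e0_ev)
  qed
  have zero: "flat m w W (\<lambda>x \<in> W. 0) = 0" if W: "W \<in> nbhds M m" for W
  proof -
    have "(\<lambda>x \<in> W. 0 * (\<lambda>x \<in> W. 0) x) = (\<lambda>x \<in> W. 0 :: real)" by auto
    then show ?thesis using smult[OF W red_const[OF nbhds_opn(1)[OF W], of 0], of 0] by simp
  qed
  show ?thesis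
    unfolding tangent_hom_def
  proof (intro CollectI conjI ballI allI impI)
    show "flat m w \<in> (\<Pi>\<^sub>E W\<in>nbhds R m. carrier (sec R W) \<rightarrow>\<^sub>E UNIV)"
      by (auto simp: flat_def)
  next
    fix W a b assume "W \<in> nbhds R m" "a \<in> carrier (sec R W)" "b \<in> carrier (sec R W)"
    then have W: "W \<in> nbhds M m" and a: "a \<in> red_funs M W" and b: "b \<in> red_funs M W" by simp_all
    note Wo = nbhds_opn(1)[OF W]
    have "ev W (\<lambda>x \<in> W. a x + b x) = ev W a \<oplus>\<^bsub>sec M W\<^esub> ev W b"
      by (rule sec_eqI[OF Wo]) (simp_all add: closed Wo ev a b red_add e_simps)
    then show "flat m w W (a \<oplus>\<^bsub>sec R W\<^esub> b) = flat m w W a + flat m w W b"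
      using tangent_hom_add[OF w W ev_closed[OF Wo a] ev_closed[OF Wo b]] by (simp add: ap[OF W] a b red_add Wo)
  next
    fix W r a assume "W \<in> nbhds R m" "a \<in> carrier (sec R W)"
    then show "flat m w W (r \<odot>\<^bsub>sec R W\<^esub> a) = r * flat m w W a" using smult by simp
  next
    fix W a and q :: bit assume "W \<in> nbhds R m" "q \<noteq> 0" "a \<in> gr (sec R W) q"
    then show "flat m w W a = 0" using zero by simp
  next
    fix W q a b assume "W \<in> nbhds R m" and a: "a \<in> gr (sec R W) q" and "b \<in> carrier (sec R W)"
    then have W: "W \<in> nbhds M m" and b: "b \<in> red_funs M W" by simp_all
    note Wo = nbhds_opn(1)[OF W]
    have a': "a \<in> red_funs M W" using a red_const[OF Wo] by (auto split: if_splits)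
    show "flat m w W (a \<otimes>\<^bsub>sec R W\<^esub> b) = flat m w W a * eps R W b m + ksign 0 q * eps R W a m * flat m w W b"
      using mult[OF W a' b] by (simp add: k eps_reduced[OF Wo] a' b)
  next
    fix W W' a assume "W \<in> nbhds R m" "W' \<in> nbhds R m" and sub: "W' \<subseteq> W" and "a \<in> carrier (sec R W)"
    then have W: "W \<in> nbhds M m" and W': "W' \<in> nbhds M m" and a: "a \<in> red_funs M W" by simp_all
    note Wo = nbhds_opn(1)[OF W]
    have o: "W' \<in> opens M W" using W' sub by (auto simp: nbhds_def opens_def)
    show "flat m w W' (res R W W' a) = flat m w W a"
      using tangent_hom_res[OF w W W' sub ev_closed[OF Wo a]]
      by (simp add: ap[OF W a] ap[OF W' red_restrict[OF Wo o a]] ev_res[OF Wo o a])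
  qed
qed

text \<open>Both Leibniz terms of s1 \<tau> vanish: \<open>\<tau>\<close> has value 0 at
  \<open>m\<close>, and an even vector kills the odd section \<open>\<tau>\<close>.\<close>

lemma tangent_even_decomp:
  assumes w: "w \<in> tangent_hom M m 0" and W: "W \<in> nbhds M m" and s: "s \<in> carrier (sec M W)"
  shows "w W s = flat m w W (e0 W s)"
proof -
  note Wo = nbhds_opn(1)[OF W]
  note r = e0_red_funs[OF Wo s] e1_red_funs[OF Wo s]
  note c = ev_closed[OF Wo r(1)] ev_closed[OF Wo r(2)] tau_closed[OF Wo]
  have "w W (ev W (e1 W s) \<otimes>\<^bsub>sec M W\<^esub> \<tau> W) = 0"
    using tangent_hom_leibniz[OF w W ev_gr[OF Wo r(2)] c(3)] tangent_hom_odd[OF w W tau_gr[OF Wo]]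
      e0_tau[OF Wo nbhds_opn(2)[OF W]] by simp
  then show ?thesis
    using sec_decomp[OF Wo s] tangent_hom_add[OF w W c(1) mult_closed[OF Wo c(2,3)]] W r by (simp add: flat_def)
qed

text \<open>An odd vector kills even sections, so only s1 \<tau> counts and the vector is the
  multiple w(\<tau>) of the value of Q at \<open>m\<close>.\<close>

lemma tangent_odd_decomp:
  assumes w: "w \<in> tangent_hom M m 1" and W: "W \<in> nbhds M m" and s: "s \<in> carrier (sec M W)"
  shows "w W s = e1 W s m * w W (\<tau> W)"
proof -
  note Wo = nbhds_opn(1)[OF W]
  note r = e0_red_funs[OF Wo s] e1_red_funs[OF Wo s]
  note c = ev_closed[OF Wo r(1)] ev_closed[OF Wo r(2)] tau_closed[OF Wo]
  have "w W (ev W (e1 W s) \<otimes>\<^bsub>sec M W\<^esub> \<tau> W) = e1 W s m * w W (\<tau> W)"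
    using tangent_hom_leibniz[OF w W ev_gr[OF Wo r(2)] c(3)] tangent_hom_odd[OF w W ev_gr[OF Wo r(2)]]
      e0_ev[OF Wo r(2)] by (simp add: ksign_def)
  then show ?thesis
    using sec_decomp[OF Wo s] tangent_hom_add[OF w W c(1) mult_closed[OF Wo c(2,3)]]
      tangent_hom_odd[OF w W ev_gr[OF Wo r(1)]] by simp
qed

lemma vf_at_apply:
  "W \<in> nbhds M m \<Longrightarrow> s \<in> carrier (sec M W) \<Longrightarrow> vf_at M U X m W s = e0 (W \<inter> U) (X (W \<inter> U) (res M W (W \<inter> U) s)) m"
  by (simp add: vf_at_def)

text \<open>The odd summand sends \<open>ev\<close> of a function to an odd section, which has no
  value, so on such sections only the even summand is seen.\<close>

lemma vf_at_reduction:
  assumes U: "U \<in> nbhds M m" and X0: "X0 \<in> vect_hom M U 0" and X1: "X1 \<in> vect_hom M U 1"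
    and W: "W \<in> nbhds M m" and a: "a \<in> red_funs M W"
  shows "vf_at R U (reduction U X0) m W a = vf_at M U (vf_add M U X0 X1) m W (ev W a)"
proof -
  note Wo = nbhds_opn(1)[OF W] and Uo = nbhds_opn(1)[OF U]
  let ?V = "W \<inter> U"
  have V: "?V \<in> opens M W" "?V \<in> opens M U" "opn ?V" "m \<in> ?V"
    using opens_Int_left[OF W U] by (auto simp: nbhds_iff)
  note ra = red_restrict[OF Wo V(1) a]
  note c = ev_closed[OF V(3) ra]
  have "X1 ?V (ev ?V (restrict a ?V)) \<in> gr (sec M ?V) 1"
    using vect_hom_gr[OF X1 V(2) ev_gr[OF V(3) ra]] by simp
  then have "e0 ?V (X1 ?V (ev ?V (restrict a ?V))) m = 0"
    using V(4) by (simp add: gr1_iff[OF V(3)])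
  then have "vf_at M U (vf_add M U X0 X1) m W (ev W a) = e0 ?V (X0 ?V (ev ?V (restrict a ?V))) m"
    using V by (simp add: vf_at_apply[OF W ev_closed[OF Wo a]] ev_res[OF Wo V(1) a] vf_add_def c
        e0_add[OF V(3) vect_hom_closed[OF X0 V(2) c] vect_hom_closed[OF X1 V(2) c] V(4)])
  then show ?thesis
    using vf_at_red[OF U reduction_vect_hom[OF Uo X0] W a] reduction_apply[OF V(2) ra] by simp
qed

end

context shander_metric
begin

section \<open>Comparison of the kernels of the two forms\<close>

sublocale tensor: reduced_tensor M n Q P "reduced_metric M g"
  by unfold_locales (rule reduced_super_metric)

text \<open>The uniqueness half of evaluating \<open>form_at\<close> on \<open>sharp m v\<close>:
  for any extension X and any Y at all, the value is the reduced metric on the reductions, and the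
  reduction of X takes the value \<open>v\<close> at \<open>m\<close>.\<close>

lemma form_at_sharp_aux:
  assumes v: "v \<in> form_kernel R h m" and U: "U \<in> nbhds M m"
    and X: "X \<in> vect M U" and Y: "Y \<in> vect M U" and vX: "vf_at M U X m = sharp m v"
  shows "e0 U (g U X Y) m = 0"
proof -
  note Uo = nbhds_opn(1)[OF U]
  have v': "v \<in> tangent_hom R m 0" "\<And>w. w \<in> tangent_hom R m 0 \<Longrightarrow> form_at R h m v w = 0"
    using v unfolding form_kernel_def tangent_red by auto
  obtain X0 X1 where X01: "X0 \<in> vect_hom M U 0" "X1 \<in> vect_hom M U 1" "X = vf_add M U X0 X1"
    using X unfolding vect_def by blast
  obtain Y0 Y1 where Y01: "Y0 \<in> vect_hom M U 0" "Y1 \<in> vect_hom M U 1" "Y = vf_add M U Y0 Y1"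
    using Y unfolding vect_def by blast
  note rX = reduction_vect_hom[OF Uo X01(1)] and rY = reduction_vect_hom[OF Uo Y01(1)]
  have "vf_at R U (reduction U X0) m = v"
  proof (rule tvec_eqI[OF _ tangent_hom_family[OF v'(1)]])
    show "vf_at R U (reduction U X0) m \<in> (\<Pi>\<^sub>E W\<in>nbhds R m. carrier (sec R W) \<rightarrow>\<^sub>E UNIV)"
      by (auto simp: vf_at_def)
    fix W a assume "W \<in> nbhds R m" "a \<in> carrier (sec R W)"
    then have W: "W \<in> nbhds M m" and a: "a \<in> red_funs M W" by simp_all
    note Wo = nbhds_opn(1)[OF W]
    show "vf_at R U (reduction U X0) m W a = v W a"
      using vf_at_reduction[OF U X01(1,2) W a] vX W ev_closed[OF Wo a] by (simp add: X01(3) sharp_def e0_ev[OF Wo a])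
  qed
  then have "h U (reduction U X0) (reduction U Y0) m = 0"
    using tensor.form_at_red[OF U rX rY] v'(2)[OF vf_at_red_tangent[OF U rY]] by simp
  then show ?thesis
    using g_vect[OF Uo X01(1,2) Y01(1,2) nbhds_opn(2)[OF U]] by (simp add: X01(3) Y01(3))
qed

text \<open>Besides uniqueness, the definite description needs extensions of both vectors to exist
  on a common neighbourhood. The even parts are extended on the reduced manifold and lifted, the odd
  part is extended by a multiple of Q.\<close>

lemma sharp_form_kernel:
  assumes m: "m \<in> points M" and v: "v \<in> form_kernel R h m"
  shows "sharp m v \<in> form_kernel M g m"
  unfolding form_kernel_def
proof (intro CollectI conjI ballI)
  have v': "v \<in> tangent_hom R m 0"
    using v unfolding form_kernel_def tangent_red by auto
  show "sharp m v \<in> tangent M m"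
    by (rule tangent_hom_even_tangent[OF sharp_tangent_hom[OF v']])
  fix w assume "w \<in> tangent M m"
  then obtain w0 w1 where w0: "w0 \<in> tangent_hom M m 0" and w1: "w1 \<in> tangent_hom M m 1" and w: "w = tvec_add M m w0 w1"
    unfolding tangent_def by blast
  obtain U \<phi> where C: "m \<in> U" "red_chart U \<phi>" using red_chart_exists[OF m] .
  have U: "U \<in> nbhds M m" using C rc_opn[OF C(2)] by (simp add: nbhds_iff)
  note Uo = nbhds_opn(1)[OF U]
  obtain A where A: "A \<in> vect_hom R U 0" "vf_at R U A m = v"
    using red_tangent_extension[OF m v' C] by blast
  obtain B where B: "B \<in> vect_hom R U 0" "vf_at R U B m = flat m w0"
    using red_tangent_extension[OF m flat_tangent_hom[OF w0] C] by blast
  \<comment> \<open>The odd part of \<open>w\<close> is w1(\<tau>) times the value of Q at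
    \<open>m\<close>; the coefficient is kept constant.\<close>
  define c where "c = (\<lambda>x \<in> U. w1 U (\<tau> U))"
  have c: "c \<in> red_funs M U" unfolding c_def by (rule red_const[OF Uo])
  define X where "X = red_lift U A"
  define Y1 where "Y1 = vf_scale M U (ev U c) (QU U)"
  define Y where "Y = vf_add M U (red_lift U B) Y1"
  have Y1: "Y1 \<in> vect_hom M U 1"
    unfolding Y1_def by (rule vf_scale_even_vect_hom[OF Uo ev_gr[OF Uo c] QU_hom[OF Uo]])
  have X: "X \<in> vect M U" unfolding X_def by (rule vect_hom_vect[OF Uo red_lift_vect_hom[OF A(1)]])
  have Y: "Y \<in> vect M U" unfolding Y_def vect_def using red_lift_vect_hom[OF B(1)] Y1 by blast
  have vX: "vf_at M U X m = sharp m v"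
  proof (rule tvec_eqI[where N = M and m = m])
    show "vf_at M U X m \<in> (\<Pi>\<^sub>E W\<in>nbhds M m. carrier (sec M W) \<rightarrow>\<^sub>E UNIV)"
      "sharp m v \<in> (\<Pi>\<^sub>E W\<in>nbhds M m. carrier (sec M W) \<rightarrow>\<^sub>E UNIV)"
      by (auto simp: vf_at_def sharp_def)
    fix W s assume W: "W \<in> nbhds M m" and s: "s \<in> carrier (sec M W)"
    note Wo = nbhds_opn(1)[OF W]
    have V: "W \<inter> U \<in> opens M W" "W \<inter> U \<in> opens M U" using opens_Int_left[OF W U] by auto
    have "vf_at M U X m W s = vf_at R U A m W (e0 W s)"
      using vf_at_red[OF U A(1) W e0_red_funs[OF Wo s]]
      by (simp add: vf_at_apply[OF W s] X_def e0_red_lift[OF A(1) V(2) res_closed[OF Wo V(1) s]] e0_res_fun[OF Wo s V(1)])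
    then show "vf_at M U X m W s = sharp m v W s"
      using W s by (simp add: A(2) sharp_def)
  qed
  have wY: "vf_at M U Y m = w"
  proof (rule tvec_eqI[where N = M and m = m])
    show "vf_at M U Y m \<in> (\<Pi>\<^sub>E W\<in>nbhds M m. carrier (sec M W) \<rightarrow>\<^sub>E UNIV)"
      "w \<in> (\<Pi>\<^sub>E W\<in>nbhds M m. carrier (sec M W) \<rightarrow>\<^sub>E UNIV)"
      by (auto simp: vf_at_def w tvec_add_def)
    fix W s assume W: "W \<in> nbhds M m" and s: "s \<in> carrier (sec M W)"
    let ?V = "W \<inter> U"
    note Wo = nbhds_opn(1)[OF W]
    have V: "?V \<in> opens M W" "?V \<in> opens M U" "?V \<in> nbhds M m" using opens_Int_left[OF W U] by auto
    note Vo = nbhds_opn[OF V(3)]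
    note rs = res_closed[OF Wo V(1) s]
    \<comment> \<open>The coefficient was taken over \<open>U\<close>, while the decomposition of
      \<open>w1\<close> is used over \<open>W\<close>; since \<open>\<tau>\<close> restricts to
      \<open>\<tau>\<close>, both agree.\<close>
    have wt: "w1 W (\<tau> W) = w1 U (\<tau> U)"
      using tangent_hom_res[OF w1 W V(3) _ tau_closed[OF Wo]] tangent_hom_res[OF w1 U V(3) _ tau_closed[OF Uo]]
      by (simp add: tau_res[OF Wo V(1)] tau_res[OF Uo V(2)])
    have cm: "e0 U (ev U c) m = w1 U (\<tau> U)"
      unfolding e0_ev[OF Uo c] using C(1) by (simp add: c_def)
    have "Y1 ?V (res M W ?V s) = res M U ?V (ev U c) \<otimes>\<^bsub>sec M ?V\<^esub> Q ?V (res M W ?V s)"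
      using V rs by (simp add: Y1_def vf_scale_def QU_apply)
    then have "e0 ?V (Y1 ?V (res M W ?V s)) m = w1 U (\<tau> U) * e1 W s m"
      using e0_mult[OF Vo(1) res_closed[OF Uo V(2) ev_closed[OF Uo c]] Q_closed[OF Vo(1) rs] Vo(2)]
        e0_res[OF Uo V(2) ev_closed[OF Uo c] Vo(2)] e1_res[OF Wo V(1) s Vo(2)]
      by (simp add: cm e0_Q)
    moreover have "e0 ?V (red_lift U B ?V (res M W ?V s)) m = flat m w0 W (e0 W s)"
      using vf_at_red[OF U B(1) W e0_red_funs[OF Wo s]]
      by (simp add: B(2) e0_red_lift[OF B(1) V(2) rs] e0_res_fun[OF Wo s V(1)])
    moreover have "Y ?V (res M W ?V s) = red_lift U B ?V (res M W ?V s) \<oplus>\<^bsub>sec M ?V\<^esub> Y1 ?V (res M W ?V s)"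
      using V rs by (simp add: Y_def vf_add_def)
    ultimately have "vf_at M U Y m W s = flat m w0 W (e0 W s) + w1 U (\<tau> U) * e1 W s m"
      using e0_add[OF Vo(1) vect_hom_closed[OF red_lift_vect_hom[OF B(1)] V(2) rs] vect_hom_closed[OF Y1 V(2) rs] Vo(2)]
      by (simp add: vf_at_apply[OF W s])
    also have "\<dots> = w W s"
      using tangent_even_decomp[OF w0 W s] tangent_odd_decomp[OF w1 W s] W s by (simp add: w tvec_add_def wt)
    finally show "vf_at M U Y m W s = w W s" .
  qed
  show "form_at M g m (sharp m v) w = 0"
    unfolding form_at_def
  proof (rule the_equality)
    show "\<exists>U \<in> nbhds M m. \<exists>X \<in> vect M U. \<exists>Y \<in> vect M U.
        vf_at M U X m = sharp m v \<and> vf_at M U Y m = w \<and> 0 = e0 U (g U X Y) m"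
      using U X Y vX wY form_at_sharp_aux[OF v U X Y vX] by (metis (no_types, lifting))
    fix r assume "\<exists>U \<in> nbhds M m. \<exists>X \<in> vect M U. \<exists>Y \<in> vect M U.
        vf_at M U X m = sharp m v \<and> vf_at M U Y m = w \<and> r = e0 U (g U X Y) m"
    then obtain U' X' Y' where "U' \<in> nbhds M m" "X' \<in> vect M U'" "Y' \<in> vect M U'"
      "vf_at M U' X' m = sharp m v" "r = e0 U' (g U' X' Y') m"
      by blast
    then show "r = 0" using form_at_sharp_aux[OF v] by blast
  qed
qed

text \<open>\<open>sharp\<close> maps the reduced kernel to even kernel vectors of \<open>M\<close>,
  of which only zero exists. The other inclusion also needs an argument, because the form at the
  zero vector is a definite description: it is evaluated on the zero field.\<close>

lemma reduced_form_kernel: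
  assumes m: "m \<in> points M" and ker: "form_kernel M g m \<inter> tangent_hom M m 0 = {tvec_zero M m}"
  shows "form_kernel R h m = {tvec_zero R m}"
proof (intro equalityI subsetI)
  fix v assume v: "v \<in> form_kernel R h m"
  then have v': "v \<in> tangent_hom R m 0" unfolding form_kernel_def tangent_red by auto
  have "sharp m v = tvec_zero M m"
    using sharp_form_kernel[OF m v] sharp_tangent_hom[OF v'] ker by blast
  \<comment> \<open>Injectivity of \<open>sharp\<close>: every reduced function is the body of its
    image under \<open>ev\<close>.\<close>
  moreover have "v W a = sharp m v W (ev W a)" if W: "W \<in> nbhds M m" and a: "a \<in> red_funs M W" for W a
    using W ev_closed[OF nbhds_opn(1)[OF W] a] e0_ev[OF nbhds_opn(1)[OF W] a] by (simp add: sharp_def)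
  ultimately have "v W a = tvec_zero R m W a" if "W \<in> nbhds R m" "a \<in> carrier (sec R W)" for W a
    using that ev_closed[OF nbhds_opn(1)] by (simp add: tvec_zero_def)
  then have "v = tvec_zero R m"
    by (intro tvec_eqI[OF tangent_hom_family[OF v'] tangent_hom_family[OF red.tvec_zero_tangent_hom[of m 0]]])
  then show "v \<in> {tvec_zero R m}" by simp
next
  fix v assume "v \<in> {tvec_zero R m}"
  then have v: "v = tvec_zero R m" by simp
  have "form_at R h m v w = 0" if w: "w \<in> tangent_hom R m 0" for w
  proof -
    obtain U \<phi> where C: "m \<in> U" "red_chart U \<phi>" using red_chart_exists[OF m] .
    have U: "U \<in> nbhds M m" using C rc_opn[OF C(2)] by (simp add: nbhds_iff)
    note Uo = nbhds_opn(1)[OF U]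
    obtain B where B: "B \<in> vect_hom R U 0" "vf_at R U B m = w"
      using red_tangent_extension[OF m w C] by blast
    note z = red_vf_zero[OF Uo, of 0]
    have "vf_at R U (vf_zero R U) m = v"
      unfolding v
    proof (rule tvec_eqI[OF tangent_hom_family[OF vf_at_red_tangent[OF U z]] tangent_hom_family[OF red.tvec_zero_tangent_hom[of m 0]]])
      fix W a assume "W \<in> nbhds R m" "a \<in> carrier (sec R W)"
      then have W: "W \<in> nbhds M m" and a: "a \<in> red_funs M W" by simp_all
      have V: "W \<inter> U \<in> opens M W" "W \<inter> U \<in> opens M U" "m \<in> W \<inter> U" using opens_Int_left[OF W U] by (auto simp: nbhds_iff)
      show "vf_at R U (vf_zero R U) m W a = tvec_zero R m W a"
        unfolding vf_at_red[OF U z W a]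
        using V W a red_restrict[OF nbhds_opn(1)[OF W] V(1) a] by (simp add: vf_zero_def tvec_zero_def)
    qed
    then show ?thesis
      using tensor.form_at_red[OF U z B(1)] h_zero[OF Uo B(1)] C(1) by (simp add: B(2))
  qed
  then show "v \<in> form_kernel R h m"
    unfolding form_kernel_def tangent_red using red.tvec_zero_tangent_hom[of m 0] v by blast
qed

end

theorem proposition2p3:
  fixes M :: "('a, 's) superspace"
    and g :: "('a, 's) tensor2"
    and Q P :: "('a, 's) vf"
  assumes "super_null_riemannian TYPE('n::finite) M g Q P"
  shows "pseudo_riemannian TYPE('n) (reduced M) (reduced_metric M g)"
proof -
  note a = assms[unfolded super_null_riemannian_def supermanifold_def]
  interpret shander_metric M "TYPE('n)" Q P g
    by unfold_locales (use a in blast)+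
  have "supermanifold TYPE('n) 0 (reduced M)"
    using a by (intro reduced_supermanifold) blast+
  moreover have "form_kernel (reduced M) (reduced_metric M g) m = {tvec_zero (reduced M) m}" if "m \<in> points M" for m
    using a that by (intro reduced_form_kernel) (auto simp: kernel_dim_0_1_def)
  ultimately show ?thesis
    using reduced_super_metric by (simp add: pseudo_riemannian_def)
qed

end
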